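(* Let $\alpha:B\to B\otimes A$ be a coaction of a compact quantum group $(A,\Delta)$ on $B$ which preserves $\psi$, with unitary implementation $U$. Let $A_G\in\mathcal B(L^2(B))$ be self-adjoint with $m(A_G\otimes A_G)m^*=A_G$ and $(1\otimes\eta^*m)(1\otimes A_G\otimes1)(m^*\eta\otimes1)=A_G$, and let $S_0\subseteq\mathcal B(L^2(B))$ be the $B'$-operator bimodule generated by $A_G$. The following are equivalent: (1) $\alpha$ acts on $A_G$, that is, $U(A_G\otimes1)=(A_G\otimes1)U$; (2) $\alpha_U$ leaves $S_0'=\kappa(S_0)$ invariant, that is, $\alpha_U(S_0')\subseteq S_0'\otimes A$; (3) $\alpha_U^{\mathrm{op}}(S_0)\subseteq S_0\otimes A$.
   Context: $B$ is a finite-dimensional $C^*$-algebra, $\mathrm{Tr}$ the sum of the non-normalised traces of its matrix blocks, $\psi$ a faithful state on $B$, $Q\in B$ the positive invertible element with $\psi(a)=\mathrm{Tr}(Qa)$, and $\sigma_z(a)=Q^{iz}aQ^{-iz}$. $L^2(B)$ is the GNS space of $\psi$ with GNS map $\Lambda$ (a linear bijection), $(\Lambda(a)|\Lambda(b))=\psi(a^*b)$ (linear in the right variable), $B$ acting by $a\Lambda(b)=\Lambda(ab)$, and $B'$ is the commutant of $B$ in $\mathcal B(L^2(B))$. $m(\Lambda(a)\otimes\Lambda(b))=\Lambda(ab)$ with Hilbert space adjoint $m^*$; $\eta:\mathbb C\to L^2(B)$, $\lambda\mapsto\lambda\Lambda(1)$, with adjoint $\eta^*$. $J$ is the antilinear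 modular conjugation $J\Lambda(a)=\Lambda(\sigma_{i/2}(a)^* )$, which satisfies $J^2=1$, $JBJ=B'$. $(A,\Delta)$ is a ($C^*$-algebraic) compact quantum group such that $A$ admits a unitary antipode $R$ (for instance, $A$ is in universal form): $R:A\to A$ is the $*$-preserving anti-automorphism with $R^2=\mathrm{id}$ and $\sigma(R\otimes R)\Delta=\Delta R$ ($\sigma$ the tensor swap), extending the unitary antipode of the dense Hopf $*$-algebra $\mathcal O_A$, where the antipode $S$ of $\mathcal O_A$ factors as $S=R\tau_{-i/2}$ with $(\tau_t)$ the scaling group. A coaction of $(A,\Delta)$ on $B$ is a unital $*$-homomorphism $\alpha:B\to B\otimes A$ with $(\alpha\otimes\mathrm{id})\alpha=(\mathrm{id}\otimes\Delta)\alpha$ and $\mathrm{lin}\{(1\otimes a)\alpha(b):a\in A,b\in B\}$ dense in $B\otimes A$; it preserves $\psi$ if $(\psi\otimes\mathrm{id})\alpha(b)=\psi(b)1$ for all $b\in B$. With $A$ faithfully and non-degenerately represented on a Hilbert space $K$, the unitary implementation is the unitary $U$ on $L^2(B)\otimes K$, $U(\Lambda(b)\otimes\xi)=\alpha(b)(\Lambda(1)\otimes\xi)$; in fact $U\in\mathcal B(L^2(B))\otimes A$. Define $\kappa:\mathcal B(L^2(B))\to\mathcal B(L^2(B))$, $\kappa(x)=Jx^*J$; $\alpha_U:\mathcal B(L^2(B))\to\mathcal B(L^2(B))\otimes A$, $\alpha_U(x)=U(x\otimes1)U^*$; and $\alpha_U^{\mathrm{op}}(x)=(\kappa\otimes R)\alpha_U(\kappa(x))$.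 The $B'$-operator bimodule generated by $A_G$ is $\mathrm{lin}\{xA_Gy:x,y\in B'\}$. *)

theory Defs
  imports "HOL-Analysis.Analysis"
begin

section \<open>Complex vector spaces, Hilbert spaces and C*-algebras\<close>

class scaleC =
  fixes scaleC :: "complex \<Rightarrow> 'a \<Rightarrow> 'a"  (infixr \<open>*\<^sub>C\<close> 75)

class complex_normed_vector = real_normed_vector + scaleC +
  assumes scaleC_add_right: "c *\<^sub>C (x + y) = c *\<^sub>C x + c *\<^sub>C y"
    and scaleC_add_left: "(c + d) *\<^sub>C x = c *\<^sub>C x + d *\<^sub>C x"
    and scaleC_scaleC: "c *\<^sub>C d *\<^sub>C x = (c * d) *\<^sub>C x"
    and scaleC_one: "1 *\<^sub>C x = x"
    and scaleR_scaleC: "r *\<^sub>R x = complex_of_real r *\<^sub>C x"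
    and norm_scaleC: "norm (c *\<^sub>C x) = cmod c * norm x"

global_interpretation complex_vector: vector_space
  "scaleC :: complex \<Rightarrow> 'a \<Rightarrow> 'a::complex_normed_vector"
  by unfold_locales
    (simp_all add: scaleC_add_right scaleC_add_left scaleC_scaleC scaleC_one)

abbreviation cspan :: "'a::complex_normed_vector set \<Rightarrow> 'a set"
  where "cspan \<equiv> complex_vector.span"

abbreviation csubspace :: "'a::complex_normed_vector set \<Rightarrow> bool"
  where "csubspace \<equiv> complex_vector.subspace"

abbreviation clinear :: "('a::complex_normed_vector \<Rightarrow> 'b::complex_normed_vector) \<Rightarrow> bool"
  where "clinear \<equiv> Vector_Spaces.linear (*\<^sub>C) (*\<^sub>C)"

class cinner =
  fixes cinner :: "'a \<Rightarrow> 'a \<Rightarrow> complex"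

text \<open>The inner product is linear in the right variable.  Positivity, and
  \<^term>\<open>norm x = sqrt (Re (cinner x x))\<close>, come from \<^class>\<open>real_inner\<close>.\<close>

class chilbert_space = complex_normed_vector + real_inner + complete_space + cinner +
  assumes cinner_commute: "cinner x y = cnj (cinner y x)"
    and cinner_add_right: "cinner x (y + z) = cinner x y + cinner x z"
    and cinner_scaleC_right: "cinner x (c *\<^sub>C y) = c * cinner x y"
    and inner_Re_cinner: "inner x y = Re (cinner x y)"

class star =
  fixes star :: "'a \<Rightarrow> 'a"

class cstar_algebra = complex_normed_vector + real_normed_algebra_1 + complete_space + star +
  assumes scaleC_mult_left: "c *\<^sub>C x * y = c *\<^sub>C (x * y)"
    and scaleC_mult_right: "x * c *\<^sub>C y = c *\<^sub>C (x * y)"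
    and star_star: "star (star x) = x"
    and star_add: "star (x + y) = star x + star y"
    and star_scaleC: "star (c *\<^sub>C x) = cnj c *\<^sub>C star x"
    and star_mult: "star (x * y) = star y * star x"
    and cstar_identity: "norm (star x * x) = (norm x)\<^sup>2"

subclass (in cstar_algebra) banach ..

subclass (in chilbert_space) banach ..

instantiation complex :: chilbert_space
begin
definition scaleC_complex :: "complex \<Rightarrow> complex \<Rightarrow> complex"
  where "scaleC_complex c x = c * x"
definition cinner_complex :: "complex \<Rightarrow> complex \<Rightarrow> complex"
  where "cinner_complex x y = cnj x * y"
instance
  by standard
    (auto simp: scaleC_complex_def cinner_complex_def algebra_simps scaleR_conv_of_real
      norm_mult inner_complex_def)
end

instantiation blinfun :: (real_normed_vector, complex_normed_vector) complex_normed_vector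
begin
lift_definition scaleC_blinfun :: "complex \<Rightarrow> 'a \<Rightarrow>\<^sub>L 'b \<Rightarrow> 'a \<Rightarrow>\<^sub>L 'b" is "\<lambda>c f x. c *\<^sub>C f x"
proof -
  fix c :: complex and f :: "'a \<Rightarrow> 'b" assume f: "bounded_linear f"
  interpret f: bounded_linear f by fact
  obtain K where K: "\<And>x. norm (f x) \<le> norm x * K" using f.bounded by blast
  show "bounded_linear (\<lambda>x. c *\<^sub>C f x)"
  proof
    show "\<exists>K. \<forall>x. norm (c *\<^sub>C f x) \<le> norm x * K"
      by (rule exI[of _ "cmod c * K"], auto simp: norm_scaleC)
        (metis K mult.left_commute mult_left_mono norm_ge_zero)
  qed (simp_all add: f.add f.scaleR scaleC_add_right scaleR_scaleC scaleC_scaleC mult.commute)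
qed
instance
proof
  fix c :: complex and T :: "'a \<Rightarrow>\<^sub>L 'b"
  have le: "norm (c *\<^sub>C T) \<le> cmod c * norm T" for c and T :: "'a \<Rightarrow>\<^sub>L 'b"
  proof (rule norm_blinfun_bound)
    fix x
    have "norm (c *\<^sub>C T x) \<le> cmod c * (norm T * norm x)"
      by (simp add: norm_scaleC mult_left_mono norm_blinfun)
    then show "norm (blinfun_apply (c *\<^sub>C T) x) \<le> cmod c * norm T * norm x"
      by (simp add: scaleC_blinfun.rep_eq mult.assoc)
  qed auto
  show "norm (c *\<^sub>C T) = cmod c * norm T"
  proof (cases "c = 0")
    case True
    then show ?thesis using le[of c T] by simp
  next
    case False
    have "inverse c *\<^sub>C c *\<^sub>C T = T"
      by (rule blinfun_eqI) (simp add: scaleC_blinfun.rep_eq scaleC_scaleC scaleC_one False)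
    then have "norm T \<le> cmod (inverse c) * norm (c *\<^sub>C T)"
      using le[of "inverse c" "c *\<^sub>C T"] by simp
    then have "cmod c * norm T \<le> norm (c *\<^sub>C T)"
      using False mult_left_mono[of "norm T" "cmod (inverse c) * norm (c *\<^sub>C T)" "cmod c"]
      by (simp add: norm_inverse flip: mult.assoc)
    then show ?thesis using le[of c T] by simp
  qed
qed (auto intro!: blinfun_eqI simp: scaleC_blinfun.rep_eq blinfun.add_left blinfun.scaleR_left
    scaleC_add_right scaleC_add_left scaleC_scaleC scaleC_one scaleR_scaleC)
end


section \<open>The Hilbert space tensor product\<close>

definition is_orthonormal_basis :: "'h::chilbert_space set \<Rightarrow> bool" where
  "is_orthonormal_basis E \<longleftrightarrow>
     (\<forall>x\<in>E. \<forall>y\<in>E. cinner x y = (if x = y then 1 else 0)) \<and>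
     (\<forall>x. (\<forall>e\<in>E. cinner e x = 0) \<longrightarrow> x = 0)"

definition some_basis :: "'h::chilbert_space set" where
  "some_basis = (SOME E. is_orthonormal_basis E)"

text \<open>The tensor product is realised as the square summable functions on the product of two
  orthonormal bases.  That this does not depend on the bases is the content of
  \<open>cinner_tensor_vec\<close> and \<open>closure_cspan_tensor_vec\<close> below.\<close>

typedef (overloaded) ('h::chilbert_space, 'k::chilbert_space) htensor =
  "{f :: 'h \<times> 'k \<Rightarrow> complex.
      (\<forall>p. p \<notin> some_basis \<times> some_basis \<longrightarrow> f p = 0) \<and> (\<lambda>p. (cmod (f p))\<^sup>2) summable_on UNIV}"
  morphisms coord Abs_htensor
  by (rule exI[of _ "\<lambda>_. 0"]) simp

setup_lifting type_definition_htensor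

lemma sq_summable_mult:
  fixes f g :: "'x \<Rightarrow> complex"
  assumes "(\<lambda>p. (cmod (f p))\<^sup>2) summable_on A" "(\<lambda>p. (cmod (g p))\<^sup>2) summable_on A"
  shows "(\<lambda>p. cnj (f p) * g p) summable_on A"
proof (rule abs_summable_summable, rule summable_on_comparison_test)
  show "(\<lambda>p. (cmod (f p))\<^sup>2 + (cmod (g p))\<^sup>2) summable_on A"
    using assms by (rule summable_on_add)
  fix p
  have "2 * (cmod (f p) * cmod (g p)) \<le> (cmod (f p))\<^sup>2 + (cmod (g p))\<^sup>2"
    using sum_squares_bound[of "cmod (f p)" "cmod (g p)"] by (simp add: mult.assoc)
  then show "norm (cnj (f p) * g p) \<le> (cmod (f p))\<^sup>2 + (cmod (g p))\<^sup>2"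
    using mult_nonneg_nonneg[of "cmod (f p)" "cmod (g p)"]
    by (simp add: norm_mult del: mult_nonneg_nonneg)
qed simp

lemma sq_summable_add:
  fixes f g :: "'x \<Rightarrow> complex"
  assumes "(\<lambda>p. (cmod (f p))\<^sup>2) summable_on A" "(\<lambda>p. (cmod (g p))\<^sup>2) summable_on A"
  shows "(\<lambda>p. (cmod (f p + g p))\<^sup>2) summable_on A"
proof (rule summable_on_comparison_test)
  show "(\<lambda>p. 2 * (cmod (f p))\<^sup>2 + 2 * (cmod (g p))\<^sup>2) summable_on A"
    using assms by (intro summable_on_add summable_on_cmult_right)
  fix p
  have "(cmod (f p + g p))\<^sup>2 \<le> (cmod (f p) + cmod (g p))\<^sup>2"
    by (intro power_mono norm_triangle_ineq) simp
  also have "\<dots> \<le> 2 * (cmod (f p))\<^sup>2 + 2 * (cmod (g p))\<^sup>2"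
    using sum_squares_bound[of "cmod (f p)" "cmod (g p)"] by (simp add: power2_sum)
  finally show "(cmod (f p + g p))\<^sup>2 \<le> 2 * (cmod (f p))\<^sup>2 + 2 * (cmod (g p))\<^sup>2" .
qed simp

lemma Re_cnj_mult_self: "Re (cnj z * z) = (cmod z)\<^sup>2"
  unfolding cmod_power2 by (simp add: power2_eq_square)

lemma coord_sq_summable: "(\<lambda>p. (cmod (coord x p))\<^sup>2) summable_on UNIV"
  using coord[of x] by simp

lemma coord_mult_summable: "(\<lambda>p. cnj (coord x p) * coord y p) summable_on UNIV"
  by (rule sq_summable_mult[OF coord_sq_summable coord_sq_summable])

lemma htensor_eqI: "(\<And>p. coord x p = coord y p) \<Longrightarrow> x = y"
  by (metis coord_inject ext)

instantiation htensor :: (chilbert_space, chilbert_space) real_inner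
begin

lift_definition zero_htensor :: "('a, 'b) htensor" is "\<lambda>_. 0"
  by simp

lift_definition plus_htensor :: "('a, 'b) htensor \<Rightarrow> ('a, 'b) htensor \<Rightarrow> ('a, 'b) htensor"
  is "\<lambda>f g p. f p + g p"
  by (auto intro: sq_summable_add)

lift_definition uminus_htensor :: "('a, 'b) htensor \<Rightarrow> ('a, 'b) htensor"
  is "\<lambda>f p. - f p"
  by simp

lift_definition scaleR_htensor :: "real \<Rightarrow> ('a, 'b) htensor \<Rightarrow> ('a, 'b) htensor"
  is "\<lambda>r f p. complex_of_real r * f p"
  by (auto simp: norm_mult power_mult_distrib intro: summable_on_cmult_right)

definition minus_htensor :: "('a, 'b) htensor \<Rightarrow> ('a, 'b) htensor \<Rightarrow> ('a, 'b) htensor"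
  where "x - y = x + - y" for x y :: "('a, 'b) htensor"

definition inner_htensor :: "('a, 'b) htensor \<Rightarrow> ('a, 'b) htensor \<Rightarrow> real"
  where "inner x y = Re (\<Sum>\<^sub>\<infinity>p. cnj (coord x p) * coord y p)" for x y :: "('a, 'b) htensor"

definition norm_htensor :: "('a, 'b) htensor \<Rightarrow> real"
  where "norm x = sqrt (inner x x)" for x :: "('a, 'b) htensor"

definition sgn_htensor :: "('a, 'b) htensor \<Rightarrow> ('a, 'b) htensor"
  where "sgn_htensor x = scaleR (inverse (norm x)) x"

definition dist_htensor :: "('a, 'b) htensor \<Rightarrow> ('a, 'b) htensor \<Rightarrow> real"
  where "dist x y = norm (x - y)" for x y :: "('a, 'b) htensor"

definition uniformity_htensor :: "(('a, 'b) htensor \<times> ('a, 'b) htensor) filter"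
  where "uniformity_htensor = (INF e\<in>{0<..}. principal {(x, y). dist x y < e})"

definition open_htensor :: "('a, 'b) htensor set \<Rightarrow> bool"
  where "open_htensor U \<longleftrightarrow> (\<forall>x\<in>U. \<forall>\<^sub>F (x', y) in uniformity. x' = x \<longrightarrow> y \<in> U)"

instance
proof
  have inner_self: "inner x x = (\<Sum>\<^sub>\<infinity>p. (cmod (coord x p))\<^sup>2)" for x :: "('a, 'b) htensor"
    unfolding inner_htensor_def infsum_Re[OF coord_mult_summable, symmetric]
    by (simp only: Re_cnj_mult_self)
  fix x y z :: "('a, 'b) htensor" and r s :: real
  show "x + y + z = x + (y + z)" "x + y = y + x" "0 + x = x" "- x + x = 0" "x - y = x + - y"
    by (auto intro!: htensor_eqI simp: minus_htensor_def plus_htensor.rep_eq uminus_htensor.rep_eq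
        zero_htensor.rep_eq)
  show "r *\<^sub>R (x + y) = r *\<^sub>R x + r *\<^sub>R y" "(r + s) *\<^sub>R x = r *\<^sub>R x + s *\<^sub>R x"
    "r *\<^sub>R s *\<^sub>R x = (r * s) *\<^sub>R x" "1 *\<^sub>R x = x"
    by (auto intro!: htensor_eqI simp: scaleR_htensor.rep_eq plus_htensor.rep_eq algebra_simps)
  show "sgn x = scaleR (inverse (norm x)) x" by (rule sgn_htensor_def)
  show "dist x y = norm (x - y)" by (rule dist_htensor_def)
  show "(uniformity :: (('a, 'b) htensor \<times> ('a, 'b) htensor) filter)
      = (INF e\<in>{0<..}. principal {(x, y). dist x y < e})"
    by (rule uniformity_htensor_def)
  show "open U \<longleftrightarrow> (\<forall>x\<in>U. \<forall>\<^sub>F (x', y) in uniformity. x' = x \<longrightarrow> y \<in> U)" for U :: "('a, 'b) htensor set"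
    by (rule open_htensor_def)
  have "cnj (\<Sum>\<^sub>\<infinity>p. cnj (coord x p) * coord y p) = (\<Sum>\<^sub>\<infinity>p. cnj (coord y p) * coord x p)"
    by (simp add: mult.commute flip: infsum_cnj)
  then show "inner x y = inner y x"
    unfolding inner_htensor_def by (metis cnj.simps(1))
  show "inner (x + y) z = inner x z + inner y z"
    by (simp add: inner_htensor_def plus_htensor.rep_eq distrib_right infsum_add
        coord_mult_summable)
  show "inner (r *\<^sub>R x) y = r * inner x y"
    by (simp add: inner_htensor_def scaleR_htensor.rep_eq mult.assoc infsum_cmult_right')
  show "0 \<le> inner x x"
    unfolding inner_self by (rule infsum_nonneg) simp
  show "norm x = sqrt (inner x x)"
    by (rule norm_htensor_def)
  show "inner x x = 0 \<longleftrightarrow> x = 0"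
  proof
    assume "inner x x = 0"
    then have "(cmod (coord x p))\<^sup>2 \<le> 0" for p
      using finite_sum_le_infsum[OF coord_sq_summable, of "{p}" x] by (simp add: inner_self)
    then show "x = 0" by (auto intro!: htensor_eqI simp: zero_htensor.rep_eq)
  next
    assume "x = 0"
    then show "inner x x = 0" by (simp add: inner_self zero_htensor.rep_eq)
  qed
qed
end

lemma norm_htensor_sq: "(norm x)\<^sup>2 = (\<Sum>\<^sub>\<infinity>p. (cmod (coord x p))\<^sup>2)"
proof -
  have "(norm x)\<^sup>2 = inner x x" by (rule power2_norm_eq_inner)
  then show ?thesis
    unfolding inner_htensor_def infsum_Re[OF coord_mult_summable, symmetric]
    by (simp only: Re_cnj_mult_self)
qed

lemma sum_coord_le: "finite F \<Longrightarrow> (\<Sum>p\<in>F. (cmod (coord x p))\<^sup>2) \<le> (norm x)\<^sup>2"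
  unfolding norm_htensor_sq by (rule finite_sum_le_infsum[OF coord_sq_summable]) auto

lemma coord_diff: "coord (x - y) p = coord x p - coord y p"
  unfolding minus_htensor_def plus_htensor.rep_eq uminus_htensor.rep_eq by simp

instance htensor :: (chilbert_space, chilbert_space) complete_space
proof
  fix X :: "nat \<Rightarrow> ('a, 'b) htensor"
  assume X: "Cauchy X"
  have "Cauchy (\<lambda>n. coord (X n) p)" for p
  proof (rule CauchyI)
    fix e :: real assume "0 < e"
    then obtain M where M: "\<And>m n. m \<ge> M \<Longrightarrow> n \<ge> M \<Longrightarrow> norm (X m - X n) < e"
      using CauchyD[OF X, of e] by auto
    have "cmod (coord (X m) p - coord (X n) p) \<le> norm (X m - X n)" for m n
      using sum_coord_le[of "{p}" "X m - X n"] by (simp add: coord_diff)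
    then show "\<exists>M. \<forall>m\<ge>M. \<forall>n\<ge>M. norm (coord (X m) p - coord (X n) p) < e"
      by (intro exI[of _ M] allI impI) (rule order_le_less_trans, assumption, rule M)
  qed
  then have f: "(\<lambda>n. coord (X n) p) \<longlonglongrightarrow> lim (\<lambda>n. coord (X n) p)" for p
    by (simp add: Cauchy_convergent_iff convergent_LIMSEQ_iff)
  define f where "f p = lim (\<lambda>n. coord (X n) p)" for p
  note f = f[folded f_def]
  have fatou: "(\<Sum>p\<in>F. (cmod (coord (X n) p - f p))\<^sup>2) \<le> e\<^sup>2"
    if "finite F" "\<And>m. m \<ge> M \<Longrightarrow> norm (X n - X m) \<le> e" for F n e M
  proof (rule LIMSEQ_le_const2)
    show "(\<lambda>m. \<Sum>p\<in>F. (cmod (coord (X n) p - coord (X m) p))\<^sup>2) \<longlonglongrightarrow>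
        (\<Sum>p\<in>F. (cmod (coord (X n) p - f p))\<^sup>2)"
      by (intro tendsto_intros f)
    show "\<exists>N. \<forall>m\<ge>N. (\<Sum>p\<in>F. (cmod (coord (X n) p - coord (X m) p))\<^sup>2) \<le> e\<^sup>2"
    proof (intro exI[of _ M] allI impI)
      fix m assume "M \<le> m"
      have "(\<Sum>p\<in>F. (cmod (coord (X n) p - coord (X m) p))\<^sup>2) \<le> (norm (X n - X m))\<^sup>2"
        using sum_coord_le[OF that(1), of "X n - X m"] by (simp add: coord_diff)
      also have "\<dots> \<le> e\<^sup>2"
        by (intro power_mono that(2) \<open>M \<le> m\<close>) simp
      finally show "(\<Sum>p\<in>F. (cmod (coord (X n) p - coord (X m) p))\<^sup>2) \<le> e\<^sup>2" .
    qed
  qed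
  obtain M where M: "\<And>m n. m \<ge> M \<Longrightarrow> n \<ge> M \<Longrightarrow> norm (X m - X n) < 1"
    using CauchyD[OF X, of 1] by auto
  have bd: "(\<Sum>p\<in>F. (cmod (coord (X M) p - f p))\<^sup>2) \<le> 1\<^sup>2" if "finite F" for F
    by (rule fatou[OF that, of M]) (rule less_imp_le, rule M, auto)
  have "(\<lambda>p. (cmod (coord (X M) p - f p))\<^sup>2) summable_on UNIV"
    by (rule nonneg_bounded_partial_sums_imp_summable_on[of _ _ "1\<^sup>2"], simp,
        rule eventually_finite_subsets_at_top_weakI, rule bd)
  then have "(\<lambda>p. (cmod (coord (X M) p + - (coord (X M) p - f p)))\<^sup>2) summable_on UNIV"
    by (intro sq_summable_add coord_sq_summable) (simp only: norm_minus_cancel)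
  then have "(\<lambda>p. (cmod (f p))\<^sup>2) summable_on UNIV" by simp
  moreover have "f p = 0" if "p \<notin> some_basis \<times> some_basis" for p
  proof -
    have "coord (X n) p = 0" for n using coord[of "X n"] that by (cases p) auto
    then show ?thesis unfolding f_def by simp
  qed
  ultimately have cf: "coord (Abs_htensor f) = f"
    by (intro Abs_htensor_inverse) auto
  have "X \<longlonglongrightarrow> Abs_htensor f"
  proof (rule LIMSEQ_I)
    fix e :: real assume e: "0 < e"
    then obtain N where N: "\<And>m n. m \<ge> N \<Longrightarrow> n \<ge> N \<Longrightarrow> norm (X m - X n) < e / 2"
      using CauchyD[OF X, of "e / 2"] by auto
    have "norm (X n - Abs_htensor f) \<le> e / 2" if "n \<ge> N" for n
    proof (rule power2_le_imp_le)
      show "(norm (X n - Abs_htensor f))\<^sup>2 \<le> (e / 2)\<^sup>2"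
        unfolding norm_htensor_sq
      proof (rule infsum_le_finite_sums[OF coord_sq_summable])
        show "sum (\<lambda>p. (cmod (coord (X n - Abs_htensor f) p))\<^sup>2) F \<le> (e / 2)\<^sup>2"
          if "finite F" for F
          unfolding coord_diff cf
          by (rule fatou[OF that, of N]) (rule less_imp_le, rule N[OF \<open>n \<ge> N\<close>])
      qed
    qed (use e in simp)
    then show "\<exists>no. \<forall>n\<ge>no. norm (X n - Abs_htensor f) < e"
    proof (intro exI[of _ N] allI impI)
      fix n assume "N \<le> n"
      from \<open>\<And>n. N \<le> n \<Longrightarrow> norm (X n - Abs_htensor f) \<le> e / 2\<close>[OF this]
      show "norm (X n - Abs_htensor f) < e" using e by simp
    qed
  qed
  then show "convergent X" by (auto simp: convergent_def)
qed

instantiation htensor :: (chilbert_space, chilbert_space) chilbert_space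
begin

lift_definition scaleC_htensor :: "complex \<Rightarrow> ('a, 'b) htensor \<Rightarrow> ('a, 'b) htensor"
  is "\<lambda>c f p. c * f p"
  by (auto simp: norm_mult power_mult_distrib intro: summable_on_cmult_right)

definition cinner_htensor :: "('a, 'b) htensor \<Rightarrow> ('a, 'b) htensor \<Rightarrow> complex"
  where "cinner x y = (\<Sum>\<^sub>\<infinity>p. cnj (coord x p) * coord y p)" for x y :: "('a, 'b) htensor"

instance
proof
  fix x y z :: "('a, 'b) htensor" and r :: real and c d :: complex
  show "c *\<^sub>C (x + y) = c *\<^sub>C x + c *\<^sub>C y" "(c + d) *\<^sub>C x = c *\<^sub>C x + d *\<^sub>C x"
    "c *\<^sub>C d *\<^sub>C x = (c * d) *\<^sub>C x" "1 *\<^sub>C x = x" "r *\<^sub>R x = complex_of_real r *\<^sub>C x"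
    by (auto intro!: htensor_eqI simp: scaleR_htensor.rep_eq plus_htensor.rep_eq
        scaleC_htensor.rep_eq algebra_simps)
  show "norm (c *\<^sub>C x) = cmod c * norm x"
    by (rule power2_eq_imp_eq)
      (simp_all add: power_mult_distrib norm_htensor_sq scaleC_htensor.rep_eq norm_mult
        infsum_cmult_right')
  show "cinner x y = cnj (cinner y x)"
    by (simp add: cinner_htensor_def mult.commute flip: infsum_cnj)
  show "cinner x (y + z) = cinner x y + cinner x z"
    by (simp add: cinner_htensor_def plus_htensor.rep_eq distrib_left infsum_add
        coord_mult_summable)
  show "cinner x (c *\<^sub>C y) = c * cinner x y"
    by (simp add: cinner_htensor_def scaleC_htensor.rep_eq mult.left_commute infsum_cmult_right')
  show "inner x y = Re (cinner x y)"
    by (simp add: inner_htensor_def cinner_htensor_def)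
qed
end

lemma cinner_add_left: "cinner (x + y) z = cinner x z + cinner (y :: 'h::chilbert_space) z"
  by (metis cinner_add_right cinner_commute complex_cnj_add)

lemma cinner_scaleC_left: "cinner (c *\<^sub>C x) y = cnj c * cinner x (y :: 'h::chilbert_space)"
  by (metis cinner_commute cinner_scaleC_right complex_cnj_mult)

lemma cinner_zero_right [simp]: "cinner x (0 :: 'h::chilbert_space) = 0"
  using cinner_add_right[of x 0 0] by simp

lemma cinner_zero_left [simp]: "cinner (0 :: 'h::chilbert_space) x = 0"
  using cinner_add_left[of 0 0 x] by simp

lemma cinner_diff_right: "cinner x (y - z) = cinner x y - cinner x (z :: 'h::chilbert_space)"
  using cinner_add_right[of x "y - z" z] by simp

lemma cinner_sum_right: "cinner x (\<Sum>i\<in>F. f i) = (\<Sum>i\<in>F. cinner x (f i :: 'h::chilbert_space))"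
  by (induction F rule: infinite_finite_induct) (auto simp: cinner_add_right)

lemma cinner_sum_left: "cinner (\<Sum>i\<in>F. f i) x = (\<Sum>i\<in>F. cinner (f i :: 'h::chilbert_space) x)"
  by (induction F rule: infinite_finite_induct) (auto simp: cinner_add_left)

lemma cinner_self: "cinner x x = complex_of_real ((norm (x :: 'h::chilbert_space))\<^sup>2)"
proof -
  have "Im (cinner x x) = 0"
    using cinner_commute[of x x] by (metis Reals_cnj_iff complex_is_Real_iff)
  then show ?thesis
    by (simp add: complex_eq_iff power2_norm_eq_inner inner_Re_cinner)
qed

lemma norm_cinner_le: "cmod (cinner x y) \<le> norm x * norm (y :: 'h::chilbert_space)"
proof (cases "cinner x y = 0")
  case False
  define c where "c = cnj (cinner x y) / cmod (cinner x y)"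
  have "cmod c = 1" using False by (simp add: c_def norm_divide)
  have "cnj w / cmod w * w = complex_of_real (cmod w)" if "w \<noteq> 0" for w
    using that complex_norm_square[of w] by (simp add: field_simps power2_eq_square)
  from this[OF False] have "complex_of_real (cmod (cinner x y)) = cinner x (c *\<^sub>C y)"
    by (simp add: c_def cinner_scaleC_right)
  then have "cmod (cinner x y) = inner x (c *\<^sub>C y)"
    by (metis Re_complex_of_real inner_Re_cinner)
  also have "\<dots> \<le> norm x * norm (c *\<^sub>C y)" by (rule norm_cauchy_schwarz)
  finally show ?thesis using \<open>cmod c = 1\<close> by (simp add: norm_scaleC)
qed simp

lemma bounded_linear_cinner_right: "bounded_linear (cinner (x :: 'h::chilbert_space))"
proof (rule bounded_linear_intro[where K = "norm x"])
  show "norm (cinner x y) \<le> norm y * norm x" for y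
    using norm_cinner_le[of x y] by (simp only: mult.commute)
qed (simp_all add: cinner_add_right scaleR_scaleC cinner_scaleC_right scaleC_complex_def)

lemma ex_orthonormal_basis: "\<exists>E :: 'h::chilbert_space set. is_orthonormal_basis E"
proof -
  define \<O> where "\<O> = {E :: 'h set. \<forall>x\<in>E. \<forall>y\<in>E. cinner x y = (if x = y then 1 else 0)}"
  have "\<exists>M\<in>\<O>. \<forall>X\<in>\<O>. M \<subseteq> X \<longrightarrow> X = M"
  proof (rule subset_Zorn')
    fix C assume C: "subset.chain \<O> C"
    have "cinner x y = (if x = y then 1 else 0)" if "x \<in> \<Union>C" "y \<in> \<Union>C" for x y
    proof -
      obtain E F where "E \<in> C" "F \<in> C" "x \<in> E" "y \<in> F" using \<open>x \<in> \<Union>C\<close> \<open>y \<in> \<Union>C\<close> by blast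
      then obtain G where "G \<in> C" "x \<in> G" "y \<in> G"
        using C unfolding subset_chain_def by blast
      then show ?thesis using C unfolding subset_chain_def \<O>_def by blast
    qed
    then show "\<Union>C \<in> \<O>" unfolding \<O>_def by blast
  qed
  then obtain M where M: "M \<in> \<O>" and max: "\<And>X. X \<in> \<O> \<Longrightarrow> M \<subseteq> X \<Longrightarrow> X = M" by blast
  have "x = 0" if x: "\<forall>e\<in>M. cinner e x = 0" for x
  proof (rule ccontr)
    assume "x \<noteq> 0"
    define y where "y = complex_of_real (inverse (norm x)) *\<^sub>C x"
    have "norm y = 1" using \<open>x \<noteq> 0\<close> by (simp add: y_def norm_scaleC norm_inverse)
    then have yy: "cinner y y = 1" by (simp add: cinner_self)
    have ey: "cinner e y = 0" "cinner y e = 0" if "e \<in> M" for e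
    proof -
      show "cinner e y = 0" using x that by (simp add: y_def cinner_scaleC_right)
      then show "cinner y e = 0" using cinner_commute[of y e] by simp
    qed
    have "insert y M \<in> \<O>"
      using M yy ey unfolding \<O>_def by (auto; metis)
    then have "y \<in> M" using max by blast
    then show False using ey(1) yy by simp
  qed
  then show ?thesis using M unfolding is_orthonormal_basis_def \<O>_def by blast
qed

lemma some_basis: "is_orthonormal_basis some_basis"
  unfolding some_basis_def by (rule someI_ex) (rule ex_orthonormal_basis)

lemma cinner_some_basis:
  "e \<in> some_basis \<Longrightarrow> f \<in> some_basis \<Longrightarrow> cinner e f = (if e = f then 1 else 0)"
  using some_basis unfolding is_orthonormal_basis_def by blast

lemma cinner_basis_sum:
  assumes "finite F" "F \<subseteq> some_basis" "e \<in> some_basis"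
  shows "cinner e (\<Sum>f\<in>F. c f *\<^sub>C f) = (if e \<in> F then c e else 0)"
proof -
  have "cinner e (\<Sum>f\<in>F. c f *\<^sub>C f) = (\<Sum>f\<in>F. c f * cinner e f)"
    by (simp only: cinner_sum_right cinner_scaleC_right)
  also have "\<dots> = (\<Sum>f\<in>F. if e = f then c f else 0)"
    using assms by (intro sum.cong refl) (simp add: cinner_some_basis subset_iff)
  finally show ?thesis using assms(1) by simp
qed

lemma norm_sum_basis:
  fixes c :: "'h::chilbert_space \<Rightarrow> complex"
  assumes "finite F" "F \<subseteq> some_basis"
  shows "(norm (\<Sum>e\<in>F. c e *\<^sub>C e))\<^sup>2 = (\<Sum>e\<in>F. (cmod (c e))\<^sup>2)"
proof -
  let ?s = "\<Sum>e\<in>F. c e *\<^sub>C e"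
  have "cinner ?s ?s = (\<Sum>e\<in>F. cnj (c e) * cinner e ?s)"
    by (simp only: cinner_sum_left cinner_scaleC_left)
  also have "\<dots> = (\<Sum>e\<in>F. complex_of_real ((cmod (c e))\<^sup>2))"
    using assms
    by (intro sum.cong refl) (auto simp: cinner_basis_sum subset_iff mult.commute simp flip: complex_norm_square)
  finally have "complex_of_real ((norm ?s)\<^sup>2) = complex_of_real (\<Sum>e\<in>F. (cmod (c e))\<^sup>2)"
    unfolding cinner_self by simp
  then show ?thesis by (simp only: of_real_eq_iff)
qed

lemma bessel:
  fixes x :: "'h::chilbert_space"
  assumes "finite F" "F \<subseteq> some_basis"
  shows "(\<Sum>e\<in>F. (cmod (cinner e x))\<^sup>2) \<le> (norm x)\<^sup>2"
proof -
  define s where "s = (\<Sum>e\<in>F. cinner e x *\<^sub>C e)"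
  have es: "cinner e s = cinner e x" if "e \<in> F" for e
    unfolding s_def using assms that by (subst cinner_basis_sum) auto
  have "cinner s (x - s) = 0"
    by (subst s_def) (simp add: cinner_sum_left cinner_scaleC_left cinner_diff_right es)
  then have "inner s (x - s) = 0" by (simp add: inner_Re_cinner)
  then have "(norm x)\<^sup>2 = (norm s)\<^sup>2 + (norm (x - s))\<^sup>2"
    unfolding power2_norm_eq_inner by (simp add: inner_diff inner_commute)
  then show ?thesis using norm_sum_basis[OF assms, of "\<lambda>e. cinner e x"] by (simp add: s_def)
qed

lemma bessel_summable:
  "(\<lambda>e. (cmod (cinner e (x :: 'h::chilbert_space)))\<^sup>2) summable_on some_basis"
  by (rule nonneg_bounded_partial_sums_imp_summable_on)
    (auto intro!: eventually_finite_subsets_at_top_weakI bessel)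

lemma basis_expansion:
  fixes x :: "'h::chilbert_space"
  shows "((\<lambda>e. cinner e x *\<^sub>C e) has_sum x) some_basis"
proof -
  define P where "P = sum (\<lambda>e. cinner e x *\<^sub>C e)"
  define Q where "Q = sum (\<lambda>e. (cmod (cinner e x))\<^sup>2)"
  have "(\<lambda>e. cinner e x *\<^sub>C e) summable_on some_basis"
  proof -
    have "((\<lambda>e. (cmod (cinner e x))\<^sup>2) has_sum infsum (\<lambda>e. (cmod (cinner e x))\<^sup>2) some_basis) some_basis"
      using bessel_summable[of x] by (rule has_sum_infsum)
    then obtain q where q: "(Q \<longlongrightarrow> q) (finite_subsets_at_top some_basis)"
      by (simp add: has_sum_def Q_def that)
    have ex: "\<exists>F. finite F \<and> F \<subseteq> some_basis \<and>
        (\<forall>G. finite G \<and> F \<subseteq> G \<and> G \<subseteq> some_basis \<longrightarrow> norm (P G - P F) < e)"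
      if "e > 0" for e
    proof -
      have "e\<^sup>2 / 2 > 0" using that by simp
      then obtain F where F: "finite F" "F \<subseteq> some_basis"
        "\<And>G. finite G \<Longrightarrow> F \<subseteq> G \<Longrightarrow> G \<subseteq> some_basis \<Longrightarrow> dist (Q G) q < e\<^sup>2 / 2"
        using tendstoD[OF q, of "e\<^sup>2 / 2"] unfolding eventually_finite_subsets_at_top by auto
      have "norm (P G - P F) < e" if G: "finite G" "F \<subseteq> G" "G \<subseteq> some_basis" for G
      proof (rule power2_less_imp_less)
        have "P G - P F = (\<Sum>e\<in>G - F. cinner e x *\<^sub>C e)"
          unfolding P_def using G by (simp add: sum_diff)
        then have "(norm (P G - P F))\<^sup>2 = Q (G - F)"
          using norm_sum_basis[of "G - F" "\<lambda>e. cinner e x"] G by (auto simp: Q_def)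
        also have "\<dots> = Q G - Q F" unfolding Q_def using G F(1) by (simp add: sum_diff)
        also have "\<dots> < e\<^sup>2" using F(3)[OF G] F(3)[OF F(1) order_refl F(2)]
          by (simp add: dist_real_def abs_if split: if_splits)
        finally show "(norm (P G - P F))\<^sup>2 < e\<^sup>2" .
      qed (use \<open>e > 0\<close> in simp)
      then show ?thesis using F(1,2) by (intro exI[of _ F]) auto
    qed
    have "\<forall>n::nat. \<exists>F. finite F \<and> F \<subseteq> some_basis \<and>
        (\<forall>G. finite G \<and> F \<subseteq> G \<and> G \<subseteq> some_basis \<longrightarrow> norm (P G - P F) < 1 / Suc n)"
      by (intro allI ex) simp
    from choice[OF this] obtain F0 where F0': "\<forall>n::nat. finite (F0 n) \<and> F0 n \<subseteq> some_basis \<and>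
        (\<forall>G. finite G \<and> F0 n \<subseteq> G \<and> G \<subseteq> some_basis \<longrightarrow> norm (P G - P (F0 n)) < 1 / Suc n)" ..
    have F0: "\<And>n. finite (F0 n)" "\<And>n. F0 n \<subseteq> some_basis"
      "\<And>n G. finite G \<Longrightarrow> F0 n \<subseteq> G \<Longrightarrow> G \<subseteq> some_basis \<Longrightarrow> norm (P G - P (F0 n)) < 1 / Suc n"
      using F0' by auto
    define X where "X n = P (\<Union>k\<le>n. F0 k)" for n
    have Xd: "norm (P G - X n) < 2 / Suc N"
      if "N \<le> n" "finite G" "F0 N \<subseteq> G" "G \<subseteq> some_basis" for N n G
    proof -
      have "norm (P (\<Union>k\<le>n. F0 k) - P (F0 N)) < 1 / Suc N"
        using F0 that by (intro F0(3)) auto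
      moreover have "norm (P G - P (F0 N)) < 1 / Suc N" using that by (intro F0(3))
      ultimately show ?thesis
        using norm_triangle_ineq4[of "P G - P (F0 N)" "P (\<Union>k\<le>n. F0 k) - P (F0 N)"]
        by (simp add: X_def)
    qed
    have small: "\<exists>N::nat. 2 / Suc N < e" if pos: "e > 0" for e :: real
    proof -
      obtain N where "inverse (real (Suc N)) < e / 2"
        using pos reals_Archimedean[of "e / 2"] by auto
      then show ?thesis by (intro exI[of _ N]) (simp add: field_simps)
    qed
    have "Cauchy X"
    proof (rule CauchyI)
      fix e :: real assume "0 < e"
      then obtain N :: nat where N: "2 / Suc N < e" using small[of e] by blast
      have "norm (X m - X n) < e" if "m \<ge> N" "n \<ge> N" for m n
      proof -
        have "norm (P (\<Union>k\<le>m. F0 k) - X n) < 2 / Suc N"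
          using F0 that by (intro Xd) auto
        then show ?thesis using N by (simp add: X_def)
      qed
      then show "\<exists>M. \<forall>m\<ge>M. \<forall>n\<ge>M. norm (X m - X n) < e" by blast
    qed
    then obtain y where y: "X \<longlonglongrightarrow> y" using Cauchy_convergent convergent_def by blast
    have "(P \<longlongrightarrow> y) (finite_subsets_at_top some_basis)"
    proof (rule tendstoI)
      fix e :: real assume "0 < e"
      then obtain N :: nat where N: "2 / Suc N < e" using small[of e] by blast
      have "dist (P G) y < e" if G: "finite G" "F0 N \<subseteq> G" "G \<subseteq> some_basis" for G
      proof -
        have "(\<lambda>n. norm (P G - X n)) \<longlonglongrightarrow> norm (P G - y)" by (intro tendsto_intros y)
        then have "norm (P G - y) \<le> 2 / Suc N"
          by (rule LIMSEQ_le_const2) (use Xd[OF _ G] in \<open>auto intro!: exI[of _ N] less_imp_le\<close>)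
        then show ?thesis using N by (simp add: dist_norm)
      qed
      then show "eventually (\<lambda>G. dist (P G) y < e) (finite_subsets_at_top some_basis)"
        unfolding eventually_finite_subsets_at_top using F0 by (intro exI[of _ "F0 N"]) auto
    qed
    then have "((\<lambda>e. cinner e x *\<^sub>C e) has_sum y) some_basis"
      by (simp add: has_sum_def P_def)
    then show ?thesis by (auto simp: summable_on_def)
  qed
  then obtain y where y: "((\<lambda>e. cinner e x *\<^sub>C e) has_sum y) some_basis"
    unfolding summable_on_def by blast
  have "cinner f (x - y) = 0" if f: "f \<in> some_basis" for f
  proof -
    interpret f: bounded_linear "cinner f"
      by (rule bounded_linear_cinner_right)
    have "((cinner f \<circ> (\<lambda>e. cinner e x *\<^sub>C e)) has_sum cinner f y) some_basis"
      by (rule has_sum_comm_additive_general[OF _ _ y])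
        (auto simp: f.sum f.tendsto intro: f.tendsto)
    then have *: "((\<lambda>e. if e = f then cinner f x else 0) has_sum cinner f y) some_basis"
      by (rule has_sum_cong[THEN iffD1, rotated])
        (auto simp: cinner_scaleC_right cinner_some_basis f)
    have "((\<lambda>e. if e = f then cinner f x else 0) has_sum cinner f x) some_basis"
      using f by (auto intro!: has_sum_finite_neutralI[of "{f}"] split: if_splits)
    then show ?thesis using * has_sum_unique by (auto simp: cinner_diff_right)
  qed
  then have "x - y = 0"
    using some_basis unfolding is_orthonormal_basis_def by blast
  then show ?thesis using y by simp
qed

lemma parseval:
  fixes x y :: "'h::chilbert_space"
  shows "((\<lambda>e. cnj (cinner e x) * cinner e y) has_sum cinner x y) some_basis"
proof -
  interpret x: bounded_linear "cinner x"
    by (rule bounded_linear_cinner_right)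
  have "((cinner x \<circ> (\<lambda>e. cinner e y *\<^sub>C e)) has_sum cinner x y) some_basis"
    by (rule has_sum_comm_additive_general[OF _ _ basis_expansion[of y]])
      (auto simp: x.sum intro: x.tendsto)
  then show ?thesis
    by (simp add: o_def cinner_scaleC_right mult.commute flip: cinner_commute)
qed

lift_definition tensor_vec :: "'h::chilbert_space \<Rightarrow> 'k::chilbert_space \<Rightarrow> ('h, 'k) htensor"
    (infixr \<open>\<otimes>\<^sub>v\<close> 70)
  is "\<lambda>x y p. if p \<in> some_basis \<times> some_basis then cinner (fst p) x * cinner (snd p) y else 0"
proof -
  fix x :: 'h and y :: 'k
  have "(\<lambda>p. (cmod (cinner (fst p) x * cinner (snd p) y))\<^sup>2) summable_on some_basis \<times> some_basis"
  proof (rule nonneg_bounded_partial_sums_imp_summable_on[of _ _ "(norm x)\<^sup>2 * (norm y)\<^sup>2"])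
    show "eventually (\<lambda>F. (\<Sum>p\<in>F. (cmod (cinner (fst p) x * cinner (snd p) y))\<^sup>2)
        \<le> (norm x)\<^sup>2 * (norm y)\<^sup>2) (finite_subsets_at_top (some_basis \<times> some_basis))"
    proof (rule eventually_finite_subsets_at_top_weakI)
      fix F :: "('h \<times> 'k) set" assume F: "finite F" "F \<subseteq> some_basis \<times> some_basis"
      have "(\<Sum>p\<in>F. (cmod (cinner (fst p) x * cinner (snd p) y))\<^sup>2)
          \<le> (\<Sum>p\<in>fst ` F \<times> snd ` F. (cmod (cinner (fst p) x * cinner (snd p) y))\<^sup>2)"
        using F by (intro sum_mono2) (auto simp: rev_image_eqI)
      also have "\<dots> = (\<Sum>e\<in>fst ` F. (cmod (cinner e x))\<^sup>2) * (\<Sum>f\<in>snd ` F. (cmod (cinner f y))\<^sup>2)"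
        unfolding sum_product sum.cartesian_product
        by (intro sum.cong refl) (auto simp: norm_mult power_mult_distrib)
      also have "\<dots> \<le> (norm x)\<^sup>2 * (norm y)\<^sup>2"
        using F by (intro mult_mono bessel sum_nonneg) auto
      finally show "(\<Sum>p\<in>F. (cmod (cinner (fst p) x * cinner (snd p) y))\<^sup>2)
          \<le> (norm x)\<^sup>2 * (norm y)\<^sup>2" .
    qed
  qed simp
  then have "(\<lambda>p. (cmod (if p \<in> some_basis \<times> some_basis
      then cinner (fst p) x * cinner (snd p) y else 0))\<^sup>2) summable_on UNIV"
    by (rule summable_on_cong_neutral[THEN iffD1, rotated -1]) auto
  then show "(\<forall>p. p \<notin> some_basis \<times> some_basis \<longrightarrow>
        (if p \<in> some_basis \<times> some_basis then cinner (fst p) x * cinner (snd p) y else 0) = 0) \<and>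
      (\<lambda>p. (cmod (if p \<in> some_basis \<times> some_basis
        then cinner (fst p) x * cinner (snd p) y else 0))\<^sup>2) summable_on UNIV"
    by simp
qed

lemma cinner_tensor_vec: "cinner (x \<otimes>\<^sub>v y) (x' \<otimes>\<^sub>v y') = cinner x x' * cinner y y'"
proof -
  let ?f = "\<lambda>p. cnj (coord (x \<otimes>\<^sub>v y) p) * coord (x' \<otimes>\<^sub>v y') p"
  let ?g = "\<lambda>e. cnj (cinner e x) * cinner e x'" and ?h = "\<lambda>e. cnj (cinner e y) * cinner e y'"
  have gh: "?f p = ?g (fst p) * ?h (snd p)" if "p \<in> some_basis \<times> some_basis" for p
    using that by (simp add: tensor_vec.rep_eq)
  have f0: "?f p = 0" if "p \<notin> some_basis \<times> some_basis" for p
    using that by (simp add: tensor_vec.rep_eq)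
  have sm: "?f summable_on some_basis \<times> some_basis"
    by (rule summable_on_subset_banach[OF coord_mult_summable]) simp
  have "cinner (x \<otimes>\<^sub>v y) (x' \<otimes>\<^sub>v y') = infsum ?f (some_basis \<times> some_basis)"
    unfolding cinner_htensor_def by (rule infsum_cong_neutral) (auto simp: f0)
  also have "\<dots> = infsum (\<lambda>e. infsum (\<lambda>f. ?f (e, f)) some_basis) some_basis"
    using infsum_Sigma_banach[OF sm] by simp
  also have "\<dots> = infsum (\<lambda>e. ?g e * infsum ?h some_basis) some_basis"
  proof (rule infsum_cong)
    fix e :: 'a assume "e \<in> some_basis"
    then have "infsum (\<lambda>f. ?f (e, f)) some_basis = infsum (\<lambda>f. ?g e * ?h f) some_basis"
      by (intro infsum_cong) (simp add: gh)
    then show "infsum (\<lambda>f. ?f (e, f)) some_basis = ?g e * infsum ?h some_basis"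
      by (simp only: infsum_cmult_right')
  qed
  also have "\<dots> = infsum ?g some_basis * infsum ?h some_basis"
    by (simp only: infsum_cmult_left')
  finally show ?thesis by (simp only: infsumI[OF parseval])
qed

lemma closure_cspan_tensor_vec:
  "closure (cspan {x \<otimes>\<^sub>v y | x y. True}) = (UNIV :: ('h::chilbert_space, 'k::chilbert_space) htensor set)"
proof -
  have coord_sum: "coord (\<Sum>q\<in>F. c q *\<^sub>C b q) p = (\<Sum>q\<in>F. c q * coord (b q) p)"
    for F :: "('h \<times> 'k) set" and c and b :: "_ \<Rightarrow> ('h, 'k) htensor" and p
    by (induction F rule: infinite_finite_induct)
      (auto simp: zero_htensor.rep_eq plus_htensor.rep_eq scaleC_htensor.rep_eq)
  have cb: "coord (e \<otimes>\<^sub>v f) p = (if p = (e, f) then 1 else 0)"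
    if "e \<in> some_basis" "f \<in> some_basis" for e :: 'h and f :: 'k and p
    using that by (cases p) (auto simp: tensor_vec.rep_eq cinner_some_basis)
  have "z \<in> closure (cspan {x \<otimes>\<^sub>v y | x y. True})" for z :: "('h, 'k) htensor"
    unfolding closure_approachable
  proof (intro allI impI)
    fix e :: real assume "0 < e"
    let ?B = "some_basis \<times> some_basis :: ('h \<times> 'k) set"
    have z0: "coord z p = 0" if "p \<notin> ?B" for p using coord[of z] that by (cases p) auto
    have "((\<lambda>p. (cmod (coord z p))\<^sup>2) has_sum (norm z)\<^sup>2) UNIV"
      unfolding norm_htensor_sq by (rule has_sum_infsum[OF coord_sq_summable])
    then have "((\<lambda>p. (cmod (coord z p))\<^sup>2) has_sum (norm z)\<^sup>2) ?B"
      by (rule has_sum_cong_neutral[THEN iffD1, rotated -1]) (auto simp: z0)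
    then have lim: "(sum (\<lambda>p. (cmod (coord z p))\<^sup>2) \<longlongrightarrow> (norm z)\<^sup>2) (finite_subsets_at_top ?B)"
      by (simp add: has_sum_def)
    have "0 < e\<^sup>2" using \<open>0 < e\<close> by simp
    from tendstoD[OF lim this] obtain F where F: "finite F" "F \<subseteq> ?B"
      and d: "dist (\<Sum>p\<in>F. (cmod (coord z p))\<^sup>2) ((norm z)\<^sup>2) < e\<^sup>2"
      unfolding eventually_finite_subsets_at_top by auto
    define s where "s = (\<Sum>q\<in>F. coord z q *\<^sub>C (fst q \<otimes>\<^sub>v snd q))"
    have s: "coord s p = (if p \<in> F then coord z p else 0)" for p
    proof -
      have "coord s p = (\<Sum>q\<in>F. if p = q then coord z q else 0)"
        unfolding s_def coord_sum
      proof (intro sum.cong refl)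
        fix q assume "q \<in> F"
        then have "coord (fst q \<otimes>\<^sub>v snd q) p = (if p = (fst q, snd q) then 1 else 0)"
          using F(2) by (intro cb) auto
        then show "coord z q * coord (fst q \<otimes>\<^sub>v snd q) p = (if p = q then coord z q else 0)"
          by simp
      qed
      then show ?thesis using F(1) by simp
    qed
    have "(norm (s - z))\<^sup>2 = (\<Sum>\<^sub>\<infinity>p\<in>- F. (cmod (coord z p))\<^sup>2)"
      unfolding norm_htensor_sq coord_diff s by (rule infsum_cong_neutral) auto
    also have "\<dots> = (norm z)\<^sup>2 - (\<Sum>p\<in>F. (cmod (coord z p))\<^sup>2)"
    proof -
      have "(\<Sum>\<^sub>\<infinity>p\<in>UNIV - F. (cmod (coord z p))\<^sup>2) =
          (\<Sum>\<^sub>\<infinity>p. (cmod (coord z p))\<^sup>2) - (\<Sum>\<^sub>\<infinity>p\<in>F. (cmod (coord z p))\<^sup>2)"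
        using F(1) by (intro infsum_Diff coord_sq_summable summable_on_finite) auto
      then show ?thesis using F(1) by (simp add: norm_htensor_sq Compl_eq_Diff_UNIV)
    qed
    also have "\<dots> < e\<^sup>2" using d by (simp add: dist_real_def abs_if split: if_splits)
    finally have "dist s z < e"
      unfolding dist_norm by (rule power2_less_imp_less) (use \<open>0 < e\<close> in simp)
    moreover have "s \<in> cspan {x \<otimes>\<^sub>v y | x y. True}"
      unfolding s_def
      by (intro complex_vector.span_sum complex_vector.span_scale complex_vector.span_base) auto
    ultimately show "\<exists>y\<in>cspan {x \<otimes>\<^sub>v y | x y. True}. dist y z < e" by blast
  qed
  then show ?thesis by auto
qed


section \<open>Operators\<close>

text \<open>Elements of the library type of bounded linear maps are only real-linear, so that
  it also contains antilinear maps; \<open>bounded_ops\<close> is \<open>\<B>(H, K)\<close>.\<close>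

definition bounded_ops :: "('h::chilbert_space \<Rightarrow>\<^sub>L 'k::chilbert_space) set" where
  "bounded_ops = {T. \<forall>c x. blinfun_apply T (c *\<^sub>C x) = c *\<^sub>C blinfun_apply T x}"

definition adj :: "('h::chilbert_space \<Rightarrow>\<^sub>L 'k::chilbert_space) \<Rightarrow> ('k \<Rightarrow>\<^sub>L 'h)" where
  "adj T = (THE S. S \<in> bounded_ops \<and>
     (\<forall>x y. cinner (blinfun_apply S y) x = cinner y (blinfun_apply T x)))"

definition unitary_op :: "('h::chilbert_space \<Rightarrow>\<^sub>L 'k::chilbert_space) \<Rightarrow> bool" where
  "unitary_op U \<longleftrightarrow>
     U \<in> bounded_ops \<and> adj U o\<^sub>L U = id_blinfun \<and> U o\<^sub>L adj U = id_blinfun"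

definition commutant :: "('h::chilbert_space \<Rightarrow>\<^sub>L 'h) set \<Rightarrow> ('h \<Rightarrow>\<^sub>L 'h) set" where
  "commutant M = {T \<in> bounded_ops. \<forall>S\<in>M. T o\<^sub>L S = S o\<^sub>L T}"

definition tensor_op ::
    "('h::chilbert_space \<Rightarrow>\<^sub>L 'h'::chilbert_space) \<Rightarrow> ('k::chilbert_space \<Rightarrow>\<^sub>L 'k'::chilbert_space)
      \<Rightarrow> (('h, 'k) htensor \<Rightarrow>\<^sub>L ('h', 'k') htensor)"
    (infixr \<open>\<otimes>\<^sub>o\<close> 70) where
  "S \<otimes>\<^sub>o T = (THE X. X \<in> bounded_ops \<and>
     (\<forall>x y. blinfun_apply X (x \<otimes>\<^sub>v y) = blinfun_apply S x \<otimes>\<^sub>v blinfun_apply T y))"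

definition tensor_assoc ::
    "(('h::chilbert_space, 'k::chilbert_space) htensor, 'l::chilbert_space) htensor
      \<Rightarrow>\<^sub>L ('h, ('k, 'l) htensor) htensor" where
  "tensor_assoc = (THE X. X \<in> bounded_ops \<and>
     (\<forall>x y z. blinfun_apply X ((x \<otimes>\<^sub>v y) \<otimes>\<^sub>v z) = x \<otimes>\<^sub>v (y \<otimes>\<^sub>v z)))"

definition left_unitor :: "(complex, 'h::chilbert_space) htensor \<Rightarrow>\<^sub>L 'h" where
  "left_unitor = (THE X. X \<in> bounded_ops \<and> (\<forall>c x. blinfun_apply X (c \<otimes>\<^sub>v x) = c *\<^sub>C x))"

definition right_unitor :: "('h::chilbert_space, complex) htensor \<Rightarrow>\<^sub>L 'h" where
  "right_unitor = (THE X. X \<in> bounded_ops \<and> (\<forall>x c. blinfun_apply X (x \<otimes>\<^sub>v c) = c *\<^sub>C x))"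

text \<open>The spatial tensor product, as a norm-closed space of operators on the tensor product of
  the Hilbert spaces.  If one of the factors is finite-dimensional and the other one is closed,
  this is the algebraic tensor product.\<close>

definition tensor_space ::
    "('h::chilbert_space \<Rightarrow>\<^sub>L 'h) set \<Rightarrow> ('k::chilbert_space \<Rightarrow>\<^sub>L 'k) set
      \<Rightarrow> (('h, 'k) htensor \<Rightarrow>\<^sub>L ('h, 'k) htensor) set"
    (infixr \<open>\<otimes>\<^sub>s\<close> 70) where
  "S \<otimes>\<^sub>s T = closure (cspan {s \<otimes>\<^sub>o t | s t. s \<in> S \<and> t \<in> T})"

definition clinear_on ::
    "'a::complex_normed_vector set \<Rightarrow> ('a \<Rightarrow> 'b::complex_normed_vector) \<Rightarrow> bool" where
  "clinear_on X F \<longleftrightarrow>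
     (\<forall>x\<in>X. \<forall>y\<in>X. F (x + y) = F x + F y) \<and> (\<forall>c. \<forall>x\<in>X. F (c *\<^sub>C x) = c *\<^sub>C F x)"

text \<open>The continuous linear map on \<open>S \<otimes>\<^sub>s T\<close> with \<open>s \<otimes> t \<mapsto> p s t\<close>.  It is
  unique on \<open>S \<otimes>\<^sub>s T\<close> (its values elsewhere are irrelevant).  The maps \<open>f \<otimes> g\<close>
  below are those with \<open>p s t = f s \<otimes> g t\<close>.\<close>

definition tensor_lift ::
    "('h::chilbert_space \<Rightarrow>\<^sub>L 'h) set \<Rightarrow> ('k::chilbert_space \<Rightarrow>\<^sub>L 'k) set
      \<Rightarrow> (('h \<Rightarrow>\<^sub>L 'h) \<Rightarrow> ('k \<Rightarrow>\<^sub>L 'k) \<Rightarrow> 'c::complex_normed_vector)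
      \<Rightarrow> (('h, 'k) htensor \<Rightarrow>\<^sub>L ('h, 'k) htensor) \<Rightarrow> 'c" where
  "tensor_lift S T p = (SOME F. clinear_on (S \<otimes>\<^sub>s T) F \<and> continuous_on (S \<otimes>\<^sub>s T) F \<and>
     (\<forall>s\<in>S. \<forall>t\<in>T. F (s \<otimes>\<^sub>o t) = p s t))"


section \<open>Compact quantum groups\<close>

text \<open>A unital \<open>C*\<close>-algebra that is faithfully and non-degenerately represented on the Hilbert
  space \<open>'k\<close> is identified with its image.\<close>

definition cstar_algebra_on :: "('k::chilbert_space \<Rightarrow>\<^sub>L 'k) set \<Rightarrow> bool" where
  "cstar_algebra_on A \<longleftrightarrow>
     A \<subseteq> bounded_ops \<and> csubspace A \<and> closed A \<and> id_blinfun \<in> A \<and>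
     (\<forall>a\<in>A. \<forall>b\<in>A. a o\<^sub>L b \<in> A) \<and> (\<forall>a\<in>A. adj a \<in> A)"

definition compact_quantum_group ::
    "('k::chilbert_space \<Rightarrow>\<^sub>L 'k) set
      \<Rightarrow> (('k \<Rightarrow>\<^sub>L 'k) \<Rightarrow> (('k, 'k) htensor \<Rightarrow>\<^sub>L ('k, 'k) htensor)) \<Rightarrow> bool" where
  "compact_quantum_group A \<Delta> \<longleftrightarrow>
     cstar_algebra_on A \<and>
     (\<forall>a\<in>A. \<Delta> a \<in> A \<otimes>\<^sub>s A) \<and> clinear_on A \<Delta> \<and>
     (\<forall>a\<in>A. \<forall>b\<in>A. \<Delta> (a o\<^sub>L b) = \<Delta> a o\<^sub>L \<Delta> b) \<and>
     (\<forall>a\<in>A. \<Delta> (adj a) = adj (\<Delta> a)) \<and> \<Delta> id_blinfun = id_blinfun \<and>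
     (\<forall>a\<in>A. tensor_assoc o\<^sub>L tensor_lift A A (\<lambda>s t. \<Delta> s \<otimes>\<^sub>o t) (\<Delta> a) =
        tensor_lift A A (\<lambda>s t. s \<otimes>\<^sub>o \<Delta> t) (\<Delta> a) o\<^sub>L tensor_assoc) \<and>
     closure (cspan {(a \<otimes>\<^sub>o id_blinfun) o\<^sub>L \<Delta> b | a b. a \<in> A \<and> b \<in> A}) = A \<otimes>\<^sub>s A \<and>
     closure (cspan {(id_blinfun \<otimes>\<^sub>o a) o\<^sub>L \<Delta> b | a b. a \<in> A \<and> b \<in> A}) = A \<otimes>\<^sub>s A"

definition unitary_corepresentation ::
    "('k::chilbert_space \<Rightarrow>\<^sub>L 'k) set
      \<Rightarrow> (('k \<Rightarrow>\<^sub>L 'k) \<Rightarrow> (('k, 'k) htensor \<Rightarrow>\<^sub>L ('k, 'k) htensor))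
      \<Rightarrow> nat \<Rightarrow> (nat \<Rightarrow> nat \<Rightarrow> 'k \<Rightarrow>\<^sub>L 'k) \<Rightarrow> bool" where
  "unitary_corepresentation A \<Delta> n u \<longleftrightarrow>
     (\<forall>i<n. \<forall>j<n. u i j \<in> A \<and> \<Delta> (u i j) = (\<Sum>k<n. u i k \<otimes>\<^sub>o u k j)) \<and>
     (\<forall>i<n. \<forall>j<n. (\<Sum>k<n. adj (u k i) o\<^sub>L u k j) = (if i = j then id_blinfun else 0)) \<and>
     (\<forall>i<n. \<forall>j<n. (\<Sum>k<n. u i k o\<^sub>L adj (u j k)) = (if i = j then id_blinfun else 0))"

text \<open>The dense Hopf *-algebra \<open>\<O>\<^sub>A\<close>.\<close>

definition hopf_algebra ::
    "('k::chilbert_space \<Rightarrow>\<^sub>L 'k) set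
      \<Rightarrow> (('k \<Rightarrow>\<^sub>L 'k) \<Rightarrow> (('k, 'k) htensor \<Rightarrow>\<^sub>L ('k, 'k) htensor)) \<Rightarrow> ('k \<Rightarrow>\<^sub>L 'k) set" where
  "hopf_algebra A \<Delta> =
     cspan {u i j | n u i j. unitary_corepresentation A \<Delta> n u \<and> i < n \<and> j < n}"

text \<open>The antipode identities \<open>m (S \<otimes> id) \<Delta> = \<epsilon>(\<cdot>) 1 = m (id \<otimes> S) \<Delta>\<close> on
  matrix coefficients, where \<open>\<epsilon>(u\<^sub>i\<^sub>j) = \<delta>\<^sub>i\<^sub>j\<close>.\<close>

definition is_antipode ::
    "('k::chilbert_space \<Rightarrow>\<^sub>L 'k) set
      \<Rightarrow> (('k \<Rightarrow>\<^sub>L 'k) \<Rightarrow> (('k, 'k) htensor \<Rightarrow>\<^sub>L ('k, 'k) htensor))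
      \<Rightarrow> (('k \<Rightarrow>\<^sub>L 'k) \<Rightarrow> ('k \<Rightarrow>\<^sub>L 'k)) \<Rightarrow> bool" where
  "is_antipode A \<Delta> S \<longleftrightarrow>
     clinear_on (hopf_algebra A \<Delta>) S \<and> S ` hopf_algebra A \<Delta> \<subseteq> hopf_algebra A \<Delta> \<and>
     (\<forall>n u. unitary_corepresentation A \<Delta> n u \<longrightarrow> (\<forall>i<n. \<forall>j<n.
        (\<Sum>k<n. S (u i k) o\<^sub>L u k j) = (if i = j then id_blinfun else 0) \<and>
        (\<Sum>k<n. u i k o\<^sub>L S (u k j)) = (if i = j then id_blinfun else 0)))"

text \<open>The scaling group, extended to complex parameters on \<open>\<O>\<^sub>A\<close>.  For a finite-dimensional
  unitary corepresentation \<open>u\<close> there is a positive invertible matrix \<open>F\<close> with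
  \<open>(id \<otimes> S\<^sup>2)(u) = F u F\<^sup>-\<^sup>1\<close>, and then \<open>(id \<otimes> \<tau>\<^sub>z)(u) = F\<^sup>i\<^sup>z u F\<^sup>-\<^sup>i\<^sup>z\<close>.  Changing the
  orthonormal basis replaces \<open>u\<close> by another unitary corepresentation with the same span of
  coefficients, so one may take \<open>F = diag(l\<^sub>0, l\<^sub>1, \<dots>)\<close>.
  These conditions determine \<open>\<tau>\<close> on \<open>\<O>\<^sub>A\<close>.\<close>

definition is_scaling_group ::
    "('k::chilbert_space \<Rightarrow>\<^sub>L 'k) set
      \<Rightarrow> (('k \<Rightarrow>\<^sub>L 'k) \<Rightarrow> (('k, 'k) htensor \<Rightarrow>\<^sub>L ('k, 'k) htensor))
      \<Rightarrow> (('k \<Rightarrow>\<^sub>L 'k) \<Rightarrow> ('k \<Rightarrow>\<^sub>L 'k)) \<Rightarrow> (complex \<Rightarrow> ('k \<Rightarrow>\<^sub>L 'k) \<Rightarrow> ('k \<Rightarrow>\<^sub>L 'k)) \<Rightarrow> bool" where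
  "is_scaling_group A \<Delta> S \<tau> \<longleftrightarrow>
     (\<forall>z. clinear_on (hopf_algebra A \<Delta>) (\<tau> z)) \<and>
     (\<forall>n u l. unitary_corepresentation A \<Delta> n u \<and> (\<forall>i<n. l i > (0::real)) \<and>
        (\<forall>i<n. \<forall>j<n. S (S (u i j)) = complex_of_real (l i / l j) *\<^sub>C u i j) \<longrightarrow>
        (\<forall>z. \<forall>i<n. \<forall>j<n. \<tau> z (u i j) = (complex_of_real (l i / l j) powr (\<i> * z)) *\<^sub>C u i j))"

definition unitary_antipode ::
    "('k::chilbert_space \<Rightarrow>\<^sub>L 'k) set
      \<Rightarrow> (('k \<Rightarrow>\<^sub>L 'k) \<Rightarrow> (('k, 'k) htensor \<Rightarrow>\<^sub>L ('k, 'k) htensor))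
      \<Rightarrow> (('k \<Rightarrow>\<^sub>L 'k) \<Rightarrow> ('k \<Rightarrow>\<^sub>L 'k)) \<Rightarrow> bool" where
  "unitary_antipode A \<Delta> R \<longleftrightarrow>
     (\<forall>a\<in>A. R a \<in> A) \<and> clinear_on A R \<and>
     (\<forall>a\<in>A. \<forall>b\<in>A. R (a o\<^sub>L b) = R b o\<^sub>L R a) \<and>
     (\<forall>a\<in>A. R (adj a) = adj (R a)) \<and> (\<forall>a\<in>A. R (R a) = a) \<and>
     (\<forall>a\<in>A. tensor_lift A A (\<lambda>s t. t \<otimes>\<^sub>o s)
        (tensor_lift A A (\<lambda>s t. R s \<otimes>\<^sub>o R t) (\<Delta> a)) = \<Delta> (R a)) \<and>
     (\<exists>S \<tau>. is_antipode A \<Delta> S \<and> is_scaling_group A \<Delta> S \<tau> \<and>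
        (\<forall>a\<in>hopf_algebra A \<Delta>. S a = R (\<tau> (- \<i> / 2) a)))"


section \<open>Finite-dimensional C*-algebras with a faithful state\<close>

text \<open>A system of matrix units, that is, a *-isomorphism of the algebra with the direct sum of
  the full matrix algebras of sizes \<open>n 0, \<dots>, n (r - 1)\<close>; in particular the algebra is
  finite-dimensional.  Conversely every finite-dimensional \<open>C*\<close>-algebra has such a system.\<close>

definition matrix_units ::
    "nat \<Rightarrow> (nat \<Rightarrow> nat) \<Rightarrow> (nat \<Rightarrow> nat \<Rightarrow> nat \<Rightarrow> 'b::cstar_algebra) \<Rightarrow> bool" where
  "matrix_units r n E \<longleftrightarrow>
     (\<forall>k<r. \<forall>i<n k. \<forall>j<n k. E k i j \<noteq> 0 \<and> star (E k i j) = E k j i) \<and>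
     (\<forall>k<r. \<forall>i<n k. \<forall>j<n k. \<forall>l<r. \<forall>p<n l. \<forall>q<n l.
        E k i j * E l p q = (if k = l \<and> j = p then E k i q else 0)) \<and>
     cspan {E k i j | k i j. k < r \<and> i < n k \<and> j < n k} = UNIV"

definition block_trace ::
    "nat \<Rightarrow> (nat \<Rightarrow> nat) \<Rightarrow> (nat \<Rightarrow> nat \<Rightarrow> nat \<Rightarrow> 'b::cstar_algebra) \<Rightarrow> 'b \<Rightarrow> complex" where
  "block_trace r n E b =
     (THE t. \<exists>c. b = (\<Sum>k<r. \<Sum>i<n k. \<Sum>j<n k. c k i j *\<^sub>C E k i j) \<and> t = (\<Sum>k<r. \<Sum>i<n k. c k i i))"

definition positive_invertible :: "'b::cstar_algebra \<Rightarrow> bool" where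
  "positive_invertible Q \<longleftrightarrow> (\<exists>c. Q = star c * c) \<and> (\<exists>P. P * Q = 1 \<and> Q * P = 1)"

definition faithful_state :: "('b::cstar_algebra \<Rightarrow> complex) \<Rightarrow> bool" where
  "faithful_state \<psi> \<longleftrightarrow>
     clinear \<psi> \<and> \<psi> 1 = 1 \<and>
     (\<forall>a. Im (\<psi> (star a * a)) = 0 \<and> 0 \<le> Re (\<psi> (star a * a))) \<and>
     (\<forall>a. \<psi> (star a * a) = 0 \<longrightarrow> a = 0)"

text \<open>\<open>Q\<^sup>w = exp (w log Q)\<close> for positive invertible \<open>Q\<close>.\<close>

definition cstar_log :: "'b::cstar_algebra \<Rightarrow> 'b" where
  "cstar_log Q = (THE L. star L = L \<and> exp L = Q)"

definition cstar_powr :: "'b::cstar_algebra \<Rightarrow> complex \<Rightarrow> 'b" where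
  "cstar_powr Q w = exp (w *\<^sub>C cstar_log Q)"

definition modular_aut :: "'b::cstar_algebra \<Rightarrow> complex \<Rightarrow> 'b \<Rightarrow> 'b" where
  "modular_aut Q z a = cstar_powr Q (\<i> * z) * a * cstar_powr Q (- \<i> * z)"

text \<open>\<open>'h\<close> is \<open>L\<^sup>2(B)\<close>, with GNS map \<open>\<Lambda>\<close>.\<close>

definition gns_map :: "('b::cstar_algebra \<Rightarrow> complex) \<Rightarrow> ('b \<Rightarrow> 'h::chilbert_space) \<Rightarrow> bool" where
  "gns_map \<psi> \<Lambda> \<longleftrightarrow>
     clinear \<Lambda> \<and> bij \<Lambda> \<and> (\<forall>a b. cinner (\<Lambda> a) (\<Lambda> b) = \<psi> (star a * b))"

definition left_mult :: "('b::cstar_algebra \<Rightarrow> 'h::chilbert_space) \<Rightarrow> 'b \<Rightarrow> ('h \<Rightarrow>\<^sub>L 'h)" where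
  "left_mult \<Lambda> a = Blinfun (\<lambda>x. \<Lambda> (a * inv \<Lambda> x))"

definition mult_op :: "('b::cstar_algebra \<Rightarrow> 'h::chilbert_space) \<Rightarrow> (('h, 'h) htensor \<Rightarrow>\<^sub>L 'h)" where
  "mult_op \<Lambda> = (THE m. m \<in> bounded_ops \<and>
     (\<forall>a b. blinfun_apply m (\<Lambda> a \<otimes>\<^sub>v \<Lambda> b) = \<Lambda> (a * b)))"

definition unit_op :: "('b::cstar_algebra \<Rightarrow> 'h::chilbert_space) \<Rightarrow> (complex \<Rightarrow>\<^sub>L 'h)" where
  "unit_op \<Lambda> = Blinfun (\<lambda>c. c *\<^sub>C \<Lambda> 1)"

definition modular_conj :: "('b::cstar_algebra \<Rightarrow> 'h::chilbert_space) \<Rightarrow> 'b \<Rightarrow> ('h \<Rightarrow>\<^sub>L 'h)" where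
  "modular_conj \<Lambda> Q = Blinfun (\<lambda>x. \<Lambda> (star (modular_aut Q (\<i> / 2) (inv \<Lambda> x))))"

definition kappa ::
    "('b::cstar_algebra \<Rightarrow> 'h::chilbert_space) \<Rightarrow> 'b \<Rightarrow> ('h \<Rightarrow>\<^sub>L 'h) \<Rightarrow> ('h \<Rightarrow>\<^sub>L 'h)" where
  "kappa \<Lambda> Q x = modular_conj \<Lambda> Q o\<^sub>L adj x o\<^sub>L modular_conj \<Lambda> Q"

definition commutant_bimodule ::
    "('b::cstar_algebra \<Rightarrow> 'h::chilbert_space) \<Rightarrow> ('h \<Rightarrow>\<^sub>L 'h) \<Rightarrow> ('h \<Rightarrow>\<^sub>L 'h) set" where
  "commutant_bimodule \<Lambda> T = cspan {x o\<^sub>L T o\<^sub>L y | x y.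
     x \<in> commutant (range (left_mult \<Lambda>)) \<and> y \<in> commutant (range (left_mult \<Lambda>))}"


section \<open>Coactions\<close>

text \<open>\<open>B\<close> is identified with the operators \<open>left_mult \<Lambda> b\<close> on \<open>L\<^sup>2(B)\<close>, so that
  \<open>B \<otimes> A\<close> acts on \<open>L\<^sup>2(B) \<otimes> K\<close>.\<close>

definition coaction ::
    "('k::chilbert_space \<Rightarrow>\<^sub>L 'k) set
      \<Rightarrow> (('k \<Rightarrow>\<^sub>L 'k) \<Rightarrow> (('k, 'k) htensor \<Rightarrow>\<^sub>L ('k, 'k) htensor))
      \<Rightarrow> ('b::cstar_algebra \<Rightarrow> 'h::chilbert_space)
      \<Rightarrow> ('b \<Rightarrow> (('h, 'k) htensor \<Rightarrow>\<^sub>L ('h, 'k) htensor)) \<Rightarrow> bool" where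
  "coaction A \<Delta> \<Lambda> \<alpha> \<longleftrightarrow>
     (\<forall>b. \<alpha> b \<in> range (left_mult \<Lambda>) \<otimes>\<^sub>s A) \<and> clinear \<alpha> \<and>
     (\<forall>a b. \<alpha> (a * b) = \<alpha> a o\<^sub>L \<alpha> b) \<and> (\<forall>b. \<alpha> (star b) = adj (\<alpha> b)) \<and> \<alpha> 1 = id_blinfun \<and>
     (\<forall>b. tensor_assoc o\<^sub>L
          tensor_lift (range (left_mult \<Lambda>)) A (\<lambda>s t. \<alpha> (inv (left_mult \<Lambda>) s) \<otimes>\<^sub>o t) (\<alpha> b) =
        tensor_lift (range (left_mult \<Lambda>)) A (\<lambda>s t. s \<otimes>\<^sub>o \<Delta> t) (\<alpha> b) o\<^sub>L tensor_assoc) \<and>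
     closure (cspan {(id_blinfun \<otimes>\<^sub>o a) o\<^sub>L \<alpha> b | a b. a \<in> A}) = range (left_mult \<Lambda>) \<otimes>\<^sub>s A"

definition preserves_state ::
    "('k::chilbert_space \<Rightarrow>\<^sub>L 'k) set \<Rightarrow> ('b::cstar_algebra \<Rightarrow> 'h::chilbert_space)
      \<Rightarrow> ('b \<Rightarrow> complex) \<Rightarrow> ('b \<Rightarrow> (('h, 'k) htensor \<Rightarrow>\<^sub>L ('h, 'k) htensor)) \<Rightarrow> bool" where
  "preserves_state A \<Lambda> \<psi> \<alpha> \<longleftrightarrow>
     (\<forall>b. tensor_lift (range (left_mult \<Lambda>)) A (\<lambda>s t. \<psi> (inv (left_mult \<Lambda>) s) *\<^sub>C t) (\<alpha> b) =
        \<psi> b *\<^sub>C id_blinfun)"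

definition unitary_implementation ::
    "('b::cstar_algebra \<Rightarrow> 'h::chilbert_space)
      \<Rightarrow> ('b \<Rightarrow> (('h, 'k::chilbert_space) htensor \<Rightarrow>\<^sub>L ('h, 'k) htensor))
      \<Rightarrow> (('h, 'k) htensor \<Rightarrow>\<^sub>L ('h, 'k) htensor) \<Rightarrow> bool" where
  "unitary_implementation \<Lambda> \<alpha> U \<longleftrightarrow>
     unitary_op U \<and>
     (\<forall>b \<xi>. blinfun_apply U (\<Lambda> b \<otimes>\<^sub>v \<xi>) = blinfun_apply (\<alpha> b) (\<Lambda> 1 \<otimes>\<^sub>v \<xi>))"

definition alpha_U ::
    "(('h::chilbert_space, 'k::chilbert_space) htensor \<Rightarrow>\<^sub>L ('h, 'k) htensor)
      \<Rightarrow> ('h \<Rightarrow>\<^sub>L 'h) \<Rightarrow> (('h, 'k) htensor \<Rightarrow>\<^sub>L ('h, 'k) htensor)" where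
  "alpha_U U x = U o\<^sub>L (x \<otimes>\<^sub>o id_blinfun) o\<^sub>L adj U"

definition alpha_U_op ::
    "('k::chilbert_space \<Rightarrow>\<^sub>L 'k) set \<Rightarrow> (('k \<Rightarrow>\<^sub>L 'k) \<Rightarrow> ('k \<Rightarrow>\<^sub>L 'k))
      \<Rightarrow> ('b::cstar_algebra \<Rightarrow> 'h::chilbert_space) \<Rightarrow> 'b
      \<Rightarrow> (('h, 'k) htensor \<Rightarrow>\<^sub>L ('h, 'k) htensor)
      \<Rightarrow> ('h \<Rightarrow>\<^sub>L 'h) \<Rightarrow> (('h, 'k) htensor \<Rightarrow>\<^sub>L ('h, 'k) htensor)" where
  "alpha_U_op A R \<Lambda> Q U x =
     tensor_lift bounded_ops A (\<lambda>s t. kappa \<Lambda> Q s \<otimes>\<^sub>o R t) (alpha_U U (kappa \<Lambda> Q x))"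

end

theory Submission
  imports Defs "HOL-Computational_Algebra.Fundamental_Theorem_Algebra"
begin

text \<open>The self-adjoint undirected \<open>A\<^sub>G\<close> preserves \<open>*\<close> and commutes with \<open>J\<close>, so
  \<open>\<kappa>(S\<^sub>0) = B A\<^sub>G B\<close>.  As \<open>\<alpha>\<^sub>U\<close> restricts to \<open>\<alpha>\<close> on \<open>B\<close>, invariance of \<open>A\<^sub>G\<close> gives invariance
  of \<open>B A\<^sub>G B\<close>.  Conversely, identify \<open>\<B>(L\<^sup>2(B))\<close> with \<open>L\<^sup>2(B) \<otimes> L\<^sup>2(B)\<close> by
  \<open>\<bar>\<Lambda>(a)\<rangle>\<langle>\<Lambda>(b)\<bar> \<mapsto> \<Lambda>(a) \<otimes> \<Lambda>(b\<^sup>*)\<close>.  Then \<open>\<alpha>\<^sub>U\<close> becomes a unitary corepresentation, and the antipode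
  shows that the orthogonal complement of \<open>B A\<^sub>G B\<close> is invariant along with \<open>B A\<^sub>G B\<close>.  Schur
  multiplication by \<open>A\<^sub>G\<close> is the orthogonal projection onto \<open>B A\<^sub>G B\<close>, and it sends
  \<open>\<bar>\<Lambda>(1)\<rangle>\<langle>\<Lambda>(1)\<bar>\<close>, which is invariant because \<open>\<alpha>(1) = 1\<close>, to \<open>A\<^sub>G\<close>.  The opposite coaction is
  \<open>\<alpha>\<^sub>U\<close> conjugated by the involution \<open>\<kappa> \<otimes> R\<close>.\<close>

section \<open>Operators on Hilbert spaces\<close>

text \<open>The obstacle is that \<psi> need not be tracial. For the Hilbert-Schmidt inner product
  the coefficients of \<open>alpha_U U\<close> are u_ik (adj u_jl), and the matrix of the adj u_jl
  is in general not unitary, so orthogonal complements need not be invariant. Taking the star of the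
  second vector replaces them by u_ik u_ml, the coefficients of the tensor square of the unitary
  matrix u. The price is paid on the graph side: self-adjointness of Schur multiplication for the
  new inner product rests on combining both symmetries of A with the KMS property of \<psi>. The
  same combination shows that A commutes with the modular operator; J involves its square root,
  which is why a separate argument about square roots appears. A second obstacle is analytic:
  \<Delta> and R are algebraic data, while their tensor lifts are specified as continuous maps.
  Continuity comes from contractivity of unital *-homomorphisms and *-antihomomorphisms. Since
  L^2(B) is finite-dimensional, the rest is calculation with finite matrices over the algebra of the
  quantum group.\<close>

lemma riesz_real:
  fixes f :: "'a::{real_inner,complete_space} \<Rightarrow> real"
  assumes "bounded_linear f"
  shows "\<exists>y. \<forall>x. f x = inner y x"
proof -
  interpret f: bounded_linear f by fact
  obtain K where K: "\<And>x. norm (f x) \<le> norm x * K" "K > 0" using f.pos_bounded by blast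
  \<comment> \<open>The representing vector is the minimiser of \<open>q\<close>: if f is the
    pairing with y, then \<open>q x\<close> is the squared distance from x to y up to an additive
    constant.\<close>
  define q where "q x = (norm x)\<^sup>2 - 2 * f x" for x
  define m where "m = Inf (range q)"
  have "q x \<ge> - K\<^sup>2" for x
  proof -
    have "0 \<le> (norm x - K)\<^sup>2" by simp
    then show ?thesis using K(1)[of x] unfolding q_def power2_diff by simp
  qed
  then have bdd: "bdd_below (range q)" by (intro bdd_belowI2)
  have ge: "m \<le> q x" for x unfolding m_def by (rule cINF_lower[OF bdd]) simp
  have "\<exists>x. q x < m + inverse (Suc n)" for n
    using cInf_lessD[of "range q" "m + inverse (Suc n)"] unfolding m_def by auto
  then obtain X where X: "\<And>n. q (X n) < m + inverse (Suc n)" by metis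
  \<comment> \<open>Parallelogram law: \<open>q\<close> is at least \<open>m\<close> at the
    midpoint, so near-minimisers are close to each other and a minimising sequence is
    Cauchy.\<close>
  have par: "(norm (x - y))\<^sup>2 \<le> 2 * (q x + q y - 2 * m)" for x y
  proof -
    have "q x + q y - 2 * q ((1/2) *\<^sub>R (x + y)) = (norm (x - y))\<^sup>2 / 2"
      unfolding q_def power2_norm_eq_inner f.scaleR f.add
      by (simp add: inner_add inner_diff inner_commute algebra_simps)
    then show ?thesis using ge[of "(1/2) *\<^sub>R (x + y)"] by simp
  qed
  have "Cauchy X"
  proof (rule CauchyI)
    fix e :: real assume "0 < e"
    then have "e\<^sup>2 / 4 > 0" by simp
    then obtain N where N: "inverse (Suc N) < e\<^sup>2 / 4" using reals_Archimedean by blast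
    have "norm (X a - X b) < e" if "a \<ge> N" "b \<ge> N" for a b
    proof (rule power2_less_imp_less)
      have "inverse (real (Suc a)) \<le> inverse (Suc N)" "inverse (real (Suc b)) \<le> inverse (Suc N)"
        using that by (auto intro!: le_imp_inverse_le)
      then have "q (X a) < m + inverse (Suc N)" "q (X b) < m + inverse (Suc N)"
        using X[of a] X[of b] by (auto elim!: less_le_trans)
      moreover have "p < s" if "qa < m + r" "qb < m + r" "p \<le> 2 * (qa + qb - 2 * m)" "r < s / 4"
        for p s qa qb r :: real using that by (simp add: field_simps)
      ultimately show "(norm (X a - X b))\<^sup>2 < e\<^sup>2" using par[of "X a" "X b"] N by blast
    qed (use \<open>0 < e\<close> in simp)
    then show "\<exists>M. \<forall>m\<ge>M. \<forall>n\<ge>M. norm (X m - X n) < e" by blast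
  qed
  then obtain y where y: "X \<longlonglongrightarrow> y" using Cauchy_convergent convergent_def by blast
  have lim: "(\<lambda>n. q (X n)) \<longlonglongrightarrow> q y" unfolding q_def by (intro tendsto_intros y f.tendsto)
  have "(\<lambda>n. m + inverse (Suc n)) \<longlonglongrightarrow> m + 0"
    by (intro tendsto_intros LIMSEQ_inverse_real_of_nat)
  then have "q y \<le> m + 0" by (rule LIMSEQ_le[OF lim]) (use X in \<open>auto intro!: exI[of _ 0] less_imp_le\<close>)
  then have qy: "q y \<le> q (y + t *\<^sub>R x)" for t x using ge[of "y + t *\<^sub>R x"] by simp
  have "f x = inner y x" for x
  proof (cases "x = 0")
    case False
    then have nx: "inner x x > 0" by simp
    have *: "0 \<le> t\<^sup>2 * inner x x + 2 * t * (inner y x - f x)" for t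
      using qy[of t x] unfolding q_def power2_norm_eq_inner f.add f.scaleR
      by (simp add: inner_add inner_commute algebra_simps power2_eq_square)
    define d where "d = inner y x - f x"
    \<comment> \<open>This value of t minimises the quadratic polynomial.\<close>
    have "0 \<le> (- d / inner x x)\<^sup>2 * inner x x + 2 * (- d / inner x x) * d"
      using *[of "- d / inner x x"] by (simp add: d_def)
    also have "\<dots> = - (d\<^sup>2 / inner x x)" using nx by (simp add: field_simps power2_eq_square)
    finally have "d\<^sup>2 / inner x x \<le> 0" by simp
    then have "d = 0" using nx by (simp add: divide_le_0_iff)
    then show ?thesis by (simp add: d_def)
  qed simp
  then show ?thesis by blast
qed

lemma cinner_uminus_right [simp]: "cinner x (- y) = - cinner x (y :: 'h::chilbert_space)"
  using cinner_diff_right[of x 0 y] by simp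

lemma cinner_diff_left: "cinner (x - y) z = cinner x z - cinner y (z :: 'h::chilbert_space)"
  by (metis cinner_commute cinner_diff_right complex_cnj_diff)

lemma cinner_eqI: "(\<And>x. cinner x y = cinner x z) \<Longrightarrow> y = (z :: 'h::chilbert_space)"
proof -
  assume "\<And>x. cinner x y = cinner x z"
  then have "cinner (y - z) (y - z) = 0" by (simp add: cinner_diff_right)
  then show ?thesis by (simp add: cinner_self)
qed

lemma Re_cinner_commute: "Re (cinner x y) = Re (cinner y (x :: 'h::chilbert_space))"
  by (metis cinner_commute cnj.sel(1))

lemma complex_eqI_Re:
  assumes "Re a = Re b" "Re (\<i> * a) = Re (\<i> * b)"
  shows "a = b"
  using assms by (auto simp: complex_eq_iff)

lemma bounded_opsI: "(\<And>c x. blinfun_apply T (c *\<^sub>C x) = c *\<^sub>C blinfun_apply T x) \<Longrightarrow> T \<in> bounded_ops"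
  by (simp add: bounded_ops_def)

lemma op_scaleC: "T \<in> bounded_ops \<Longrightarrow> blinfun_apply T (c *\<^sub>C x) = c *\<^sub>C blinfun_apply T x"
  by (simp add: bounded_ops_def)

text \<open>The Riesz theorem for real spaces is applied to the real part of the form, and replacing
  w by \<i> w recovers the imaginary part. Adjoints and ampliations are both obtained this
  way.\<close>

lemma op_of_form:
  fixes B :: "'k::chilbert_space \<Rightarrow> 'h::chilbert_space \<Rightarrow> complex"
  assumes add_left: "\<And>w w' z. B (w + w') z = B w z + B w' z"
    and add_right: "\<And>w z z'. B w (z + z') = B w z + B w z'"
    and scale_left: "\<And>c w z. B (c *\<^sub>C w) z = cnj c * B w z"
    and scale_right: "\<And>c w z. B w (c *\<^sub>C z) = c * B w z"
    and bound: "\<And>w z. cmod (B w z) \<le> C * norm w * norm z"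
  shows "\<exists>X\<in>bounded_ops. norm X \<le> \<bar>C\<bar> \<and> (\<forall>w z. cinner w (blinfun_apply X z) = B w z)"
proof -
  have "\<exists>y. \<forall>w. cinner w y = B w z" for z
  proof -
    have "bounded_linear (\<lambda>w. Re (B w z))"
    proof (rule bounded_linear_intro[where K = "C * norm z"])
      show "norm (Re (B w z)) \<le> norm w * (C * norm z)" for w
        using order_trans[OF abs_Re_le_cmod bound[of w z]] by (simp add: ac_simps)
    qed (simp_all add: add_left scale_left scaleR_scaleC)
    then obtain y where y: "\<And>w. Re (B w z) = inner y w" using riesz_real by blast
    have "cinner w y = B w z" for w
    proof (rule complex_eqI_Re)
      show *: "Re (cinner w y) = Re (B w z)" for w
        unfolding y inner_Re_cinner by (rule Re_cinner_commute)
      show "Re (\<i> * cinner w y) = Re (\<i> * B w z)"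
        using *[of "\<i> *\<^sub>C w"] by (simp add: cinner_scaleC_left scale_left)
    qed
    then show ?thesis by blast
  qed
  then obtain X where X: "\<And>w z. cinner w (X z) = B w z" by metis
  have sc: "X (c *\<^sub>C z) = c *\<^sub>C X z" for c z
    by (rule cinner_eqI) (simp add: X scale_right cinner_scaleC_right)
  have bd: "norm (X z) \<le> norm z * \<bar>C\<bar>" for z
  proof -
    have "norm (X z) * norm (X z) = cmod (B (X z) z)"
      by (simp add: X[symmetric] cinner_self power2_eq_square norm_mult)
    also have "\<dots> \<le> C * norm (X z) * norm z" by (rule bound)
    also have "\<dots> \<le> \<bar>C\<bar> * norm (X z) * norm z" by (intro mult_right_mono) auto
    finally have "norm (X z) * norm (X z) \<le> norm (X z) * (norm z * \<bar>C\<bar>)" by (simp add: ac_simps)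
    then show ?thesis
      by (cases "X z = 0") (auto simp: mult_le_cancel_left)
  qed
  have bl: "bounded_linear X"
  proof (rule bounded_linear_intro[OF _ _ bd])
    show "X (a + b) = X a + X b" for a b
      by (rule cinner_eqI) (simp add: X add_right cinner_add_right)
    show "X (r *\<^sub>R a) = r *\<^sub>R X a" for r a by (simp add: scaleR_scaleC sc)
  qed
  show ?thesis
  proof (intro bexI conjI allI)
    show "Blinfun X \<in> bounded_ops" by (rule bounded_opsI) (simp add: bounded_linear_Blinfun_apply bl sc)
    show "norm (Blinfun X) \<le> \<bar>C\<bar>"
      by (rule norm_blinfun_bound) (use bd in \<open>simp_all add: bounded_linear_Blinfun_apply bl mult.commute\<close>)
  qed (simp add: bounded_linear_Blinfun_apply bl X)
qed

section \<open>Algebra of complex-linear bounded operators\<close>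

lemma bounded_ops_id [simp, intro]: "id_blinfun \<in> bounded_ops"
  by (rule bounded_opsI) simp

lemma bounded_ops_compose [simp, intro]: "S \<in> bounded_ops \<Longrightarrow> T \<in> bounded_ops \<Longrightarrow> S o\<^sub>L T \<in> bounded_ops"
  by (simp add: bounded_ops_def)

lemma bounded_ops_zero [simp, intro]: "0 \<in> bounded_ops"
  by (rule bounded_opsI) simp

lemma bounded_ops_add [simp, intro]: "S \<in> bounded_ops \<Longrightarrow> T \<in> bounded_ops \<Longrightarrow> S + T \<in> bounded_ops"
  by (simp add: bounded_ops_def blinfun.add_left scaleC_add_right)

lemma bounded_ops_scaleC [simp, intro]: "T \<in> bounded_ops \<Longrightarrow> c *\<^sub>C T \<in> bounded_ops"
  by (simp add: bounded_ops_def scaleC_blinfun.rep_eq scaleC_scaleC mult.commute)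

lemma csubspace_bounded_ops: "csubspace bounded_ops"
  by (rule complex_vector.subspaceI) auto

lemma bounded_ops_diff [simp, intro]: "S \<in> bounded_ops \<Longrightarrow> T \<in> bounded_ops \<Longrightarrow> S - T \<in> bounded_ops"
  by (rule complex_vector.subspace_diff[OF csubspace_bounded_ops])

lemma bounded_ops_sum [simp, intro]: "(\<And>i. i \<in> I \<Longrightarrow> T i \<in> bounded_ops) \<Longrightarrow> sum T I \<in> bounded_ops"
  by (rule complex_vector.subspace_sum[OF csubspace_bounded_ops])

lemma bounded_linear_scaleC: "bounded_linear (\<lambda>x. c *\<^sub>C (x :: 'a::complex_normed_vector))"
  by (rule bounded_linear_intro[where K = "cmod c"])
    (simp_all add: scaleC_add_right scaleR_scaleC scaleC_scaleC mult.commute norm_scaleC)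

lemma closed_bounded_ops: "closed (bounded_ops :: ('h::chilbert_space \<Rightarrow>\<^sub>L 'k::chilbert_space) set)"
proof -
  note cont = bounded_linear.continuous_on[OF bounded_linear_scaleC continuous_on_id]
  have "bounded_ops = (\<Inter>c. \<Inter>x. {T :: 'h \<Rightarrow>\<^sub>L 'k. blinfun_apply T (c *\<^sub>C x) = c *\<^sub>C blinfun_apply T x})"
    by (auto simp: bounded_ops_def)
  also have "closed \<dots>"
    by (intro closed_INT ballI closed_Collect_eq continuous_intros continuous_on_compose2[OF cont]) auto
  finally show ?thesis .
qed

section \<open>Adjoints\<close>

lemma adj_unique:
  assumes "S \<in> bounded_ops" "\<And>x y. cinner (blinfun_apply S y) x = cinner y (blinfun_apply T x)"
  shows "adj T = S"
  unfolding adj_def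
proof (rule the_equality)
  fix S' assume *: "S' \<in> bounded_ops \<and> (\<forall>x y. cinner (blinfun_apply S' y) x = cinner y (blinfun_apply T x))"
  show "S' = S"
  proof (rule blinfun_eqI, rule cinner_eqI)
    fix x y show "cinner y (S' x) = cinner y (S x)"
      using * assms(2) by (metis cinner_commute)
  qed
qed (use assms in auto)

lemma
  assumes T: "T \<in> bounded_ops"
  shows adj_bounded_ops [simp, intro]: "adj T \<in> bounded_ops"
    and cinner_adj_left: "cinner (blinfun_apply (adj T) y) x = cinner y (blinfun_apply T x)"
proof -
  have "\<exists>X\<in>bounded_ops. norm X \<le> \<bar>norm T\<bar> \<and> (\<forall>w z. cinner w (blinfun_apply X z) = cinner (blinfun_apply T w) z)"
  proof (rule op_of_form)
    fix w z
    have "cmod (cinner (T w) z) \<le> norm (T w) * norm z" by (rule norm_cinner_le)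
    also have "\<dots> \<le> norm T * norm w * norm z" by (intro mult_right_mono norm_blinfun) simp
    finally show "cmod (cinner (T w) z) \<le> norm T * norm w * norm z" .
  qed (simp_all add: blinfun.add_right cinner_add_left cinner_add_right op_scaleC[OF T]
      cinner_scaleC_left cinner_scaleC_right)
  then obtain X where X: "X \<in> bounded_ops" "\<And>w z. cinner w (blinfun_apply X z) = cinner (blinfun_apply T w) z"
    by blast
  have X': "cinner (X y) x = cinner y (T x)" for x y
    using X(2) by (metis cinner_commute)
  have "adj T = X" by (rule adj_unique) (auto simp: X X')
  then show "adj T \<in> bounded_ops" "cinner (blinfun_apply (adj T) y) x = cinner y (blinfun_apply T x)"
    using X(1) X' by auto
qed

lemma cinner_adj_right:
  "T \<in> bounded_ops \<Longrightarrow> cinner y (blinfun_apply (adj T) x) = cinner (blinfun_apply T y) x"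
  by (metis cinner_commute cinner_adj_left)

lemma adj_adj [simp]: "T \<in> bounded_ops \<Longrightarrow> adj (adj T) = T"
  by (rule adj_unique) (auto simp: cinner_adj_right)

lemma adj_compose: "S \<in> bounded_ops \<Longrightarrow> T \<in> bounded_ops \<Longrightarrow> adj (S o\<^sub>L T) = adj T o\<^sub>L adj S"
  by (rule adj_unique) (auto simp: cinner_adj_left)

lemma adj_id [simp]: "adj id_blinfun = id_blinfun"
  by (rule adj_unique) auto

lemma adj_add: "S \<in> bounded_ops \<Longrightarrow> T \<in> bounded_ops \<Longrightarrow> adj (S + T) = adj S + adj T"
  by (rule adj_unique) (auto simp: cinner_adj_left blinfun.add_left cinner_add_left cinner_add_right)

lemma adj_zero [simp]: "adj 0 = 0"
  by (rule adj_unique) auto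

lemma adj_scaleC: "T \<in> bounded_ops \<Longrightarrow> adj (c *\<^sub>C T) = cnj c *\<^sub>C adj T"
  by (rule adj_unique)
    (auto simp: cinner_adj_left scaleC_blinfun.rep_eq cinner_scaleC_left cinner_scaleC_right)

lemma adj_sum: "(\<And>i. i \<in> I \<Longrightarrow> T i \<in> bounded_ops) \<Longrightarrow> adj (sum T I) = (\<Sum>i\<in>I. adj (T i))"
  by (induction I rule: infinite_finite_induct) (auto simp: adj_add)

lemma norm_adj_le: "T \<in> bounded_ops \<Longrightarrow> norm (adj T) \<le> norm T"
proof (rule norm_blinfun_bound)
  fix y assume T: "T \<in> bounded_ops"
  have "complex_of_real ((norm (adj T y))\<^sup>2) = cinner y (T (adj T y))"
    using cinner_adj_left[OF T, of y "adj T y"] by (simp only: cinner_self)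
  from arg_cong[OF this, of cmod] have "norm (adj T y) * norm (adj T y) = cmod (cinner y (T (adj T y)))"
    by (simp only: norm_of_real abs_power2 power2_eq_square[symmetric])
  also have "\<dots> \<le> norm y * (norm T * norm (adj T y))"
    by (rule order_trans[OF norm_cinner_le mult_left_mono[OF norm_blinfun]]) simp
  finally have "norm (adj T y) * norm (adj T y) \<le> norm (adj T y) * (norm T * norm y)"
    by (simp add: ac_simps)
  then show "norm (adj T y) \<le> norm T * norm y"
    by (cases "adj T y = 0") (auto simp: mult_le_cancel_left)
qed simp

lemma norm_adj: "T \<in> bounded_ops \<Longrightarrow> norm (adj T) = norm T"
  using norm_adj_le[of T] norm_adj_le[of "adj T"] by simp

lemma compose_scaleC_left: "(c *\<^sub>C S) o\<^sub>L T = c *\<^sub>C (S o\<^sub>L T)"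
  by (rule blinfun_eqI) (simp add: scaleC_blinfun.rep_eq)

lemma compose_scaleC_right: "S \<in> bounded_ops \<Longrightarrow> S o\<^sub>L (c *\<^sub>C T) = c *\<^sub>C (S o\<^sub>L T)"
  by (rule blinfun_eqI) (simp add: scaleC_blinfun.rep_eq op_scaleC)

lemma compose_sum_left: "(\<Sum>i\<in>I. S i) o\<^sub>L T = (\<Sum>i\<in>I. S i o\<^sub>L T)"
  by (rule blinfun_eqI) (simp add: blinfun.sum_left)

lemma compose_sum_right: "S o\<^sub>L (\<Sum>i\<in>I. T i) = (\<Sum>i\<in>I. S o\<^sub>L T i)"
  by (rule blinfun_eqI) (simp add: blinfun.sum_left blinfun.sum_right)

lemma compose_add_left: "(S + S') o\<^sub>L T = (S o\<^sub>L T) + (S' o\<^sub>L T)"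
  by (rule blinfun_eqI) (simp add: blinfun.add_left)

lemma compose_add_right: "S o\<^sub>L (T + T') = (S o\<^sub>L T) + (S o\<^sub>L T')"
  by (rule blinfun_eqI) (simp add: blinfun.add_left blinfun.add_right)

lemma op_compose_assoc: "(R o\<^sub>L S) o\<^sub>L T = R o\<^sub>L (S o\<^sub>L T)"
  by (rule blinfun_eqI) simp

lemma compose_id [simp]: "id_blinfun o\<^sub>L T = T" "T o\<^sub>L id_blinfun = T"
  by (rule blinfun_eqI, simp)+

lemma compose_zero [simp]: "0 o\<^sub>L T = 0" "T o\<^sub>L 0 = 0"
  by (rule blinfun_eqI, simp)+

text \<open>For \<open>f\<close> in an orthonormal basis, \<open>R f x = x \<otimes> f\<close> will give \<open>S \<otimes> 1\<close> and
  \<open>R f x = f \<otimes> x\<close> will give \<open>1 \<otimes> S\<close>.\<close>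

lemma ampliation:
  fixes R :: "'i \<Rightarrow> 'x::chilbert_space \<Rightarrow>\<^sub>L 'z::chilbert_space"
    and R' :: "'i \<Rightarrow> 'x'::chilbert_space \<Rightarrow>\<^sub>L 'z'::chilbert_space"
  assumes R: "\<And>f. f \<in> I \<Longrightarrow> R f \<in> bounded_ops"
    and orth: "\<And>f g x y. f \<in> I \<Longrightarrow> g \<in> I \<Longrightarrow> cinner (blinfun_apply (R f) x) (blinfun_apply (R g) y) = (if f = g then cinner x y else 0)"
    and R': "\<And>f. f \<in> I \<Longrightarrow> R' f \<in> bounded_ops"
    and orth': "\<And>f g x y. f \<in> I \<Longrightarrow> g \<in> I \<Longrightarrow> cinner (blinfun_apply (R' f) x) (blinfun_apply (R' g) y) = (if f = g then cinner x y else 0)"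
    and S: "S \<in> bounded_ops"
  shows "\<exists>Y\<in>bounded_ops. norm Y \<le> norm S \<and> (\<forall>w z. ((\<lambda>f. cinner (blinfun_apply (adj (R' f)) w) (blinfun_apply S (blinfun_apply (adj (R f)) z))) has_sum cinner w (blinfun_apply Y z)) I)"
proof -
  \<comment> \<open>Bessel's inequality for isometries with mutually orthogonal ranges, stated for
    an arbitrary family because the estimate below uses it for both \<open>R\<close> and
    \<open>R'\<close>.\<close>
  have bess: "(\<Sum>f\<in>F. (norm (adj (R f) z))\<^sup>2) \<le> (norm z)\<^sup>2"
    if F: "finite F" "F \<subseteq> I" and R: "\<And>f. f \<in> I \<Longrightarrow> R f \<in> bounded_ops"
    and orth: "\<And>f g x y. f \<in> I \<Longrightarrow> g \<in> I \<Longrightarrow> cinner (blinfun_apply (R f) x) (blinfun_apply (R g) y) = (if f = g then cinner x y else 0)"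
    for F z and R :: "'i \<Rightarrow> 'y::chilbert_space \<Rightarrow>\<^sub>L 'u::chilbert_space"
  proof -
    define s where "s = (\<Sum>f\<in>F. (norm (adj (R f) z))\<^sup>2)"
    define p where "p = (\<Sum>f\<in>F. R f (adj (R f) z))"
    have 1: "cinner p z = complex_of_real s"
      unfolding p_def s_def cinner_sum_left of_real_sum
      by (intro sum.cong refl) (use F R in \<open>simp add: cinner_adj_right[symmetric] cinner_self subset_iff\<close>)
    have "cinner p p = (\<Sum>f\<in>F. \<Sum>g\<in>F. if f = g then cinner (adj (R f) z) (adj (R g) z) else 0)"
      unfolding p_def cinner_sum_left cinner_sum_right
      by (intro sum.cong refl) (use F orth in \<open>simp add: subset_iff\<close>)
    also have "\<dots> = complex_of_real s"
      unfolding s_def of_real_sum using F by (intro sum.cong refl) (simp add: cinner_self)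
    finally have "complex_of_real ((norm p)\<^sup>2) = complex_of_real s" by (simp only: cinner_self)
    then have 2: "(norm p)\<^sup>2 = s" by (simp only: of_real_eq_iff)
    have s0: "0 \<le> s" unfolding s_def by (intro sum_nonneg) simp
    have "s \<le> norm p * norm z" using norm_cinner_le[of p z] 1 s0 by simp
    then have "norm p * norm p \<le> norm p * norm z" using 2 by (simp add: power2_eq_square)
    then have "norm p \<le> norm z" by (cases "p = 0") (auto simp: mult_le_cancel_left)
    then show ?thesis using 2 unfolding s_def[symmetric] by (metis norm_ge_zero power_mono)
  qed
  define b where "b w z f = cinner (adj (R' f) w) (S (adj (R f) z))" for w z f
  have part: "(\<Sum>f\<in>F. norm (b w z f)) \<le> norm S * norm w * norm z" if F: "finite F" "F \<subseteq> I" for F w z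
  proof -
    have "(\<Sum>f\<in>F. norm (b w z f)) \<le> (\<Sum>f\<in>F. norm S * (norm (adj (R' f) w) * norm (adj (R f) z)))"
    proof (rule sum_mono)
      fix f
      have "norm (b w z f) \<le> norm (adj (R' f) w) * (norm S * norm (adj (R f) z))"
        unfolding b_def by (rule order_trans[OF norm_cinner_le mult_left_mono[OF norm_blinfun]]) simp
      then show "norm (b w z f) \<le> norm S * (norm (adj (R' f) w) * norm (adj (R f) z))"
        by (simp add: ac_simps)
    qed
    also have "\<dots> = norm S * (\<Sum>f\<in>F. \<bar>norm (adj (R' f) w)\<bar> * \<bar>norm (adj (R f) z)\<bar>)"
      by (simp add: sum_distrib_left)
    also have "\<dots> \<le> norm S * (L2_set (\<lambda>f. norm (adj (R' f) w)) F * L2_set (\<lambda>f. norm (adj (R f) z)) F)"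
      by (intro mult_left_mono L2_set_mult_ineq) simp
    also have "\<dots> \<le> norm S * (norm w * norm z)"
      unfolding L2_set_def
      by (intro mult_left_mono mult_mono real_le_lsqrt bess F R R' orth orth') (auto intro!: real_sqrt_ge_zero sum_nonneg)
    finally show ?thesis by (simp add: mult.assoc)
  qed
  have abs: "(\<lambda>f. norm (b w z f)) summable_on I" for w z
    by (rule nonneg_bounded_partial_sums_imp_summable_on[of _ _ "norm S * norm w * norm z"])
      (auto intro!: eventually_finite_subsets_at_top_weakI part)
  then have sm: "b w z summable_on I" for w z by (rule abs_summable_summable)
  \<comment> \<open>The operator is the weak sum of the
    \<open>R' f o\<^sub>L S o\<^sub>L adj (R f)\<close>; by Cauchy-Schwarz its form is bounded by
    \<open>norm S\<close>.\<close>
  have "\<exists>Y\<in>bounded_ops. norm Y \<le> \<bar>norm S\<bar> \<and> (\<forall>w z. cinner w (blinfun_apply Y z) = infsum (b w z) I)"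
  proof (rule op_of_form)
    show "cmod (infsum (b w z) I) \<le> norm S * norm w * norm z" for w z
      by (rule order_trans[OF norm_infsum_bound[OF abs]], rule infsum_le_finite_sums[OF abs part])
  next
    fix w w' z
    have "b (w + w') z = (\<lambda>f. b w z f + b w' z f)"
      by (simp add: b_def blinfun.add_right cinner_add_left fun_eq_iff)
    then show "infsum (b (w + w') z) I = infsum (b w z) I + infsum (b w' z) I"
      by (simp add: infsum_add sm)
  next
    fix w z z'
    have "b w (z + z') = (\<lambda>f. b w z f + b w z' f)"
      by (simp add: b_def blinfun.add_right cinner_add_right fun_eq_iff)
    then show "infsum (b w (z + z')) I = infsum (b w z) I + infsum (b w z') I"
      by (simp add: infsum_add sm)
  next
    fix c w z
    have "infsum (b (c *\<^sub>C w) z) I = infsum (\<lambda>f. cnj c * b w z f) I"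
      by (intro infsum_cong) (simp add: b_def op_scaleC R' cinner_scaleC_left)
    then show "infsum (b (c *\<^sub>C w) z) I = cnj c * infsum (b w z) I"
      by (simp add: infsum_cmult_right')
    have "infsum (b w (c *\<^sub>C z)) I = infsum (\<lambda>f. c * b w z f) I"
      by (intro infsum_cong) (simp add: b_def op_scaleC R S cinner_scaleC_right)
    then show "infsum (b w (c *\<^sub>C z)) I = c * infsum (b w z) I"
      by (simp add: infsum_cmult_right')
  qed
  then obtain Y where Y: "Y \<in> bounded_ops" "norm Y \<le> norm S" "\<And>w z. cinner w (blinfun_apply Y z) = infsum (b w z) I"
    unfolding abs_norm_cancel by blast
  have "(b w z has_sum cinner w (blinfun_apply Y z)) I" for w z
    unfolding Y(3) by (rule has_sum_infsum[OF sm])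
  from this[unfolded b_def] show ?thesis
    by (intro bexI[of _ Y] conjI allI Y(1,2))
qed

section \<open>Tensor products of vectors and operators\<close>

lemma tensor_vec_add_left: "(x + x') \<otimes>\<^sub>v y = x \<otimes>\<^sub>v y + x' \<otimes>\<^sub>v y"
  by (rule htensor_eqI) (simp add: tensor_vec.rep_eq plus_htensor.rep_eq cinner_add_right algebra_simps)

lemma tensor_vec_add_right: "x \<otimes>\<^sub>v (y + y') = x \<otimes>\<^sub>v y + x \<otimes>\<^sub>v y'"
  by (rule htensor_eqI) (simp add: tensor_vec.rep_eq plus_htensor.rep_eq cinner_add_right algebra_simps)

lemma tensor_vec_scaleC_left: "(c *\<^sub>C x) \<otimes>\<^sub>v y = c *\<^sub>C (x \<otimes>\<^sub>v y)"
  by (rule htensor_eqI) (simp add: tensor_vec.rep_eq scaleC_htensor.rep_eq cinner_scaleC_right)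

lemma tensor_vec_scaleC_right: "x \<otimes>\<^sub>v (c *\<^sub>C y) = c *\<^sub>C (x \<otimes>\<^sub>v y)"
  by (rule htensor_eqI) (simp add: tensor_vec.rep_eq scaleC_htensor.rep_eq cinner_scaleC_right)

lemma tensor_vec_zero [simp]: "0 \<otimes>\<^sub>v y = 0" "x \<otimes>\<^sub>v 0 = 0"
  by (rule htensor_eqI, simp add: tensor_vec.rep_eq zero_htensor.rep_eq)+

lemma tensor_vec_sum_left: "(\<Sum>i\<in>I. x i) \<otimes>\<^sub>v y = (\<Sum>i\<in>I. x i \<otimes>\<^sub>v y)"
  by (induction I rule: infinite_finite_induct) (auto simp: tensor_vec_add_left)

lemma norm_tensor_vec: "norm (x \<otimes>\<^sub>v y) = norm x * norm y"
proof -
  have "complex_of_real ((norm (x \<otimes>\<^sub>v y))\<^sup>2) = complex_of_real ((norm x * norm y)\<^sup>2)"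
    using cinner_tensor_vec[of x y x y] unfolding cinner_self by (simp add: power_mult_distrib)
  then show ?thesis by (simp only: of_real_eq_iff) (simp add: power2_eq_iff_nonneg)
qed

definition lket :: "'h::chilbert_space \<Rightarrow> ('k::chilbert_space \<Rightarrow>\<^sub>L ('h, 'k) htensor)"
  where "lket a = Blinfun (\<lambda>y. a \<otimes>\<^sub>v y)"

definition rket :: "'k::chilbert_space \<Rightarrow> ('h::chilbert_space \<Rightarrow>\<^sub>L ('h, 'k) htensor)"
  where "rket b = Blinfun (\<lambda>x. x \<otimes>\<^sub>v b)"

lemma lket_apply [simp]: "blinfun_apply (lket a) y = a \<otimes>\<^sub>v y"
  unfolding lket_def
  by (subst bounded_linear_Blinfun_apply, rule bounded_linear_intro[where K = "norm a"])
    (simp_all add: tensor_vec_add_right scaleR_scaleC tensor_vec_scaleC_right norm_tensor_vec mult.commute)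

lemma rket_apply [simp]: "blinfun_apply (rket b) x = x \<otimes>\<^sub>v b"
  unfolding rket_def
  by (subst bounded_linear_Blinfun_apply, rule bounded_linear_intro[where K = "norm b"])
    (simp_all add: tensor_vec_add_left scaleR_scaleC tensor_vec_scaleC_left norm_tensor_vec)

lemma bounded_ops_lket [simp, intro]: "lket a \<in> bounded_ops"
  by (rule bounded_opsI) (simp add: tensor_vec_scaleC_right)

lemma bounded_ops_rket [simp, intro]: "rket b \<in> bounded_ops"
  by (rule bounded_opsI) (simp add: tensor_vec_scaleC_left)

lemma adj_lket_apply: "blinfun_apply (adj (lket a)) (x \<otimes>\<^sub>v y) = cinner a x *\<^sub>C y"
  by (rule cinner_eqI) (simp add: cinner_adj_right cinner_tensor_vec cinner_scaleC_right)

lemma adj_rket_apply: "blinfun_apply (adj (rket b)) (x \<otimes>\<^sub>v y) = cinner b y *\<^sub>C x"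
  by (rule cinner_eqI) (simp add: cinner_adj_right cinner_tensor_vec cinner_scaleC_right)

lemma tensor_vec_induct:
  assumes "closed {z. P z}" "P 0" "\<And>x y. P x \<Longrightarrow> P y \<Longrightarrow> P (x + y)" "\<And>c x. P x \<Longrightarrow> P (c *\<^sub>C x)"
    and "\<And>x y. P (x \<otimes>\<^sub>v y)"
  shows "P z"
proof -
  have "cspan {x \<otimes>\<^sub>v y | x y. True} \<subseteq> {z. P z}"
    by (rule complex_vector.span_minimal) (auto intro!: complex_vector.subspaceI assms)
  then have "closure (cspan {x \<otimes>\<^sub>v y | x y. True}) \<subseteq> {z. P z}"
    using assms(1) by (rule closure_minimal)
  then show ?thesis using closure_cspan_tensor_vec by blast
qed

lemma tensor_ext:
  fixes X Y :: "('h::chilbert_space, 'k::chilbert_space) htensor \<Rightarrow>\<^sub>L 'z::chilbert_space"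
  assumes "X \<in> bounded_ops" "Y \<in> bounded_ops" "\<And>x y. blinfun_apply X (x \<otimes>\<^sub>v y) = blinfun_apply Y (x \<otimes>\<^sub>v y)"
  shows "X = Y"
proof (rule blinfun_eqI)
  fix z show "X z = Y z"
  proof (induction z rule: tensor_vec_induct)
    case 1
    show ?case by (intro closed_Collect_eq continuous_intros)
  qed (use assms in \<open>simp_all add: blinfun.add_right op_scaleC\<close>)
qed

lemma tensor_vec_eqI:
  assumes "\<And>x y. cinner (x \<otimes>\<^sub>v y) v = cinner (x \<otimes>\<^sub>v y) w"
  shows "v = w"
proof (rule cinner_eqI)
  fix z show "cinner z v = cinner z w"
  proof (induction z rule: tensor_vec_induct)
    case 1
    have "continuous_on UNIV (\<lambda>z. cinner z u)" for u :: "('a, 'b) htensor"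
      using bounded_linear.continuous_on[OF bounded_linear_cinner_right continuous_on_id, of UNIV u]
      by (subst cinner_commute) (intro continuous_intros)
    then show ?case by (intro closed_Collect_eq)
  qed (use assms in \<open>simp_all add: cinner_add_left cinner_scaleC_left\<close>)
qed

lemma ex_tensor_op_left:
  fixes S :: "'h::chilbert_space \<Rightarrow>\<^sub>L 'h'::chilbert_space"
  assumes S: "S \<in> bounded_ops"
  shows "\<exists>X\<in>bounded_ops. norm X \<le> norm S \<and>
     (\<forall>x (y :: 'k::chilbert_space). blinfun_apply X (x \<otimes>\<^sub>v y) = blinfun_apply S x \<otimes>\<^sub>v y)"
proof -
  have orth: "cinner (rket f x) (rket g y) = (if f = g then cinner x y else 0)"
    if "f \<in> some_basis" "g \<in> some_basis" for f g :: 'k and x y :: "'z::chilbert_space"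
    using that by (simp add: cinner_tensor_vec cinner_some_basis)
  obtain Y :: "('h, 'k) htensor \<Rightarrow>\<^sub>L ('h', 'k) htensor" where
    Y: "Y \<in> bounded_ops" "norm Y \<le> norm S" "\<And>w z. ((\<lambda>f. cinner (blinfun_apply (adj (rket f)) w)
      (blinfun_apply S (blinfun_apply (adj (rket f)) z))) has_sum cinner w (blinfun_apply Y z)) some_basis"
    using ampliation[of some_basis "rket :: 'k \<Rightarrow> 'h \<Rightarrow>\<^sub>L _" "rket :: 'k \<Rightarrow> 'h' \<Rightarrow>\<^sub>L _" S, OF _ orth _ orth S]
    by auto
  have "Y (x \<otimes>\<^sub>v y) = S x \<otimes>\<^sub>v y" for x and y :: 'k
  proof (rule cinner_eqI)
    fix w :: "('h', 'k) htensor"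
    interpret b: bounded_linear "\<lambda>v. cinner w (S x \<otimes>\<^sub>v v)"
      using bounded_linear_compose[OF bounded_linear_cinner_right blinfun.bounded_linear_right, of w "lket (S x)"]
      by simp
    have "(((\<lambda>v. cinner w (S x \<otimes>\<^sub>v v)) \<circ> (\<lambda>f. cinner f y *\<^sub>C f)) has_sum cinner w (S x \<otimes>\<^sub>v y)) some_basis"
      by (rule has_sum_comm_additive_general[OF _ _ basis_expansion[of y]])
        (auto simp: b.sum intro: b.tendsto)
    also have "(\<lambda>v. cinner w (S x \<otimes>\<^sub>v v)) \<circ> (\<lambda>f. cinner f y *\<^sub>C f) =
        (\<lambda>f. cinner (adj (rket f) w) (S (adj (rket f) (x \<otimes>\<^sub>v y))))"
      by (auto simp: adj_rket_apply op_scaleC S cinner_scaleC_right cinner_adj_left tensor_vec_scaleC_right)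
    finally show "cinner w (Y (x \<otimes>\<^sub>v y)) = cinner w (S x \<otimes>\<^sub>v y)" using Y(3) has_sum_unique by blast
  qed
  then show ?thesis using Y by blast
qed

lemma ex_tensor_op_right:
  fixes S :: "'k::chilbert_space \<Rightarrow>\<^sub>L 'k'::chilbert_space"
  assumes S: "S \<in> bounded_ops"
  shows "\<exists>X\<in>bounded_ops. norm X \<le> norm S \<and>
     (\<forall>(x :: 'h::chilbert_space) y. blinfun_apply X (x \<otimes>\<^sub>v y) = x \<otimes>\<^sub>v blinfun_apply S y)"
proof -
  have orth: "cinner (lket f x) (lket g y) = (if f = g then cinner x y else 0)"
    if "f \<in> some_basis" "g \<in> some_basis" for f g :: 'h and x y :: "'z::chilbert_space"
    using that by (simp add: cinner_tensor_vec cinner_some_basis)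
  obtain Y :: "('h, 'k) htensor \<Rightarrow>\<^sub>L ('h, 'k') htensor" where
    Y: "Y \<in> bounded_ops" "norm Y \<le> norm S" "\<And>w z. ((\<lambda>f. cinner (blinfun_apply (adj (lket f)) w)
      (blinfun_apply S (blinfun_apply (adj (lket f)) z))) has_sum cinner w (blinfun_apply Y z)) some_basis"
    using ampliation[of some_basis "lket :: 'h \<Rightarrow> 'k \<Rightarrow>\<^sub>L _" "lket :: 'h \<Rightarrow> 'k' \<Rightarrow>\<^sub>L _" S, OF _ orth _ orth S]
    by auto
  have "Y (x \<otimes>\<^sub>v y) = x \<otimes>\<^sub>v S y" for x :: 'h and y
  proof (rule cinner_eqI)
    fix w :: "('h, 'k') htensor"
    interpret b: bounded_linear "\<lambda>v. cinner w (v \<otimes>\<^sub>v S y)"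
      using bounded_linear_compose[OF bounded_linear_cinner_right blinfun.bounded_linear_right, of w "rket (S y)"]
      by simp
    have "(((\<lambda>v. cinner w (v \<otimes>\<^sub>v S y)) \<circ> (\<lambda>f. cinner f x *\<^sub>C f)) has_sum cinner w (x \<otimes>\<^sub>v S y)) some_basis"
      by (rule has_sum_comm_additive_general[OF _ _ basis_expansion[of x]])
        (auto simp: b.sum intro: b.tendsto)
    also have "(\<lambda>v. cinner w (v \<otimes>\<^sub>v S y)) \<circ> (\<lambda>f. cinner f x *\<^sub>C f) =
        (\<lambda>f. cinner (adj (lket f) w) (S (adj (lket f) (x \<otimes>\<^sub>v y))))"
      by (auto simp: adj_lket_apply op_scaleC S cinner_scaleC_right cinner_adj_left tensor_vec_scaleC_left)
    finally show "cinner w (Y (x \<otimes>\<^sub>v y)) = cinner w (x \<otimes>\<^sub>v S y)" using Y(3) has_sum_unique by blast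
  qed
  then show ?thesis using Y by blast
qed

section \<open>Tensor products of operators\<close>

lemma tensor_op_unique:
  assumes "X \<in> bounded_ops" "\<And>x y. blinfun_apply X (x \<otimes>\<^sub>v y) = blinfun_apply S x \<otimes>\<^sub>v blinfun_apply T y"
  shows "S \<otimes>\<^sub>o T = X"
  unfolding tensor_op_def by (rule the_equality) (auto simp: assms intro!: tensor_ext)

lemma
  fixes S :: "'h::chilbert_space \<Rightarrow>\<^sub>L 'h'::chilbert_space" and T :: "'k::chilbert_space \<Rightarrow>\<^sub>L 'k'::chilbert_space"
  assumes S: "S \<in> bounded_ops" and T: "T \<in> bounded_ops"
  shows bounded_ops_tensor [simp, intro]: "S \<otimes>\<^sub>o T \<in> bounded_ops"
    and tensor_op_apply: "blinfun_apply (S \<otimes>\<^sub>o T) (x \<otimes>\<^sub>v y) = blinfun_apply S x \<otimes>\<^sub>v blinfun_apply T y"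
    and norm_tensor_op_le: "norm (S \<otimes>\<^sub>o T) \<le> norm S * norm T"
proof -
  obtain X :: "('h, 'k') htensor \<Rightarrow>\<^sub>L ('h', 'k') htensor" where X: "X \<in> bounded_ops" "norm X \<le> norm S" "\<And>x y. blinfun_apply X (x \<otimes>\<^sub>v y) = S x \<otimes>\<^sub>v y"
    using ex_tensor_op_left[OF S] by blast
  obtain Y :: "('h, 'k) htensor \<Rightarrow>\<^sub>L ('h, 'k') htensor" where Y: "Y \<in> bounded_ops" "norm Y \<le> norm T" "\<And>x y. blinfun_apply Y (x \<otimes>\<^sub>v y) = x \<otimes>\<^sub>v T y"
    using ex_tensor_op_right[OF T] by blast
  \<comment> \<open>Ampliating the two factors separately yields existence and the norm bound
    together.\<close>
  have eq: "S \<otimes>\<^sub>o T = X o\<^sub>L Y" by (rule tensor_op_unique) (auto simp: X Y)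
  show "S \<otimes>\<^sub>o T \<in> bounded_ops" "(S \<otimes>\<^sub>o T) (x \<otimes>\<^sub>v y) = S x \<otimes>\<^sub>v T y"
    unfolding eq by (auto simp: X Y)
  show "norm (S \<otimes>\<^sub>o T) \<le> norm S * norm T"
    unfolding eq by (rule order_trans[OF norm_blinfun_compose]) (intro mult_mono X Y; simp)
qed

lemma tensor_op_compose:
  assumes "S \<in> bounded_ops" "S' \<in> bounded_ops" "T \<in> bounded_ops" "T' \<in> bounded_ops"
  shows "(S \<otimes>\<^sub>o T) o\<^sub>L (S' \<otimes>\<^sub>o T') = (S o\<^sub>L S') \<otimes>\<^sub>o (T o\<^sub>L T')"
  by (rule tensor_ext) (auto simp: tensor_op_apply assms)

lemma tensor_op_add_left:
  assumes "S \<in> bounded_ops" "S' \<in> bounded_ops" "T \<in> bounded_ops"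
  shows "(S + S') \<otimes>\<^sub>o T = S \<otimes>\<^sub>o T + S' \<otimes>\<^sub>o T"
  by (rule tensor_ext) (auto simp: tensor_op_apply assms blinfun.add_left tensor_vec_add_left)

lemma tensor_op_add_right:
  assumes "S \<in> bounded_ops" "T' \<in> bounded_ops" "T \<in> bounded_ops"
  shows "S \<otimes>\<^sub>o (T + T') = S \<otimes>\<^sub>o T + S \<otimes>\<^sub>o T'"
  by (rule tensor_ext) (auto simp: tensor_op_apply assms blinfun.add_left tensor_vec_add_right)

lemma tensor_op_scaleC_left:
  assumes "S \<in> bounded_ops" "T \<in> bounded_ops"
  shows "(c *\<^sub>C S) \<otimes>\<^sub>o T = c *\<^sub>C (S \<otimes>\<^sub>o T)"
  by (rule tensor_ext) (auto simp: tensor_op_apply assms scaleC_blinfun.rep_eq tensor_vec_scaleC_left)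

lemma tensor_op_scaleC_right:
  assumes "S \<in> bounded_ops" "T \<in> bounded_ops"
  shows "S \<otimes>\<^sub>o (c *\<^sub>C T) = c *\<^sub>C (S \<otimes>\<^sub>o T)"
  by (rule tensor_ext) (auto simp: tensor_op_apply assms scaleC_blinfun.rep_eq tensor_vec_scaleC_right)

lemma tensor_op_zero_left [simp]: "T \<in> bounded_ops \<Longrightarrow> 0 \<otimes>\<^sub>o T = 0"
  by (rule tensor_op_unique) auto

lemma tensor_op_sum_left:
  assumes "\<And>i. i \<in> I \<Longrightarrow> S i \<in> bounded_ops" "T \<in> bounded_ops"
  shows "(\<Sum>i\<in>I. S i) \<otimes>\<^sub>o T = (\<Sum>i\<in>I. S i \<otimes>\<^sub>o T)"
  using assms by (induction I rule: infinite_finite_induct) (auto simp: tensor_op_add_left)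

lemma adj_tensor_op:
  assumes "S \<in> bounded_ops" "T \<in> bounded_ops"
  shows "adj (S \<otimes>\<^sub>o T) = adj S \<otimes>\<^sub>o adj T"
proof (rule tensor_ext)
  fix a b
  show "adj (S \<otimes>\<^sub>o T) (a \<otimes>\<^sub>v b) = (adj S \<otimes>\<^sub>o adj T) (a \<otimes>\<^sub>v b)"
    by (rule tensor_vec_eqI) (simp add: cinner_adj_right tensor_op_apply assms cinner_tensor_vec)
qed (use assms in auto)

section \<open>Contractivity of unital *-homomorphisms and *-antihomomorphisms\<close>

lemma continuous_on_cinner_left [continuous_intros]:
  "continuous_on S f \<Longrightarrow> continuous_on S (\<lambda>z. cinner (f z) (u :: 'h::chilbert_space))"
  using continuous_on_cnj[OF bounded_linear.continuous_on[OF bounded_linear_cinner_right[of u], of S f]]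
  by (simp flip: cinner_commute)

lemma continuous_on_cinner_right [continuous_intros]:
  "continuous_on S f \<Longrightarrow> continuous_on S (\<lambda>z. cinner (u :: 'h::chilbert_space) (f z))"
  by (rule bounded_linear.continuous_on[OF bounded_linear_cinner_right])

lemma adj_diff: "S \<in> bounded_ops \<Longrightarrow> T \<in> bounded_ops \<Longrightarrow> adj (S - T) = adj S - adj T"
  by (rule adj_unique) (auto simp: cinner_adj_left blinfun.diff_left cinner_diff_left cinner_diff_right)

lemma cstar_algebra_onD:
  assumes "cstar_algebra_on A"
  shows "A \<subseteq> bounded_ops" "csubspace A" "closed A" "id_blinfun \<in> A"
    "a \<in> A \<Longrightarrow> b \<in> A \<Longrightarrow> a o\<^sub>L b \<in> A" "a \<in> A \<Longrightarrow> adj a \<in> A"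
  using assms unfolding cstar_algebra_on_def by auto

lemma norm_compose_diff_le:
  assumes "norm y \<le> r" "norm z \<le> r"
  shows "norm ((y o\<^sub>L y) - (z o\<^sub>L z)) \<le> 2 * r * norm (y - z)"
proof -
  have "(y o\<^sub>L y) - (z o\<^sub>L z) = (y o\<^sub>L (y - z)) + ((y - z) o\<^sub>L z)"
    by (rule blinfun_eqI) (simp add: blinfun.diff_left blinfun.add_left blinfun.diff_right)
  also have "norm \<dots> \<le> norm y * norm (y - z) + norm (y - z) * norm z"
    by (rule norm_triangle_le) (intro add_mono norm_blinfun_compose)
  also have "\<dots> \<le> r * norm (y - z) + norm (y - z) * r"
    using assms by (intro add_mono mult_right_mono mult_left_mono) auto
  finally show ?thesis by (simp add: algebra_simps)
qed

text \<open>The square root of \<open>1 - h\<close> is \<open>1 - y\<close>, where \<open>y\<close> is the fixed point of the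
  contraction \<open>y \<mapsto> (h + y\<^sup>2) / 2\<close> of a small ball.\<close>

lemma cstar_sqrt_one_minus:
  assumes A: "cstar_algebra_on A" and h: "h \<in> A" "adj h = h" "norm h < 1"
  shows "\<exists>k\<in>A. adj k = k \<and> id_blinfun - h = k o\<^sub>L k"
proof -
  note AD = cstar_algebra_onD[OF A]
  \<comment> \<open>The smaller root of r = (norm h + r^2) / 2. As r < 1, the map \<open>f\<close>
    sends the ball of radius r into itself and contracts it by the factor r.\<close>
  define r where "r = 1 - sqrt (1 - norm h)"
  have r: "0 \<le> r" "r < 1" and rr: "r\<^sup>2 = 2 * r - norm h"
    using h(3) unfolding r_def by (auto simp: power2_diff)
  define f where "f y = (1/2) *\<^sub>R (h + (y o\<^sub>L y))" for y
  define X where "X = A \<inter> {y. adj y = y} \<inter> cball 0 r"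
  have hb: "h \<in> bounded_ops" using h(1) AD(1) by blast
  \<comment> \<open>Tested on vectors, self-adjointness is visibly a closed condition.\<close>
  have sa: "A \<inter> {y. adj y = y} = A \<inter> {y. \<forall>x z. cinner (blinfun_apply y z) x = cinner z (blinfun_apply y x)}"
    using AD(1) adj_unique cinner_adj_left by (fastforce simp: subset_iff)
  have "closed {y :: 'a \<Rightarrow>\<^sub>L 'a. \<forall>x z. cinner (blinfun_apply y z) x = cinner z (blinfun_apply y x)}"
    by (intro closed_Collect_all closed_Collect_eq continuous_intros)
  then have "closed (A \<inter> {y. adj y = y})" unfolding sa using AD(3) by (intro closed_Int)
  then have "complete X" unfolding X_def by (simp add: complete_eq_closed closed_Int)
  moreover have "X \<noteq> {}"
    using r complex_vector.subspace_0[OF AD(2)] unfolding X_def by auto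
  moreover have "f ` X \<subseteq> X"
  proof safe
    fix y assume y: "y \<in> X"
    then have yb: "y \<in> bounded_ops" and yA: "y \<in> A" "adj y = y" "norm y \<le> r" using AD(1) unfolding X_def by auto
    have "norm (f y) \<le> (norm h + norm y * norm y) / 2"
      unfolding f_def using norm_triangle_le[OF add_left_mono[OF norm_blinfun_compose], of h y y]
      by simp
    also have "\<dots> \<le> (norm h + r * r) / 2" using yA(3) r by (simp add: mult_mono)
    also have "\<dots> = r" using rr by (simp add: power2_eq_square)
    finally have "norm (f y) \<le> r" .
    moreover have "f y \<in> A"
      unfolding f_def scaleR_scaleC using h yA AD
      by (intro complex_vector.subspace_scale[OF AD(2)] complex_vector.subspace_add[OF AD(2)])
    moreover have "adj (f y) = f y"
      unfolding f_def scaleR_scaleC using hb yb yA h(2)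
      by (simp add: adj_scaleC adj_add adj_compose)
    ultimately show "f y \<in> X" unfolding X_def by auto
  qed
  moreover have "dist (f y) (f z) \<le> r * dist y z" if "y \<in> X" "z \<in> X" for y z
  proof -
    have "f y - f z = (1/2) *\<^sub>R ((y o\<^sub>L y) - (z o\<^sub>L z))" by (simp add: f_def algebra_simps)
    then show ?thesis using norm_compose_diff_le[of y r z] that by (simp add: X_def dist_norm)
  qed
  ultimately obtain y where y: "y \<in> X" "f y = y"
    using Banach_fix[of X r f] r by blast
  have yb: "y \<in> bounded_ops" and yA: "y \<in> A" "adj y = y" using y(1) AD(1) unfolding X_def by auto
  have "2 *\<^sub>R y = h + (y o\<^sub>L y)" using arg_cong[OF y(2), of "\<lambda>v. 2 *\<^sub>R v"] by (simp add: f_def)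
  then have hy: "h = 2 *\<^sub>R y - (y o\<^sub>L y)" by simp
  show ?thesis
  proof (intro bexI conjI)
    show "id_blinfun - y \<in> A" using AD yA by (intro complex_vector.subspace_diff[OF AD(2)])
    show "adj (id_blinfun - y) = id_blinfun - y" using yb yA by (simp add: adj_diff)
    show "id_blinfun - h = (id_blinfun - y) o\<^sub>L (id_blinfun - y)"
      unfolding hy by (rule blinfun_eqI) (simp add: blinfun.diff_left blinfun.diff_right scaleR_2 blinfun.add_left)
  qed
qed

text \<open>If \<open>\<parallel>a\<parallel> < 1\<close>, then \<open>1 - a\<^sup>*a = k\<^sup>2\<close> with \<open>k\<close> self-adjoint, and applying \<open>F\<close> gives
  \<open>F(a)\<^sup>*F(a) \<le> 1\<close>.\<close>

lemma star_hom_contractive: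
  fixes F :: "('k::chilbert_space \<Rightarrow>\<^sub>L 'k) \<Rightarrow> ('l::chilbert_space \<Rightarrow>\<^sub>L 'l)"
  assumes A: "cstar_algebra_on A" and lin: "clinear_on A F" and one: "F id_blinfun = id_blinfun"
    and bdd: "\<And>a. a \<in> A \<Longrightarrow> F a \<in> bounded_ops" and star: "\<And>a. a \<in> A \<Longrightarrow> F (adj a) = adj (F a)"
    and hom: "(\<forall>a\<in>A. \<forall>b\<in>A. F (a o\<^sub>L b) = F a o\<^sub>L F b) \<or> (\<forall>a\<in>A. \<forall>b\<in>A. F (a o\<^sub>L b) = F b o\<^sub>L F a)"
    and a: "a \<in> A"
  shows "norm (F a) \<le> norm a"
proof -
  note AD = cstar_algebra_onD[OF A]
  have small: "norm (F a) \<le> 1" if a: "a \<in> A" "norm a < 1" for a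
  proof -
    have ab: "a \<in> bounded_ops" using a AD(1) by blast
    have nsq: "norm a * norm a < 1" using a(2) mult_strict_mono'[of "norm a" 1 "norm a" 1] by simp
    \<comment> \<open>The element is (adj a) a for a homomorphism and a (adj a) for an
      antihomomorphism, so that F sends it to adj (F a) F a in either case.\<close>
    obtain h where h: "h \<in> A" "adj h = h" "norm h < 1" "F h = adj (F a) o\<^sub>L F a"
      using hom
    proof
      assume *: "\<forall>a\<in>A. \<forall>b\<in>A. F (a o\<^sub>L b) = F a o\<^sub>L F b"
      show ?thesis
      proof (rule that[of "adj a o\<^sub>L a"])
        show "norm (adj a o\<^sub>L a) < 1"
          using norm_blinfun_compose[of "adj a" a] nsq by (simp add: norm_adj ab)
      qed (use a ab AD * star in \<open>auto simp: adj_compose adj_bounded_ops\<close>)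
    next
      assume *: "\<forall>a\<in>A. \<forall>b\<in>A. F (a o\<^sub>L b) = F b o\<^sub>L F a"
      show ?thesis
      proof (rule that[of "a o\<^sub>L adj a"])
        show "norm (a o\<^sub>L adj a) < 1"
          using norm_blinfun_compose[of a "adj a"] nsq by (simp add: norm_adj ab)
      qed (use a ab AD * star in \<open>auto simp: adj_compose adj_bounded_ops\<close>)
    qed
    obtain k where k: "k \<in> A" "adj k = k" "id_blinfun - h = k o\<^sub>L k"
      using cstar_sqrt_one_minus[OF A h(1,2,3)] by blast
    have "F id_blinfun = F (h + (k o\<^sub>L k))" by (simp flip: k(3))
    also have "\<dots> = F h + F (k o\<^sub>L k)" using lin h(1) k(1) AD(5) unfolding clinear_on_def by blast
    also have "F (k o\<^sub>L k) = adj (F k) o\<^sub>L F k" using hom k(1,2) star[OF k(1)] by metis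
    finally have id: "id_blinfun = (adj (F a) o\<^sub>L F a) + (adj (F k) o\<^sub>L F k)" by (simp add: one h(4))
    show ?thesis
    proof (rule norm_blinfun_bound)
      fix x
      have "cinner x x = cinner x (((adj (F a) o\<^sub>L F a) + (adj (F k) o\<^sub>L F k)) x)" by (simp flip: id)
      then have "cinner x x = cinner (F a x) (F a x) + cinner (F k x) (F k x)"
        by (simp add: blinfun.add_left cinner_add_right cinner_adj_right bdd a k)
      then have "complex_of_real ((norm x)\<^sup>2) = complex_of_real ((norm (F a x))\<^sup>2 + (norm (F k x))\<^sup>2)"
        by (simp only: cinner_self of_real_add)
      then have "(norm x)\<^sup>2 = (norm (F a x))\<^sup>2 + (norm (F k x))\<^sup>2" by (simp only: of_real_eq_iff)
      then have "(norm (F a x))\<^sup>2 \<le> (norm x)\<^sup>2" by simp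
      then show "norm (F a x) \<le> 1 * norm x" by (simp add: power2_le_iff_abs_le)
    qed simp
  qed
  show ?thesis
  \<comment> \<open>The bound \<open>small\<close> requires norm below 1, so a is divided by an
    arbitrary t above its norm.\<close>
  proof (rule dense_ge)
    fix t assume t: "norm a < t"
    then have t0: "t > 0" using norm_ge_zero[of a] by linarith
    define c where "c = complex_of_real (1 / t)"
    have "norm (F (c *\<^sub>C a)) \<le> 1"
      using t t0 a AD(2) by (intro small complex_vector.subspace_scale) (auto simp: norm_scaleC c_def norm_divide)
    also have "F (c *\<^sub>C a) = c *\<^sub>C F a" using lin a unfolding clinear_on_def by blast
    finally show "norm (F a) \<le> t" using t0 by (simp add: norm_scaleC c_def norm_divide field_simps)
  qed
qed

section \<open>Maps that are linear on a subspace\<close>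

lemma clinear_on_diff:
  assumes "csubspace X" "clinear_on X F" "x \<in> X" "y \<in> X"
  shows "F (x - y) = F x - F y"
proof -
  have "F ((x - y) + y) = F (x - y) + F y"
    using assms complex_vector.subspace_diff[OF assms(1,3,4)] unfolding clinear_on_def by blast
  then show ?thesis by simp
qed

lemma clinear_on_sum:
  assumes "csubspace X" "clinear_on X F" "\<And>i. i \<in> I \<Longrightarrow> x i \<in> X"
  shows "F (\<Sum>i\<in>I. x i) = (\<Sum>i\<in>I. F (x i))"
proof -
  have z: "F 0 = 0" using clinear_on_diff[OF assms(1,2), of 0 0] complex_vector.subspace_0[OF assms(1)] by simp
  show ?thesis using assms(3)
  proof (induction I rule: infinite_finite_induct)
    case (insert i I)
    have "F (x i + sum x I) = F (x i) + F (sum x I)"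
      using assms(2) insert complex_vector.subspace_sum[OF assms(1), of I x] unfolding clinear_on_def by blast
    then show ?case using insert by simp
  qed (auto simp: z)
qed

lemma clinear_on_continuous:
  assumes "csubspace X" "clinear_on X F" "\<And>x. x \<in> X \<Longrightarrow> norm (F x) \<le> C * norm x"
  shows "continuous_on X F"
proof (rule lipschitz_on_continuous_on)
  show "(max C 0)-lipschitz_on X F"
  proof (rule lipschitz_onI)
    fix x y assume xy: "x \<in> X" "y \<in> X"
    have "norm (F (x - y)) \<le> C * norm (x - y)"
      using assms(1,3) xy by (intro assms(3) complex_vector.subspace_diff)
    also have "\<dots> \<le> max C 0 * norm (x - y)" by (intro mult_right_mono) auto
    finally show "dist (F x) (F y) \<le> max C 0 * dist x y"
      by (simp add: dist_norm clinear_on_diff[OF assms(1,2) xy])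
  qed simp
qed

section \<open>Finite-dimensional Hilbert spaces\<close>

definition ketbra :: "'h::chilbert_space \<Rightarrow> 'g::chilbert_space \<Rightarrow> ('g \<Rightarrow>\<^sub>L 'h)"
  where "ketbra a b = Blinfun (\<lambda>x. cinner b x *\<^sub>C a)"

lemma ketbra_apply [simp]: "blinfun_apply (ketbra a b) x = cinner b x *\<^sub>C a"
  unfolding ketbra_def
proof (subst bounded_linear_Blinfun_apply, rule bounded_linear_intro[where K = "norm b * norm a"])
  fix x show "norm (cinner b x *\<^sub>C a) \<le> norm x * (norm b * norm a)"
    using mult_right_mono[OF norm_cinner_le[of b x], of "norm a"] by (simp add: norm_scaleC ac_simps)
qed (simp_all add: cinner_add_right scaleC_add_left scaleR_scaleC cinner_scaleC_right scaleC_scaleC)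

lemma bounded_ops_ketbra [simp, intro]: "ketbra a b \<in> bounded_ops"
  by (rule bounded_opsI) (simp add: cinner_scaleC_right scaleC_scaleC)

text \<open>This factorisation turns slices of a product containing such a tensor into products of
  slices.\<close>

lemma ketbra_tensor: "T \<in> bounded_ops \<Longrightarrow> ketbra a b \<otimes>\<^sub>o T = lket a o\<^sub>L T o\<^sub>L adj (lket b)"
  by (rule tensor_op_unique)
    (auto simp: adj_lket_apply op_scaleC tensor_vec_scaleC_left tensor_vec_scaleC_right)

lemma adj_lket_lket: "adj (lket a) o\<^sub>L lket b = cinner a b *\<^sub>C id_blinfun"
  by (rule blinfun_eqI) (simp add: adj_lket_apply scaleC_blinfun.rep_eq)

lemma tensor_compose_lket:
  "S \<in> bounded_ops \<Longrightarrow> T \<in> bounded_ops \<Longrightarrow> (S \<otimes>\<^sub>o T) o\<^sub>L lket a = lket (blinfun_apply S a) o\<^sub>L T"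
  by (rule blinfun_eqI) (simp add: tensor_op_apply)

abbreviation slice ::
    "'h::chilbert_space \<Rightarrow> (('h, 'k::chilbert_space) htensor \<Rightarrow>\<^sub>L ('h, 'k) htensor) \<Rightarrow> 'h \<Rightarrow> ('k \<Rightarrow>\<^sub>L 'k)"
  where "slice a X c \<equiv> adj (lket a) o\<^sub>L X o\<^sub>L lket c"

lemma left_unitor_eq: "(left_unitor :: (complex, 'h::chilbert_space) htensor \<Rightarrow>\<^sub>L 'h) = adj (lket 1)"
  unfolding left_unitor_def
  by (rule the_equality) (auto simp: adj_lket_apply cinner_complex_def intro!: tensor_ext)

lemma right_unitor_eq: "(right_unitor :: ('h::chilbert_space, complex) htensor \<Rightarrow>\<^sub>L 'h) = adj (rket 1)"
  unfolding right_unitor_def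
  by (rule the_equality) (auto simp: adj_rket_apply cinner_complex_def intro!: tensor_ext)

locale finite_onb =
  fixes N :: nat and e :: "nat \<Rightarrow> 'h::chilbert_space"
  assumes onb: "i < N \<Longrightarrow> j < N \<Longrightarrow> cinner (e i) (e j) = (if i = j then 1 else 0)"
    and expand: "x = (\<Sum>i<N. cinner (e i) x *\<^sub>C e i)"
begin

text \<open>Real linearity is the right generality because J is antilinear; hence the values at
  \<open>e i\<close> and at \<i> times \<open>e i\<close> both enter the bound.\<close>

lemma bounded_linear_fd:
  assumes "linear (f :: 'h \<Rightarrow> 'v::real_normed_vector)"
  shows "bounded_linear f"
proof -
  interpret f: linear f by fact
  show ?thesis
  proof (rule bounded_linear_intro[where K = "\<Sum>i<N. norm (f (e i)) + norm (f (\<i> *\<^sub>C e i))"])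
    fix x
    have sc: "norm (f (c *\<^sub>C y)) \<le> cmod c * (norm (f y) + norm (f (\<i> *\<^sub>C y)))" for c y
    proof -
      have "c *\<^sub>C y = Re c *\<^sub>R y + Im c *\<^sub>R (\<i> *\<^sub>C y)"
        unfolding scaleR_scaleC scaleC_scaleC scaleC_add_left[symmetric]
        by (subst complex_eq[of c]) (simp add: mult.commute)
      then have "norm (f (c *\<^sub>C y)) \<le> \<bar>Re c\<bar> * norm (f y) + \<bar>Im c\<bar> * norm (f (\<i> *\<^sub>C y))"
        by (simp add: f.add f.scaleR norm_triangle_le)
      also have "\<dots> \<le> cmod c * norm (f y) + cmod c * norm (f (\<i> *\<^sub>C y))"
        by (intro add_mono mult_right_mono abs_Re_le_cmod abs_Im_le_cmod) auto
      finally show ?thesis by (simp add: algebra_simps)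
    qed
    have "cmod (cinner (e i) x) \<le> norm x" if "i < N" for i
    proof -
      have "complex_of_real ((norm (e i))\<^sup>2) = 1" using onb[OF that that] by (simp add: cinner_self)
      then have "norm (e i) = 1" by (metis norm_ge_zero of_real_eq_1_iff power2_eq_1_iff neg_0_le_iff_le not_one_le_zero)
      then show ?thesis using norm_cinner_le[of "e i" x] by simp
    qed
    then have "(\<Sum>i<N. cmod (cinner (e i) x) * (norm (f (e i)) + norm (f (\<i> *\<^sub>C e i))))
        \<le> (\<Sum>i<N. norm x * (norm (f (e i)) + norm (f (\<i> *\<^sub>C e i))))"
      by (intro sum_mono mult_right_mono) auto
    moreover have "norm (f x) \<le> (\<Sum>i<N. cmod (cinner (e i) x) * (norm (f (e i)) + norm (f (\<i> *\<^sub>C e i))))"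
      by (subst expand[of x], subst f.sum, rule order_trans[OF norm_sum], rule sum_mono, rule sc)
    ultimately show "norm (f x) \<le> norm x * (\<Sum>i<N. norm (f (e i)) + norm (f (\<i> *\<^sub>C e i)))"
      by (simp add: sum_distrib_left)
  qed (auto simp: f.add f.scaleR)
qed

lemma sum_lket_adj_lket: "(\<Sum>i<N. lket (e i) o\<^sub>L adj (lket (e i))) = (id_blinfun :: ('h, 'k::chilbert_space) htensor \<Rightarrow>\<^sub>L _)"
proof (rule tensor_ext)
  fix x and y :: 'k
  have "(\<Sum>i<N. lket (e i) o\<^sub>L adj (lket (e i))) (x \<otimes>\<^sub>v y) = (\<Sum>i<N. cinner (e i) x *\<^sub>C e i) \<otimes>\<^sub>v y"
    by (simp add: blinfun.sum_left adj_lket_apply tensor_vec_sum_left tensor_vec_scaleC_left tensor_vec_scaleC_right)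
  then show "(\<Sum>i<N. lket (e i) o\<^sub>L adj (lket (e i))) (x \<otimes>\<^sub>v y) = id_blinfun (x \<otimes>\<^sub>v y)"
    using expand[of x] by simp
qed (auto intro!: bounded_ops_sum)

lemma op_eq_sum_ketbra:
  assumes "T \<in> bounded_ops"
  shows "T = (\<Sum>i<N. \<Sum>j<N. cinner (e i) (blinfun_apply T (e j)) *\<^sub>C ketbra (e i) (e j))"
proof (rule blinfun_eqI)
  fix x
  have "T x = (\<Sum>j<N. cinner (e j) x *\<^sub>C T (e j))"
    by (subst expand[of x]) (simp add: blinfun.sum_right op_scaleC assms)
  also have "\<dots> = (\<Sum>j<N. \<Sum>i<N. cinner (e i) (T (e j)) *\<^sub>C cinner (e j) x *\<^sub>C e i)"
    by (intro sum.cong refl, subst expand) (simp add: complex_vector.scale_sum_right scaleC_scaleC mult.commute)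
  also have "\<dots> = (\<Sum>i<N. \<Sum>j<N. cinner (e i) (T (e j)) *\<^sub>C cinner (e j) x *\<^sub>C e i)"
    by (rule sum.swap)
  finally show "T x = (\<Sum>i<N. \<Sum>j<N. cinner (e i) (T (e j)) *\<^sub>C ketbra (e i) (e j)) x"
    by (simp add: blinfun.sum_left scaleC_blinfun.rep_eq)
qed

lemma op_eq_sum_entries:
  fixes X :: "('h, 'k::chilbert_space) htensor \<Rightarrow>\<^sub>L ('h, 'k) htensor"
  assumes "X \<in> bounded_ops"
  shows "X = (\<Sum>i<N. \<Sum>j<N. ketbra (e i) (e j) \<otimes>\<^sub>o (slice (e i) X (e j)))"
proof -
  have "X = (\<Sum>i<N. lket (e i) o\<^sub>L adj (lket (e i))) o\<^sub>L X o\<^sub>L (\<Sum>j<N. lket (e j) o\<^sub>L adj (lket (e j)))"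
    by (simp add: sum_lket_adj_lket)
  also have "\<dots> = (\<Sum>i<N. \<Sum>j<N. ketbra (e i) (e j) \<otimes>\<^sub>o (slice (e i) X (e j)))"
    using assms
    by (subst sum.swap)
      (simp add: compose_sum_left compose_sum_right ketbra_tensor op_compose_assoc)
  finally show ?thesis .
qed

text \<open>A finite basis of the first leg gives an explicit associator, which settles existence in
  the definite description. Uniqueness is \<open>tensor_ext\<close> used once for each tensor
  sign.\<close>

lemma tensor_assoc_eq:
  "(tensor_assoc :: (('h, 'k::chilbert_space) htensor, 'l::chilbert_space) htensor \<Rightarrow>\<^sub>L _) =
    (\<Sum>i<N. lket (e i) o\<^sub>L (adj (lket (e i)) \<otimes>\<^sub>o id_blinfun))" (is "_ = ?X")
proof -
  have X: "?X \<in> bounded_ops" by (intro bounded_ops_sum bounded_ops_compose bounded_ops_tensor) auto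
  have Xa: "?X ((x \<otimes>\<^sub>v y) \<otimes>\<^sub>v z) = x \<otimes>\<^sub>v (y \<otimes>\<^sub>v z)" for x and y :: 'k and z :: 'l
  proof -
    have "?X ((x \<otimes>\<^sub>v y) \<otimes>\<^sub>v z) = (\<Sum>i<N. cinner (e i) x *\<^sub>C e i) \<otimes>\<^sub>v (y \<otimes>\<^sub>v z)"
      by (simp add: blinfun.sum_left tensor_op_apply adj_lket_apply tensor_vec_sum_left
          tensor_vec_scaleC_left tensor_vec_scaleC_right)
    then show ?thesis using expand[of x] by simp
  qed
  show ?thesis
    unfolding tensor_assoc_def
  proof (rule the_equality)
    fix Y assume Y: "Y \<in> bounded_ops \<and> (\<forall>(x :: 'h) (y :: 'k) (z :: 'l). Y ((x \<otimes>\<^sub>v y) \<otimes>\<^sub>v z) = x \<otimes>\<^sub>v y \<otimes>\<^sub>v z)"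
    show "Y = ?X"
    proof (rule tensor_ext)
      fix u and z :: 'l
      have "Y o\<^sub>L rket z = ?X o\<^sub>L rket z"
        by (rule tensor_ext) (use Y X Xa in auto)
      then have "(Y o\<^sub>L rket z) u = (?X o\<^sub>L rket z) u" by simp
      then show "Y (u \<otimes>\<^sub>v z) = ?X (u \<otimes>\<^sub>v z)" by simp
    qed (use X Y in auto)
  qed (use X Xa in auto)
qed

lemma
  shows bounded_ops_tensor_assoc [simp]: "(tensor_assoc :: (('h, 'k::chilbert_space) htensor, 'l::chilbert_space) htensor \<Rightarrow>\<^sub>L _) \<in> bounded_ops"
    and tensor_assoc_apply [simp]: "blinfun_apply tensor_assoc ((x \<otimes>\<^sub>v y) \<otimes>\<^sub>v z) = (x :: 'h) \<otimes>\<^sub>v ((y :: 'k) \<otimes>\<^sub>v (z :: 'l))"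
proof -
  show "(tensor_assoc :: (('h, 'k) htensor, 'l) htensor \<Rightarrow>\<^sub>L _) \<in> bounded_ops"
    unfolding tensor_assoc_eq by (intro bounded_ops_sum bounded_ops_compose bounded_ops_tensor) auto
  have "tensor_assoc ((x \<otimes>\<^sub>v y) \<otimes>\<^sub>v z) = (\<Sum>i<N. cinner (e i) x *\<^sub>C e i) \<otimes>\<^sub>v (y \<otimes>\<^sub>v z)"
    unfolding tensor_assoc_eq
    by (simp add: blinfun.sum_left tensor_op_apply adj_lket_apply tensor_vec_sum_left
        tensor_vec_scaleC_left tensor_vec_scaleC_right)
  then show "tensor_assoc ((x \<otimes>\<^sub>v y) \<otimes>\<^sub>v z) = x \<otimes>\<^sub>v (y \<otimes>\<^sub>v z)" using expand[of x] by simp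
qed

end

lemma ex_finite_onb:
  assumes "finite X" "cspan X = (UNIV :: 'h::chilbert_space set)"
  shows "\<exists>N (e :: nat \<Rightarrow> 'h). finite_onb N e"
proof -
  have "complex_vector.independent (some_basis :: 'h set)"
    unfolding complex_vector.independent_explicit_module
  proof (intro allI impI)
    fix t :: "'h set" and u v assume t: "finite t" "t \<subseteq> some_basis" "(\<Sum>v\<in>t. u v *\<^sub>C v) = 0" "v \<in> t"
    then show "u v = 0" using cinner_basis_sum[OF t(1,2), of v u] by auto
  qed
  then have fin: "finite (some_basis :: 'h set)"
    using complex_vector.independent_span_bound[OF assms(1)] assms(2) by auto
  then obtain b where b: "bij_betw b {0..<card (some_basis :: 'h set)} (some_basis :: 'h set)"
    using ex_bij_betw_nat_finite by blast
  then have b: "bij_betw b {..<card (some_basis :: 'h set)} (some_basis :: 'h set)"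
    by (simp add: atLeast0LessThan)
  have "finite_onb (card (some_basis :: 'h set)) b"
  proof
    fix i j assume ij: "i < card (some_basis :: 'h set)" "j < card (some_basis :: 'h set)"
    then have "b i \<in> some_basis" "b j \<in> some_basis" "b i = b j \<longleftrightarrow> i = j"
      using b by (auto simp: bij_betw_def inj_on_def)
    then show "cinner (b i) (b j) = (if i = j then 1 else 0)" by (simp add: cinner_some_basis)
  next
    fix x :: 'h
    have "x = (\<Sum>f\<in>some_basis. cinner f x *\<^sub>C f)"
      using basis_expansion[of x] fin has_sum_unique[OF _ has_sum_finite[OF fin]] by blast
    also have "\<dots> = (\<Sum>i<card (some_basis :: 'h set). cinner (b i) x *\<^sub>C b i)"
      by (rule sum.reindex_bij_betw[OF b, symmetric])
    finally show "x = (\<Sum>i<card (some_basis :: 'h set). cinner (b i) x *\<^sub>C b i)" .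
  qed
  then show ?thesis by blast
qed

section \<open>Finite-dimensional C*-algebras with a faithful state\<close>

lemma
  assumes "clinear f"
  shows clinear_add: "f (x + y) = f x + f y" and clinear_scaleC: "f (c *\<^sub>C x) = c *\<^sub>C f x"
    and clinear_zero: "f 0 = 0" and clinear_diff: "f (x - y) = f x - f y"
    and clinear_sum: "f (\<Sum>i\<in>I. g i) = (\<Sum>i\<in>I. f (g i))"
proof -
  interpret f: Vector_Spaces.linear "(*\<^sub>C)" "(*\<^sub>C)" f by fact
  show "f (x + y) = f x + f y" "f (c *\<^sub>C x) = c *\<^sub>C f x" "f 0 = 0" "f (x - y) = f x - f y"
    "f (\<Sum>i\<in>I. g i) = (\<Sum>i\<in>I. f (g i))"
    by (rule f.add f.scale f.zero f.diff f.sum)+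
qed

lemma scaleC_mult_simps [simp]:
  "c *\<^sub>C x * y = c *\<^sub>C (x * (y :: 'b::cstar_algebra))" "x * c *\<^sub>C y = c *\<^sub>C (x * y)"
  by (rule scaleC_mult_left scaleC_mult_right)+

lemma star_zero [simp]: "star 0 = (0 :: 'b::cstar_algebra)"
  using star_add[of "0 :: 'b" 0] by simp

lemma star_diff: "star (x - y) = star x - star (y :: 'b::cstar_algebra)"
  using star_add[of "x - y" y] by simp

lemma star_sum: "star (\<Sum>i\<in>I. f i) = (\<Sum>i\<in>I. star (f i :: 'b::cstar_algebra))"
  by (induction I rule: infinite_finite_induct) (auto simp: star_add)

lemma star_one [simp]: "star 1 = (1 :: 'b::cstar_algebra)"
  using star_mult[of "star 1 :: 'b" 1] by (simp add: star_star)

lemma star_power: "star (x ^ n) = star (x :: 'b::cstar_algebra) ^ n"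
  by (induction n) (auto simp: star_mult power_commutes)

lemma norm_star: "norm (star x) = norm (x :: 'b::cstar_algebra)"
proof -
  have le: "norm y \<le> norm (star y)" for y :: 'b
  proof -
    have "norm y * norm y \<le> norm (star y) * norm y"
      using norm_mult_ineq[of "star y" y] cstar_identity[of y] by (simp add: power2_eq_square)
    then show ?thesis by (cases "y = 0") (auto simp: mult_le_cancel_right)
  qed
  show ?thesis using le[of x] le[of "star x"] by (simp add: star_star)
qed

lemma star_exp: "star (exp x) = exp (star (x :: 'b::cstar_algebra))"
proof -
  have "bounded_linear (star :: 'b \<Rightarrow> 'b)"
    by (rule bounded_linear_intro[where K = 1]) (simp_all add: star_add star_scaleC scaleR_scaleC norm_star)
  from bounded_linear.sums[OF this exp_converges[of x]]
  have "(\<lambda>n. star x ^ n /\<^sub>R fact n) sums star (exp x)"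
    by (simp add: star_scaleC scaleR_scaleC star_power)
  then show ?thesis using exp_converges[of "star x"] sums_unique2 by blast
qed

subsection \<open>States\<close>

lemma faithful_stateD:
  assumes "faithful_state \<psi>"
  shows "clinear \<psi>" "\<psi> 1 = 1" "Im (\<psi> (star a * a)) = 0" "0 \<le> Re (\<psi> (star a * a))"
    "\<psi> (star a * a) = 0 \<Longrightarrow> a = 0"
  using assms unfolding faithful_state_def by auto

lemma state_add: "faithful_state \<psi> \<Longrightarrow> \<psi> (x + y) = \<psi> x + \<psi> y"
  by (rule clinear_add[OF faithful_stateD(1)])

lemma state_scaleC: "faithful_state \<psi> \<Longrightarrow> \<psi> (c *\<^sub>C x) = c * \<psi> x"
  using clinear_scaleC[OF faithful_stateD(1), of \<psi> c x] by (simp add: scaleC_complex_def)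

text \<open>Positivity makes \<psi> real at star y * y. Taking y = x, 1 + x and 1 + \<i> x compares
  first the imaginary and then the real parts.\<close>

lemma state_star:
  assumes "faithful_state \<psi>"
  shows "\<psi> (star x) = cnj (\<psi> x)"
proof -
  note st = state_add[OF assms] state_scaleC[OF assms]
  have 1: "star (1 + x) * (1 + x) = 1 + x + star x + star x * x"
    by (simp add: star_add algebra_simps)
  have 2: "star (1 + \<i> *\<^sub>C x) * (1 + \<i> *\<^sub>C x) = 1 + \<i> *\<^sub>C x + (- \<i>) *\<^sub>C star x + star x * x"
    by (simp add: star_add star_scaleC algebra_simps scaleC_scaleC scaleC_one)
  show ?thesis
    using faithful_stateD(3)[OF assms, of "1 + x"] faithful_stateD(3)[OF assms, of "1 + \<i> *\<^sub>C x"]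
      faithful_stateD(3)[OF assms, of x]
    unfolding 1 2 st faithful_stateD(2)[OF assms] by (simp add: complex_eq_iff)
qed

subsection \<open>The spectral theorem and the logarithm\<close>

text \<open>This is p(a) c in Horner form. Carrying c along allows a linear factor of p to be moved
  into c, which drives the induction on the degree.\<close>

definition eval_at :: "'b::cstar_algebra \<Rightarrow> complex poly \<Rightarrow> 'b \<Rightarrow> 'b"
  where "eval_at a p c = fold_coeffs (\<lambda>k v. k *\<^sub>C c + a * v) p 0"

lemma eval_at_0 [simp]: "eval_at a 0 c = 0"
  by (simp add: eval_at_def)

lemma eval_at_pCons [simp]: "eval_at a (pCons k p) c = k *\<^sub>C c + a * eval_at a p c"
  by (cases "k = 0 \<and> p = 0") (auto simp: eval_at_def)

lemma eval_at_add: "eval_at a (p + q) c = eval_at a p c + eval_at a q c"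
  by (induction p q rule: poly_induct2) (simp_all add: scaleC_add_left algebra_simps)

lemma eval_at_sum: "eval_at a (\<Sum>i\<in>I. p i) c = (\<Sum>i\<in>I. eval_at a (p i) c)"
  by (induction I rule: infinite_finite_induct) (auto simp: eval_at_add)

lemma eval_at_smult: "eval_at a (smult k p) c = k *\<^sub>C eval_at a p c"
  by (induction p) (simp_all add: scaleC_add_right scaleC_scaleC)

lemma eval_at_mult_right: "eval_at a p (a * c - l *\<^sub>C c) = a * eval_at a p c - l *\<^sub>C eval_at a p c"
proof (induction p)
  case (pCons k p)
  show ?case
    unfolding eval_at_pCons pCons(2)
    by (simp add: algebra_simps complex_vector.scale_right_diff_distrib scaleC_add_right scaleC_scaleC)
qed simp

lemma eval_at_linear_factor: "eval_at a ([:- l, 1:] * q) c = eval_at a q (a * c - l *\<^sub>C c)"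
proof -
  have "[:- l, 1:] * q = pCons 0 q + smult (- l) q" by simp
  then show ?thesis by (simp only: eval_at_add eval_at_smult eval_at_mult_right) simp
qed

lemma eval_at_monom: "eval_at a (monom k i) c = k *\<^sub>C (a ^ i * c)"
  by (induction i) (simp_all add: monom_0 monom_Suc mult.assoc)

text \<open>There are \<open>card X + 1\<close> powers of a in play. Either two of them coincide,
  which gives a difference of monomials, or their set is too large to be independent. The first case
  is separate because a set of powers does not see repetitions.\<close>

lemma ex_annihilating_poly:
  fixes a :: "'b::cstar_algebra"
  assumes X: "finite X" "cspan X = (UNIV :: 'b set)"
  shows "\<exists>p. p \<noteq> 0 \<and> eval_at a p 1 = 0"
proof (cases "inj_on (\<lambda>i. a ^ i) {..card X}")
  case False
  then obtain i j where ij: "i \<noteq> j" "a ^ i = a ^ j" by (auto simp: inj_on_def)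
  define p :: "complex poly" where "p = monom 1 i + monom (- 1) j"
  have "coeff p i \<noteq> 0" using ij by (simp add: p_def)
  then have "p \<noteq> 0" by auto
  moreover have "eval_at a p 1 = 0"
    using ij by (simp add: p_def eval_at_add eval_at_monom scaleC_one)
  ultimately show ?thesis by blast
next
  case True
  let ?S = "(\<lambda>i. a ^ i) ` {..card X}"
  have "card ?S = Suc (card X)" using True by (simp add: card_image)
  then have "complex_vector.dependent ?S"
    using complex_vector.independent_span_bound[OF X(1), of ?S] X(2) by auto
  then obtain u v where u: "v \<in> ?S" "u v \<noteq> 0" "(\<Sum>v\<in>?S. u v *\<^sub>C v) = 0"
    using complex_vector.dependent_finite[of ?S] by auto
  define p where "p = (\<Sum>i\<le>card X. monom (u (a ^ i)) i)"
  obtain i where i: "i \<le> card X" "v = a ^ i" using u(1) by auto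
  have "coeff p i = u (a ^ i)" using i by (simp add: p_def coeff_sum)
  then have "p \<noteq> 0" using u(2) i by auto
  moreover have "eval_at a p 1 = 0"
    using u(3) by (simp add: p_def eval_at_sum eval_at_monom sum.reindex[OF True])
  ultimately show ?thesis by blast
qed

text \<open>Splitting off a root l of p lowers the degree, and the induction hypothesis decomposes a
  c - l c. The faithful state supplies the inner product \<psi>(star x * y), for which
  multiplication by a is symmetric; hence eigenvalues are real and generalised eigenvectors are
  eigenvectors.\<close>

lemma eigenvector_decomposition:
  fixes a :: "'b::cstar_algebra"
  assumes \<psi>: "faithful_state (\<psi> :: 'b \<Rightarrow> complex)" and a: "star a = a"
    and p: "p \<noteq> 0" "eval_at a p c = 0"
  shows "\<exists>(M :: real set) d. finite M \<and> c = (\<Sum>\<mu>\<in>M. d \<mu>) \<and> (\<forall>\<mu>\<in>M. a * d \<mu> = complex_of_real \<mu> *\<^sub>C d \<mu>)"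
  using p
proof (induction "degree p" arbitrary: p c)
  case 0
  then obtain k where "p = [:k:]" using degree_eq_zeroE by metis
  then have "c = 0" using 0 by simp
  then show ?case by (intro exI[of _ "{}"]) auto
next
  case (Suc n)
  then have "\<not> constant (poly p)" by (simp add: constant_degree)
  then obtain l where "poly p l = 0" using fundamental_theorem_of_algebra by blast
  then obtain q where q: "p = [:- l, 1:] * q" by (metis poly_eq_0_iff_dvd dvdE)
  have "q \<noteq> 0" using Suc(3) q by auto
  moreover have "n = degree q" using Suc(2) \<open>q \<noteq> 0\<close> unfolding q by (subst (asm) degree_mult_eq) auto
  moreover have "eval_at a q (a * c - l *\<^sub>C c) = 0" using Suc(4) unfolding q eval_at_linear_factor .
  ultimately obtain M :: "real set" and d where M: "finite M" "a * c - l *\<^sub>C c = (\<Sum>\<mu>\<in>M. d \<mu>)"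
    "\<And>\<mu>. \<mu> \<in> M \<Longrightarrow> a * d \<mu> = complex_of_real \<mu> *\<^sub>C d \<mu>"
    using Suc(1) by blast
  \<comment> \<open>For \<mu> \<noteq> l the map x \<mapsto> a x - l x is inverted on eigenvectors
    by division by \<mu> - l. Subtracting these preimages from c leaves \<open>f\<close>, on which
    the square of that map vanishes.\<close>
  define M' where "M' = {\<mu> \<in> M. complex_of_real \<mu> \<noteq> l}"
  define d' where "d' \<mu> = (1 / (complex_of_real \<mu> - l)) *\<^sub>C d \<mu>" for \<mu>
  define f where "f = c - (\<Sum>\<mu>\<in>M'. d' \<mu>)"
  have d': "a * d' \<mu> = complex_of_real \<mu> *\<^sub>C d' \<mu>" if "\<mu> \<in> M'" for \<mu>
    using M(3) that by (simp add: d'_def M'_def scaleC_scaleC mult.commute)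
  have "a * d' \<mu> - l *\<^sub>C d' \<mu> = d \<mu>" if "\<mu> \<in> M'" for \<mu>
    unfolding d'[OF that] complex_vector.scale_left_diff_distrib[symmetric]
    using that by (simp add: d'_def scaleC_scaleC scaleC_one M'_def)
  then have "(\<Sum>\<mu>\<in>M'. a * d' \<mu> - l *\<^sub>C d' \<mu>) = (\<Sum>\<mu>\<in>M'. d \<mu>)" by (intro sum.cong refl)
  then have "a * (\<Sum>\<mu>\<in>M'. d' \<mu>) - l *\<^sub>C (\<Sum>\<mu>\<in>M'. d' \<mu>) = (\<Sum>\<mu>\<in>M'. d \<mu>)"
    by (simp add: sum_distrib_left complex_vector.scale_sum_right sum_subtractf)
  moreover have "a * f - l *\<^sub>C f =
      (a * c - l *\<^sub>C c) - (a * (\<Sum>\<mu>\<in>M'. d' \<mu>) - l *\<^sub>C (\<Sum>\<mu>\<in>M'. d' \<mu>))"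
    unfolding f_def by (simp add: right_diff_distrib complex_vector.scale_right_diff_distrib)
  ultimately have "a * f - l *\<^sub>C f = (\<Sum>\<mu>\<in>M. d \<mu>) - (\<Sum>\<mu>\<in>M'. d \<mu>)" by (simp only: M(2))
  also have "\<dots> = (\<Sum>\<mu>\<in>M - M'. d \<mu>)"
    by (subst sum_diff[symmetric]) (auto simp: M M'_def)
  finally have f1: "a * f - l *\<^sub>C f = (\<Sum>\<mu>\<in>M - M'. d \<mu>)" .
  have f2: "a * (a * f - l *\<^sub>C f) = l *\<^sub>C (a * f - l *\<^sub>C f)"
    unfolding f1 sum_distrib_left complex_vector.scale_sum_right
    by (intro sum.cong refl) (use M(3) in \<open>auto simp: M'_def\<close>)
  have real: "l = complex_of_real (Re l) \<or> g = 0" if "a * g = l *\<^sub>C g" for g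
  proof -
    have "\<psi> (star g * a * g) = l * \<psi> (star g * g)"
      using that by (simp add: mult.assoc state_scaleC[OF \<psi>])
    moreover have "cnj (\<psi> (star g * a * g)) = \<psi> (star g * a * g)"
      unfolding state_star[OF \<psi>, symmetric] by (simp add: star_mult star_star a mult.assoc)
    moreover have "cnj (\<psi> (star g * g)) = \<psi> (star g * g)"
      unfolding state_star[OF \<psi>, symmetric] by (simp add: star_mult star_star)
    ultimately have "cnj l * \<psi> (star g * g) = l * \<psi> (star g * g)" by simp
    then have "cnj l = l \<or> g = 0" using faithful_stateD(5)[OF \<psi>] by auto
    then show ?thesis by (auto simp: complex_eq_iff)
  qed
  \<comment> \<open>Let g = a f - l f. For real l, star g * g equals star f * (a g - l g), which is
    zero by \<open>f2\<close>, and faithfulness gives g = 0. For other l, \<open>real\<close>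
    applies to g itself.\<close>
  have f3: "a * f = l *\<^sub>C f"
  proof (cases "l = complex_of_real (Re l)")
    case True
    then have lr: "cnj l = l" by (metis complex_cnj_complex_of_real)
    define g where "g = a * f - l *\<^sub>C f"
    have "star g * g = star f * (a * g - l *\<^sub>C g)"
      unfolding g_def by (simp add: star_diff star_mult star_scaleC a lr algebra_simps
        complex_vector.scale_right_diff_distrib)
    also have "\<dots> = 0" using f2 by (simp add: g_def)
    finally have "g = 0" using faithful_stateD(5)[OF \<psi>] clinear_zero[OF faithful_stateD(1)[OF \<psi>]] by simp
    then show ?thesis by (simp add: g_def)
  next
    case False
    then show ?thesis using real[OF f2] by auto
  qed
  have cf: "c = f + (\<Sum>\<mu>\<in>M'. d' \<mu>)" by (simp add: f_def)
  have finM': "finite M'" using M(1) by (simp add: M'_def)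
  show ?case
  proof (cases "l = complex_of_real (Re l)")
    case True
    have ni: "Re l \<notin> M'" using True by (simp add: M'_def)
    show ?thesis
    proof (intro exI conjI ballI)
      have "(\<Sum>\<mu>\<in>M'. if \<mu> = Re l then f else d' \<mu>) = (\<Sum>\<mu>\<in>M'. d' \<mu>)"
        by (intro sum.cong refl) (use ni in auto)
      then show "c = (\<Sum>\<mu>\<in>insert (Re l) M'. if \<mu> = Re l then f else d' \<mu>)"
        unfolding sum.insert[OF finM' ni] using cf by simp
      show "finite (insert (Re l) M')" using finM' by simp
      fix \<mu> assume "\<mu> \<in> insert (Re l) M'"
      then show "a * (if \<mu> = Re l then f else d' \<mu>) = complex_of_real \<mu> *\<^sub>C (if \<mu> = Re l then f else d' \<mu>)"
        using f3 d' by (cases "\<mu> = Re l") (simp_all flip: True)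
    qed
  next
    case False
    then have "f = 0" using real[OF f3] by auto
    then show ?thesis using cf finM' d' by (intro exI[of _ M'] exI[of _ d']) auto
  qed
qed

text \<open>Members \<mu> of \<open>M\<close> with P \<mu> = 0 are permitted, so \<open>M\<close>
  may be larger than the spectrum.\<close>

definition spectral_decomp :: "'b::cstar_algebra \<Rightarrow> real set \<Rightarrow> (real \<Rightarrow> 'b) \<Rightarrow> bool" where
  "spectral_decomp a M P \<longleftrightarrow> finite M \<and> (\<Sum>\<mu>\<in>M. P \<mu>) = 1 \<and>
     (\<forall>\<mu>\<in>M. star (P \<mu>) = P \<mu> \<and> a * P \<mu> = complex_of_real \<mu> *\<^sub>C P \<mu>) \<and>
     (\<forall>\<mu>\<in>M. \<forall>\<nu>\<in>M. P \<mu> * P \<nu> = (if \<mu> = \<nu> then P \<mu> else 0))"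

text \<open>The projections are the eigencomponents of 1. Components for distinct eigenvalues are
  orthogonal, so multiplying star (P \<mu>) by 1, the sum of all components, gives star (P \<mu>) =
  star (P \<mu>) * P \<mu>; this makes P \<mu> a projection.\<close>

lemma ex_spectral_decomp:
  fixes a :: "'b::cstar_algebra"
  assumes \<psi>: "faithful_state (\<psi> :: 'b \<Rightarrow> complex)" and X: "finite X" "cspan X = (UNIV :: 'b set)" and a: "star a = a"
  shows "\<exists>M P. spectral_decomp a M P"
proof -
  obtain p where p: "p \<noteq> 0" "eval_at a p 1 = 0" using ex_annihilating_poly[OF X] by blast
  obtain M :: "real set" and P where M: "finite M" "1 = (\<Sum>\<mu>\<in>M. P \<mu>)"
    "\<And>\<mu>. \<mu> \<in> M \<Longrightarrow> a * P \<mu> = complex_of_real \<mu> *\<^sub>C P \<mu>"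
    using eigenvector_decomposition[OF \<psi> a p] by blast
  have orth: "star (P \<mu>) * P \<nu> = 0" if "\<mu> \<in> M" "\<nu> \<in> M" "\<mu> \<noteq> \<nu>" for \<mu> \<nu>
  proof -
    have "star (a * P \<mu>) * P \<nu> = star (P \<mu>) * (a * P \<nu>)" by (simp add: star_mult a mult.assoc)
    then have "complex_of_real \<mu> *\<^sub>C (star (P \<mu>) * P \<nu>) = complex_of_real \<nu> *\<^sub>C (star (P \<mu>) * P \<nu>)"
      using M(3) that by (simp add: star_scaleC)
    then show ?thesis using that(3) by (simp add: complex_vector.scale_cancel_right)
  qed
  have sq: "star (P \<mu>) = star (P \<mu>) * P \<mu>" if "\<mu> \<in> M" for \<mu>
  proof -
    have "star (P \<mu>) = star (P \<mu>) * (\<Sum>\<nu>\<in>M. P \<nu>)" by (simp flip: M(2))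
    also have "\<dots> = (\<Sum>\<nu>\<in>M. if \<nu> = \<mu> then star (P \<mu>) * P \<mu> else 0)"
      unfolding sum_distrib_left by (intro sum.cong refl) (use orth that in auto)
    finally show ?thesis using M(1) that by simp
  qed
  have sa: "star (P \<mu>) = P \<mu>" if "\<mu> \<in> M" for \<mu>
    by (metis sq[OF that] star_mult star_star)
  have PP: "P \<mu> * P \<nu> = (if \<mu> = \<nu> then P \<mu> else 0)" if "\<mu> \<in> M" "\<nu> \<in> M" for \<mu> \<nu>
    using orth[OF that] sq[OF that(1), symmetric] unfolding sa[OF that(1)] by auto
  have "spectral_decomp a M P"
    unfolding spectral_decomp_def using M sa PP by simp
  then show ?thesis by blast
qed

lemma spectral_decompD:
  assumes "spectral_decomp a M P"
  shows "finite M" "(\<Sum>\<mu>\<in>M. P \<mu>) = 1" "\<mu> \<in> M \<Longrightarrow> star (P \<mu>) = P \<mu>"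
    "\<mu> \<in> M \<Longrightarrow> a * P \<mu> = complex_of_real \<mu> *\<^sub>C P \<mu>"
    "\<mu> \<in> M \<Longrightarrow> \<nu> \<in> M \<Longrightarrow> P \<mu> * P \<nu> = (if \<mu> = \<nu> then P \<mu> else 0)"
    "a = (\<Sum>\<mu>\<in>M. complex_of_real \<mu> *\<^sub>C P \<mu>)"
proof -
  show *: "finite M" "(\<Sum>\<mu>\<in>M. P \<mu>) = 1" "\<mu> \<in> M \<Longrightarrow> star (P \<mu>) = P \<mu>"
    "\<mu> \<in> M \<Longrightarrow> a * P \<mu> = complex_of_real \<mu> *\<^sub>C P \<mu>"
    "\<mu> \<in> M \<Longrightarrow> \<nu> \<in> M \<Longrightarrow> P \<mu> * P \<nu> = (if \<mu> = \<nu> then P \<mu> else 0)" for \<mu> \<nu>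
    using assms unfolding spectral_decomp_def by auto
  have "a = a * (\<Sum>\<mu>\<in>M. P \<mu>)" by (simp add: *(2))
  also have "\<dots> = (\<Sum>\<mu>\<in>M. complex_of_real \<mu> *\<^sub>C P \<mu>)"
    unfolding sum_distrib_left by (intro sum.cong refl *(4))
  finally show "a = (\<Sum>\<mu>\<in>M. complex_of_real \<mu> *\<^sub>C P \<mu>)" .
qed

lemma spectral_sum_mult:
  assumes "spectral_decomp a M P"
  shows "(\<Sum>\<mu>\<in>M. c \<mu> *\<^sub>C P \<mu>) * (\<Sum>\<mu>\<in>M. d \<mu> *\<^sub>C P \<mu>) = (\<Sum>\<mu>\<in>M. (c \<mu> * d \<mu>) *\<^sub>C P \<mu>)"
proof -
  note sd = spectral_decompD[OF assms]
  have "(\<Sum>\<mu>\<in>M. c \<mu> *\<^sub>C P \<mu>) * (\<Sum>\<mu>\<in>M. d \<mu> *\<^sub>C P \<mu>) =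
      (\<Sum>\<mu>\<in>M. \<Sum>\<nu>\<in>M. if \<mu> = \<nu> then (c \<mu> * d \<mu>) *\<^sub>C P \<mu> else 0)"
    unfolding sum_product by (intro sum.cong refl) (auto simp: sd(5) scaleC_scaleC mult.commute)
  then show ?thesis using sd(1) by simp
qed

lemma exp_spectral_sum:
  assumes "spectral_decomp a M P"
  shows "exp (\<Sum>\<mu>\<in>M. c \<mu> *\<^sub>C P \<mu>) = (\<Sum>\<mu>\<in>M. exp (c \<mu>) *\<^sub>C (P \<mu> :: 'b::cstar_algebra))"
proof -
  note sd = spectral_decompD[OF assms]
  have pw: "(\<Sum>\<mu>\<in>M. c \<mu> *\<^sub>C P \<mu>) ^ n = (\<Sum>\<mu>\<in>M. c \<mu> ^ n *\<^sub>C P \<mu>)" for n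
    by (induction n) (simp_all add: sd(2) scaleC_one spectral_sum_mult[OF assms])
  have bl: "bounded_linear (\<lambda>z. z *\<^sub>C p)" for p :: 'b
    by (rule bounded_linear_intro[where K = "norm p"])
      (simp_all add: scaleC_add_left scaleR_scaleC scaleC_scaleC norm_scaleC scaleC_complex_def)
  have "(\<lambda>n. \<Sum>\<mu>\<in>M. (c \<mu> ^ n /\<^sub>R fact n) *\<^sub>C P \<mu>) sums (\<Sum>\<mu>\<in>M. exp (c \<mu>) *\<^sub>C P \<mu>)"
    by (intro sums_sum bounded_linear.sums[OF bl] exp_converges)
  also have "(\<lambda>n. \<Sum>\<mu>\<in>M. (c \<mu> ^ n /\<^sub>R fact n) *\<^sub>C P \<mu>) = (\<lambda>n. (\<Sum>\<mu>\<in>M. c \<mu> *\<^sub>C P \<mu>) ^ n /\<^sub>R fact n)"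
    unfolding pw by (simp add: scaleR_scaleC complex_vector.scale_sum_right scaleC_scaleC scaleC_complex_def)
  finally show ?thesis using exp_converges sums_unique2 by blast
qed

text \<open>The definite description in \<open>cstar_log\<close> calls for existence and uniqueness
  of a self-adjoint logarithm; both come from spectral decompositions.\<close>

lemma cstar_log_spec:
  fixes Q :: "'b::cstar_algebra"
  assumes \<psi>: "faithful_state (\<psi> :: 'b \<Rightarrow> complex)" and X: "finite X" "cspan X = (UNIV :: 'b set)" and Q: "positive_invertible Q"
  shows "star (cstar_log Q) = cstar_log Q" "exp (cstar_log Q) = Q"
proof -
  obtain c P' where c: "Q = star c * c" and P': "P' * Q = 1"
    using Q unfolding positive_invertible_def by blast
  have Qsa: "star Q = Q" unfolding c by (simp add: star_mult star_star)
  obtain M P where sd: "spectral_decomp Q M P" using ex_spectral_decomp[OF \<psi> X Qsa] by blast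
  note sdD = spectral_decompD[OF sd]
  \<comment> \<open>Indices with P \<mu> = 0 may be nonpositive. There the value of
    \<open>ln\<close> is arbitrary and is multiplied by zero.\<close>
  have pos: "\<mu> > 0" if \<mu>: "\<mu> \<in> M" "P \<mu> \<noteq> 0" for \<mu>
  proof (rule ccontr)
    assume "\<not> \<mu> > 0"
    have PP: "star (P \<mu>) * P \<mu> = P \<mu>" using \<mu> sdD(3,5) by simp
    have "star (c * P \<mu>) * (c * P \<mu>) = star (P \<mu>) * (Q * P \<mu>)" by (simp add: c star_mult mult.assoc)
    also have "\<dots> = complex_of_real \<mu> *\<^sub>C (star (P \<mu>) * P \<mu>)" using \<mu> sdD(4) by simp
    finally have "0 \<le> \<mu> * Re (\<psi> (star (P \<mu>) * P \<mu>))"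
      using faithful_stateD(4)[OF \<psi>, of "c * P \<mu>"] by (simp add: state_scaleC[OF \<psi>])
    moreover have "Re (\<psi> (star (P \<mu>) * P \<mu>)) > 0"
      using faithful_stateD(3,4,5)[OF \<psi>, of "P \<mu>"] \<mu>(2) by (auto simp: complex_eq_iff order_less_le)
    ultimately have "\<mu> \<ge> 0" by (simp add: zero_le_mult_iff)
    then have "\<mu> = 0" using \<open>\<not> \<mu> > 0\<close> by simp
    then have "Q * P \<mu> = 0" using sdD(4)[OF \<mu>(1)] by simp
    then have "P' * (Q * P \<mu>) = 0" by simp
    then show False using \<mu>(2) P' by (simp flip: mult.assoc)
  qed
  define L where "L = (\<Sum>\<mu>\<in>M. complex_of_real (ln \<mu>) *\<^sub>C P \<mu>)"
  have L1: "star L = L" unfolding L_def star_sum star_scaleC by (intro sum.cong refl) (simp add: sdD(3))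
  have "exp L = (\<Sum>\<mu>\<in>M. exp (complex_of_real (ln \<mu>)) *\<^sub>C P \<mu>)"
    unfolding L_def by (rule exp_spectral_sum[OF sd])
  also have "\<dots> = (\<Sum>\<mu>\<in>M. complex_of_real \<mu> *\<^sub>C P \<mu>)"
  proof (intro sum.cong refl)
    fix \<mu> assume "\<mu> \<in> M"
    then show "exp (complex_of_real (ln \<mu>)) *\<^sub>C P \<mu> = complex_of_real \<mu> *\<^sub>C P \<mu>"
      using pos[of \<mu>] by (cases "P \<mu> = 0") (auto simp: exp_of_real)
  qed
  also have "\<dots> = Q" by (rule sdD(6)[symmetric])
  finally have L2: "exp L = Q" .
  have uniq: "L' = L" if L': "star L' = L'" "exp L' = Q" for L'
  proof -
    obtain M1 P1 where sd1: "spectral_decomp L M1 P1" using ex_spectral_decomp[OF \<psi> X L1] by blast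
    obtain M2 P2 where sd2: "spectral_decomp L' M2 P2" using ex_spectral_decomp[OF \<psi> X L'(1)] by blast
    note s1 = spectral_decompD[OF sd1] and s2 = spectral_decompD[OF sd2]
    have e1: "Q = (\<Sum>\<mu>\<in>M1. exp (complex_of_real \<mu>) *\<^sub>C P1 \<mu>)"
      using exp_spectral_sum[OF sd1, of complex_of_real] s1(6) L2 by simp
    have e2: "Q = (\<Sum>\<mu>\<in>M2. exp (complex_of_real \<mu>) *\<^sub>C P2 \<mu>)"
      using exp_spectral_sum[OF sd2, of complex_of_real] s2(6) L'(2) by simp
    have q1: "P1 \<mu> * Q = exp (complex_of_real \<mu>) *\<^sub>C P1 \<mu>" if "\<mu> \<in> M1" for \<mu>
      unfolding e1 sum_distrib_left using that s1(1) by (simp add: s1(5) if_distrib cong: if_cong)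
    have q2: "Q * P2 \<nu> = exp (complex_of_real \<nu>) *\<^sub>C P2 \<nu>" if "\<nu> \<in> M2" for \<nu>
      unfolding e2 sum_distrib_right using that s2(1) by (simp add: s2(5) if_distrib cong: if_cong)
    \<comment> \<open>Both families consist of eigenprojections of Q, with eigenvalues exp \<mu> and
      exp \<nu>. The real exponential is injective, so spectral projections of L and L' for
      different values are orthogonal.\<close>
    have z: "P1 \<mu> * P2 \<nu> = 0" if "\<mu> \<in> M1" "\<nu> \<in> M2" "\<mu> \<noteq> \<nu>" for \<mu> \<nu>
    proof -
      have "(P1 \<mu> * Q) * P2 \<nu> = P1 \<mu> * (Q * P2 \<nu>)" by (rule mult.assoc)
      then have "exp (complex_of_real \<mu>) *\<^sub>C (P1 \<mu> * P2 \<nu>) = exp (complex_of_real \<nu>) *\<^sub>C (P1 \<mu> * P2 \<nu>)"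
        using that by (simp add: q1 q2)
      then show ?thesis using that(3) by (simp add: complex_vector.scale_cancel_right exp_of_real)
    qed
    have LP: "L * P2 \<nu> = complex_of_real \<nu> *\<^sub>C P2 \<nu>" if "\<nu> \<in> M2" for \<nu>
    proof -
      have "L * P2 \<nu> = (\<Sum>\<mu>\<in>M1. complex_of_real \<mu> *\<^sub>C (P1 \<mu> * P2 \<nu>))"
        by (subst s1(6)) (simp add: sum_distrib_right)
      also have "\<dots> = (\<Sum>\<mu>\<in>M1. complex_of_real \<nu> *\<^sub>C (P1 \<mu> * P2 \<nu>))"
        by (intro sum.cong refl) (use z that in \<open>metis complex_vector.scale_zero_right\<close>)
      also have "\<dots> = complex_of_real \<nu> *\<^sub>C ((\<Sum>\<mu>\<in>M1. P1 \<mu>) * P2 \<nu>)"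
        by (simp add: sum_distrib_right complex_vector.scale_sum_right)
      finally show ?thesis by (simp add: s1(2))
    qed
    have "L = L * (\<Sum>\<nu>\<in>M2. P2 \<nu>)" by (simp add: s2(2))
    also have "\<dots> = (\<Sum>\<nu>\<in>M2. complex_of_real \<nu> *\<^sub>C P2 \<nu>)"
      unfolding sum_distrib_left by (intro sum.cong refl LP)
    also have "\<dots> = L'" by (rule s2(6)[symmetric])
    finally show ?thesis ..
  qed
  have "cstar_log Q = L"
    unfolding cstar_log_def
  proof (rule the_equality)
    show "star L = L \<and> exp L = Q" using L1 L2 ..
    show "L' = L" if "star L' = L' \<and> exp L' = Q" for L' using uniq that by blast
  qed
  then show "star (cstar_log Q) = cstar_log Q" "exp (cstar_log Q) = Q" using L1 L2 by simp_all
qed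

subsection \<open>The trace\<close>

abbreviation unit_sum ::
    "nat \<Rightarrow> (nat \<Rightarrow> nat) \<Rightarrow> (nat \<Rightarrow> nat \<Rightarrow> nat \<Rightarrow> 'b::cstar_algebra) \<Rightarrow> (nat \<Rightarrow> nat \<Rightarrow> nat \<Rightarrow> complex) \<Rightarrow> 'b"
  where "unit_sum r n E c \<equiv> \<Sum>k<r. \<Sum>i<n k. \<Sum>j<n k. c k i j *\<^sub>C E k i j"

lemma matrix_unitsD:
  assumes "matrix_units r n E"
  shows "k < r \<Longrightarrow> i < n k \<Longrightarrow> j < n k \<Longrightarrow> E k i j \<noteq> 0"
    "k < r \<Longrightarrow> i < n k \<Longrightarrow> j < n k \<Longrightarrow> l < r \<Longrightarrow> p < n l \<Longrightarrow> q < n l \<Longrightarrow>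
        E k i j * E l p q = (if k = l \<and> j = p then E k i q else 0)"
    "cspan {E k i j | k i j. k < r \<and> i < n k \<and> j < n k} = UNIV"
  using assms unfolding matrix_units_def by blast+

lemma sum_delta3:
  fixes r :: nat and n :: "nat \<Rightarrow> nat"
  assumes "k < r" "i < n k" "j < n k"
  shows "(\<Sum>k'<r. \<Sum>i'<n k'. \<Sum>j'<n k'. if k' = k \<and> i' = i \<and> j' = j then f k' i' j' else 0) =
    (f k i j :: 'a::comm_monoid_add)"
proof -
  have 1: "(\<Sum>j'<n k. if k = k \<and> i' = i \<and> j' = j then f k i' j' else 0) = (if i' = i then f k i j else 0)" for i'
    using assms by (cases "i' = i") auto
  have "(\<Sum>i'<n k'. \<Sum>j'<n k'. if k' = k \<and> i' = i \<and> j' = j then f k' i' j' else 0) =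
      (if k' = k then f k i j else 0)" for k'
  proof (cases "k' = k")
    case True
    show ?thesis unfolding True 1 using assms by simp
  qed simp
  then show ?thesis using assms by simp
qed

lemma finite_matrix_units: "finite {E k i j | k i j. k < (r :: nat) \<and> i < (n k :: nat) \<and> j < n k}"
proof -
  have "{E k i j | k i j. k < r \<and> i < n k \<and> j < n k} = (\<Union>k<r. \<Union>i<n k. \<Union>j<n k. {E k i j})" by auto
  then show ?thesis by simp
qed

lemma matrix_units_expand:
  assumes "matrix_units r n E"
  shows "\<exists>c. b = unit_sum r n E c"
proof -
  have "b \<in> cspan {E k i j | k i j. k < r \<and> i < n k \<and> j < n k}"
    using matrix_unitsD(3)[OF assms] by simp
  then show ?thesis
  proof (induction rule: complex_vector.span_induct_alt)
    case base
    show ?case by (rule exI[of _ "\<lambda>_ _ _. 0"]) simp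
  next
    case (step t x y)
    from step(1) obtain k i j where x: "x = E k i j" "k < r" "i < n k" "j < n k" by blast
    obtain c where c: "y = unit_sum r n E c" using step(2) by blast
    have "t *\<^sub>C x = (\<Sum>k'<r. \<Sum>i'<n k'. \<Sum>j'<n k'. if k' = k \<and> i' = i \<and> j' = j then t *\<^sub>C E k' i' j' else 0)"
      unfolding x(1) by (rule sum_delta3[where n = n, OF x(2-4), symmetric])
    also have "\<dots> = (\<Sum>k'<r. \<Sum>i'<n k'. \<Sum>j'<n k'. (if k' = k \<and> i' = i \<and> j' = j then t else 0) *\<^sub>C E k' i' j')"
      by (intro sum.cong refl) simp
    finally show ?case
      unfolding c by (intro exI[of _ "\<lambda>k' i' j'. (if k' = k \<and> i' = i \<and> j' = j then t else 0) + c k' i' j'"])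
        (simp only: scaleC_add_left sum.distrib)
  qed
qed

text \<open>Compression by two diagonal units isolates one coefficient. Hence coefficients are
  unique, which is what the definite description in \<open>block_trace\<close> requires.\<close>

lemma matrix_units_coeff:
  assumes "matrix_units r n E" and k: "k < r" "i < n k" "j < n k"
  shows "E k i i * (unit_sum r n E c) * E k j j = c k i j *\<^sub>C E k i j"
proof -
  have "E k i i * (unit_sum r n E c) * E k j j =
     (\<Sum>k'<r. \<Sum>i'<n k'. \<Sum>j'<n k'. c k' i' j' *\<^sub>C (E k i i * E k' i' j' * E k j j))"
    by (simp add: sum_distrib_left sum_distrib_right)
  also have "\<dots> = (\<Sum>k'<r. \<Sum>i'<n k'. \<Sum>j'<n k'. if k' = k \<and> i' = i \<and> j' = j then c k' i' j' *\<^sub>C E k' i' j' else 0)"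
    by (intro sum.cong refl) (use k in \<open>auto simp: matrix_unitsD(2)[OF assms(1)]\<close>)
  also have "\<dots> = c k i j *\<^sub>C E k i j" by (rule sum_delta3[where n = n, OF k])
  finally show ?thesis .
qed

lemma block_trace_sum:
  assumes "matrix_units r n E"
  shows "block_trace r n E (unit_sum r n E c) = (\<Sum>k<r. \<Sum>i<n k. c k i i)"
  unfolding block_trace_def
proof (rule the_equality)
  fix t assume "\<exists>d. (unit_sum r n E c) = unit_sum r n E d \<and>
      t = (\<Sum>k<r. \<Sum>i<n k. d k i i)"
  then obtain d where d: "(unit_sum r n E c) = unit_sum r n E d"
     "t = (\<Sum>k<r. \<Sum>i<n k. d k i i)" by blast
  have "c k i i = d k i i" if "k < r" "i < n k" for k i
    using matrix_units_coeff[OF assms that(1,2,2), of c] matrix_units_coeff[OF assms that(1,2,2), of d]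
      matrix_unitsD(1)[OF assms that(1,2,2)] unfolding d(1)
    by (simp add: complex_vector.scale_cancel_right)
  then show "t = (\<Sum>k<r. \<Sum>i<n k. c k i i)" by (simp add: d(2))
qed blast

lemma
  assumes mu: "matrix_units r n E"
  shows block_trace_add: "block_trace r n E (x + y) = block_trace r n E x + block_trace r n E y"
    and block_trace_scaleC: "block_trace r n E (t *\<^sub>C x) = t * block_trace r n E x"
proof -
  obtain c d where c: "x = unit_sum r n E c"
    and d: "y = unit_sum r n E d"
    using matrix_units_expand[OF mu, of x] matrix_units_expand[OF mu, of y] by blast
  have xy: "x + y = (\<Sum>k<r. \<Sum>i<n k. \<Sum>j<n k. (c k i j + d k i j) *\<^sub>C E k i j)"
    unfolding c d by (simp only: scaleC_add_left sum.distrib)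
  show "block_trace r n E (x + y) = block_trace r n E x + block_trace r n E y"
    unfolding xy block_trace_sum[OF mu] unfolding c d block_trace_sum[OF mu] by (simp add: sum.distrib)
  have tx: "t *\<^sub>C x = (\<Sum>k<r. \<Sum>i<n k. \<Sum>j<n k. (t * c k i j) *\<^sub>C E k i j)"
    unfolding c by (simp only: complex_vector.scale_sum_right scaleC_scaleC)
  show "block_trace r n E (t *\<^sub>C x) = t * block_trace r n E x"
    unfolding tx block_trace_sum[OF mu] unfolding c block_trace_sum[OF mu] by (simp add: sum_distrib_left)
qed

lemma block_trace_E:
  assumes mu: "matrix_units r n E" and k: "k < r" "i < n k" "j < n k"
  shows "block_trace r n E (E k i j) = (if i = j then 1 else 0)"
proof -
  define c where "c k' i' j' = (if k' = k \<and> i' = i \<and> j' = j then 1 else 0 :: complex)" for k' i' j'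
  have "E k i j = (\<Sum>k'<r. \<Sum>i'<n k'. \<Sum>j'<n k'. if k' = k \<and> i' = i \<and> j' = j then E k' i' j' else 0)"
    by (rule sum_delta3[where n = n, OF k, symmetric])
  also have "\<dots> = (\<Sum>k'<r. \<Sum>i'<n k'. \<Sum>j'<n k'. c k' i' j' *\<^sub>C E k' i' j')"
    unfolding c_def by (intro sum.cong refl) (simp add: scaleC_one)
  finally have eq: "E k i j = (\<Sum>k'<r. \<Sum>i'<n k'. \<Sum>j'<n k'. c k' i' j' *\<^sub>C E k' i' j')" .
  have "block_trace r n E (E k i j) = (\<Sum>k'<r. \<Sum>i'<n k'. c k' i' i')"
    by (subst eq) (rule block_trace_sum[OF mu])
  also have "\<dots> = (\<Sum>k'<r. if k' = k then (if i = j then 1 else 0) else 0)"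
  proof (intro sum.cong refl)
    fix k' show "(\<Sum>i'<n k'. c k' i' i') = (if k' = k then (if i = j then 1 else 0) else 0)"
      using k by (cases "k' = k"; cases "i = j") (auto simp: c_def intro: sum.neutral)
  qed
  also have "\<dots> = (if i = j then 1 else 0)" using k by simp
  finally show ?thesis .
qed

lemma block_trace_commute:
  assumes mu: "matrix_units r n E"
  shows "block_trace r n E (x * y) = block_trace r n E (y * x)"
proof -
  let ?T = "block_trace r n E"
  let ?S = "{E k i j | k i j. k < r \<and> i < n k \<and> j < n k}"
  note lin = block_trace_add[OF mu] block_trace_scaleC[OF mu]
  have z: "?T 0 = 0" using lin(2)[of 0 0] by simp
  have EE: "?T (x * y) = ?T (y * x)" if x: "x \<in> ?S" and y: "y \<in> ?S" for x y
  proof -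
    from x obtain k i j where x: "x = E k i j" "k < r" "i < n k" "j < n k" by blast
    from y obtain l p q where y: "y = E l p q" "l < r" "p < n l" "q < n l" by blast
    show ?thesis
      by (cases "k = l") (use x y in \<open>auto simp: matrix_unitsD(2)[OF mu] block_trace_E[OF mu] z\<close>)
  qed
  have Ey: "?T (x * y) = ?T (y * x)" if x: "x \<in> ?S" for x y
  proof -
    have "y \<in> cspan ?S" using matrix_unitsD(3)[OF mu] by simp
    then show ?thesis
    proof (induction rule: complex_vector.span_induct_alt)
      case (step c y y')
      then show ?case by (simp only: distrib_left distrib_right scaleC_mult_simps lin EE[OF x])
    qed (simp add: z)
  qed
  have "x \<in> cspan ?S" using matrix_unitsD(3)[OF mu] by simp
  then show ?thesis
  proof (induction rule: complex_vector.span_induct_alt)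
    case (step c x x')
    then show ?case by (simp only: distrib_left distrib_right scaleC_mult_simps lin Ey[OF step(1)])
  qed (simp add: z)
qed

section \<open>The GNS space\<close>

context finite_onb
begin

definition trace :: "('h \<Rightarrow>\<^sub>L 'h) \<Rightarrow> complex"
  where "trace T = (\<Sum>i<N. cinner (e i) (blinfun_apply T (e i)))"

lemma trace_commute:
  assumes "S \<in> bounded_ops" "T \<in> bounded_ops"
  shows "trace (S o\<^sub>L T) = trace (T o\<^sub>L S)"
proof -
  have *: "trace (S o\<^sub>L T) = (\<Sum>i<N. \<Sum>j<N. cinner (e i) (S (e j)) * cinner (e j) (T (e i)))"
    if "S \<in> bounded_ops" for S T
    unfolding trace_def
  proof (intro sum.cong refl)
    fix i
    have "S (T (e i)) = (\<Sum>j<N. cinner (e j) (T (e i)) *\<^sub>C S (e j))"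
      by (subst expand[of "T (e i)"]) (simp add: blinfun.sum_right op_scaleC that)
    then show "cinner (e i) ((S o\<^sub>L T) (e i)) = (\<Sum>j<N. cinner (e i) (S (e j)) * cinner (e j) (T (e i)))"
      by (simp add: cinner_sum_right cinner_scaleC_right mult.commute)
  qed
  show ?thesis unfolding *[OF assms(1)] *[OF assms(2)] by (subst sum.swap) (simp add: mult.commute)
qed

text \<open>The commutator \<open>Y\<close> of \<open>A\<close> with \<open>D = G\<^sup>2\<close> satisfies \<open>D Y = - Y D\<close>.  Hence
  \<open>Tr(Y\<^sup>* D Y) = - Tr(G Y\<^sup>* Y G)\<close>, and both traces are nonnegative.\<close>

lemma commutes_with_square_root:
  fixes A G G' :: "'h \<Rightarrow>\<^sub>L 'h"
  assumes G: "G \<in> bounded_ops" "adj G = G" "G o\<^sub>L G' = id_blinfun" and A: "A \<in> bounded_ops"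
    and comm: "A o\<^sub>L (G o\<^sub>L G o\<^sub>L G o\<^sub>L G) = (G o\<^sub>L G o\<^sub>L G o\<^sub>L G) o\<^sub>L A"
  shows "A o\<^sub>L (G o\<^sub>L G) = (G o\<^sub>L G) o\<^sub>L A"
proof -
  define Y where "Y = (A o\<^sub>L (G o\<^sub>L G)) - ((G o\<^sub>L G) o\<^sub>L A)"
  have Yb: "Y \<in> bounded_ops" unfolding Y_def using G A by auto
  have anti: "G (G (Y x)) = - Y (G (G x))" for x
  proof -
    have "A (G (G (G (G x)))) = G (G (G (G (A x))))"
      using arg_cong[OF comm, of "\<lambda>T. blinfun_apply T x"] by simp
    then show ?thesis by (simp add: Y_def blinfun.diff_left blinfun.diff_right)
  qed
  define Z where "Z = adj Y o\<^sub>L Y o\<^sub>L G"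
  have Zb: "Z \<in> bounded_ops" unfolding Z_def using Yb G by auto
  have 1: "trace (Z o\<^sub>L G) = - complex_of_real (\<Sum>i<N. (norm (G (Y (e i))))\<^sup>2)"
  proof -
    have "cinner (e i) ((Z o\<^sub>L G) (e i)) = - complex_of_real ((norm (G (Y (e i))))\<^sup>2)" for i
    proof -
      have "cinner (e i) ((Z o\<^sub>L G) (e i)) = cinner (Y (e i)) (Y (G (G (e i))))"
        by (simp add: Z_def cinner_adj_right Yb)
      also have "\<dots> = - cinner (Y (e i)) (G (G (Y (e i))))" by (simp add: anti)
      also have "\<dots> = - cinner (G (Y (e i))) (G (Y (e i)))"
        using cinner_adj_right[OF G(1), of "Y (e i)" "G (Y (e i))"] by (simp add: G(2))
      finally show ?thesis by (simp only: cinner_self)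
    qed
    then show ?thesis by (simp add: trace_def sum_negf)
  qed
  have 2: "trace (G o\<^sub>L Z) = complex_of_real (\<Sum>i<N. (norm (Y (G (e i))))\<^sup>2)"
  proof -
    have "cinner (e i) ((G o\<^sub>L Z) (e i)) = complex_of_real ((norm (Y (G (e i))))\<^sup>2)" for i
    proof -
      have "cinner (e i) ((G o\<^sub>L Z) (e i)) = cinner (G (e i)) (Z (e i))"
        using cinner_adj_right[OF G(1), of "e i" "Z (e i)"] by (simp add: G(2))
      also have "\<dots> = cinner (Y (G (e i))) (Y (G (e i)))" by (simp add: Z_def cinner_adj_right Yb)
      finally show ?thesis by (simp only: cinner_self)
    qed
    then show ?thesis by (simp add: trace_def)
  qed
  have "complex_of_real (\<Sum>i<N. (norm (Y (G (e i))))\<^sup>2) = complex_of_real (- (\<Sum>i<N. (norm (G (Y (e i))))\<^sup>2))"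
    using trace_commute[OF G(1) Zb] 1 2 by simp
  then have "(\<Sum>i<N. (norm (Y (G (e i))))\<^sup>2) = - (\<Sum>i<N. (norm (G (Y (e i))))\<^sup>2)"
    by (simp only: of_real_eq_iff)
  moreover have "(\<Sum>i<N. (norm (G (Y (e i))))\<^sup>2) \<ge> 0" "(\<Sum>i<N. (norm (Y (G (e i))))\<^sup>2) \<ge> 0"
    by (intro sum_nonneg; simp)+
  ultimately have "(\<Sum>i<N. (norm (Y (G (e i))))\<^sup>2) = 0" by linarith
  then have YG: "Y (G (e i)) = 0" if "i < N" for i
    using that by (subst (asm) sum_nonneg_eq_0_iff) auto
  have YG': "Y (G x) = 0" for x
    by (subst expand[of x]) (simp add: blinfun.sum_right op_scaleC G Yb YG)
  have "Y = 0"
  proof (rule blinfun_eqI)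
    fix x
    have "G (G' x) = x" using arg_cong[OF G(3), of "\<lambda>T. blinfun_apply T x"] by simp
    then show "Y x = blinfun_apply 0 x" using YG'[of "G' x"] by simp
  qed
  then show ?thesis by (simp add: Y_def)
qed

end

locale gns = finite_onb N e
  for N :: nat and e :: "nat \<Rightarrow> 'h::chilbert_space" +
  fixes r :: nat and n :: "nat \<Rightarrow> nat" and E :: "nat \<Rightarrow> nat \<Rightarrow> nat \<Rightarrow> 'b::cstar_algebra"
    and \<psi> :: "'b \<Rightarrow> complex" and Q :: 'b and \<Lambda> :: "'b \<Rightarrow> 'h"
  assumes matrix_units: "matrix_units r n E"
    and state: "faithful_state \<psi>"
    and Q: "positive_invertible Q"
    and \<psi>_trace: "\<psi> a = block_trace r n E (Q * a)"
    and gns_map: "gns_map \<psi> \<Lambda>"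
begin

lemma \<Lambda>_clinear: "clinear \<Lambda>" and \<Lambda>_bij: "bij \<Lambda>"
  and cinner_\<Lambda>: "cinner (\<Lambda> a) (\<Lambda> b) = \<psi> (star a * b)"
  using gns_map unfolding gns_map_def by auto

lemmas \<Lambda>_add = clinear_add[OF \<Lambda>_clinear]
  and \<Lambda>_diff = clinear_diff[OF \<Lambda>_clinear]
  and \<Lambda>_scaleC = clinear_scaleC[OF \<Lambda>_clinear]
  and \<Lambda>_sum = clinear_sum[OF \<Lambda>_clinear]
  and \<psi>_add = state_add[OF state]
  and \<psi>_scaleC = state_scaleC[OF state]
  and \<psi>_star = state_star[OF state]

lemma inv_\<Lambda> [simp]: "inv \<Lambda> (\<Lambda> a) = a" and \<Lambda>_inv [simp]: "\<Lambda> (inv \<Lambda> x) = x"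
  using \<Lambda>_bij by (auto simp: bij_is_inj surj_f_inv_f bij_is_surj)

lemma \<Lambda>_eq_iff: "\<Lambda> a = \<Lambda> b \<longleftrightarrow> a = b"
  by (metis inv_\<Lambda>)

lemma inv_\<Lambda>_add: "inv \<Lambda> (x + y) = inv \<Lambda> x + inv \<Lambda> y"
  by (metis \<Lambda>_add \<Lambda>_inv inv_\<Lambda>)

lemma inv_\<Lambda>_scaleC: "inv \<Lambda> (c *\<^sub>C x) = c *\<^sub>C inv \<Lambda> x"
  by (metis \<Lambda>_scaleC \<Lambda>_inv inv_\<Lambda>)

lemma ext_\<Lambda>: "(\<And>a. blinfun_apply S (\<Lambda> a) = blinfun_apply T (\<Lambda> a)) \<Longrightarrow> S = T"
  by (rule blinfun_eqI) (metis \<Lambda>_inv)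

lemma Blinfun_\<Lambda>_apply:
  assumes "\<And>a b. f (a + b) = f a + f b" "\<And>(t :: real) a. f (complex_of_real t *\<^sub>C a) = complex_of_real t *\<^sub>C f a"
  shows "blinfun_apply (Blinfun (\<lambda>x. \<Lambda> (f (inv \<Lambda> x)))) x = \<Lambda> (f (inv \<Lambda> x))"
  by (subst bounded_linear_Blinfun_apply[OF bounded_linear_fd])
    (auto intro!: linearI simp: inv_\<Lambda>_add assms \<Lambda>_add scaleR_scaleC inv_\<Lambda>_scaleC \<Lambda>_scaleC)

subsection \<open>Left multiplication\<close>

abbreviation lm :: "'b \<Rightarrow> 'h \<Rightarrow>\<^sub>L 'h" where "lm \<equiv> left_mult \<Lambda>"

lemma lm_apply: "blinfun_apply (lm a) x = \<Lambda> (a * inv \<Lambda> x)"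
  unfolding left_mult_def by (rule Blinfun_\<Lambda>_apply) (simp_all add: distrib_left)

lemma lm_\<Lambda> [simp]: "blinfun_apply (lm a) (\<Lambda> b) = \<Lambda> (a * b)"
  by (simp add: lm_apply)

lemma lm_bounded_ops [simp, intro]: "lm a \<in> bounded_ops"
  by (rule bounded_opsI) (simp add: lm_apply inv_\<Lambda>_scaleC \<Lambda>_scaleC)

lemma lm_one [simp]: "lm 1 = id_blinfun"
  by (rule ext_\<Lambda>) simp

lemma lm_add: "lm (a + b) = lm a + lm b"
  by (rule ext_\<Lambda>) (simp add: distrib_right \<Lambda>_add blinfun.add_left)

lemma lm_scaleC: "lm (c *\<^sub>C a) = c *\<^sub>C lm a"
  by (rule ext_\<Lambda>) (simp add: \<Lambda>_scaleC scaleC_blinfun.rep_eq)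

lemma lm_zero [simp]: "lm 0 = 0"
  using lm_scaleC[of 0 0] by simp

lemma lm_sum: "lm (\<Sum>i\<in>I. f i) = (\<Sum>i\<in>I. lm (f i))"
  by (induction I rule: infinite_finite_induct) (auto simp: lm_add)

lemma adj_lm: "adj (lm a) = lm (star a)"
proof (rule adj_unique)
  have "cinner (lm (star a) (\<Lambda> b)) (\<Lambda> c) = cinner (\<Lambda> b) (lm a (\<Lambda> c))" for b c
    by (simp add: cinner_\<Lambda> star_mult star_star mult.assoc)
  then show "cinner (lm (star a) y) x = cinner y (lm a x)" for x y by (metis \<Lambda>_inv)
qed simp

lemma lm_inj:
  assumes "lm a = lm b"
  shows "a = b"
proof -
  have "\<Lambda> (a * 1) = \<Lambda> (b * 1)"
    using arg_cong[OF assms, of "\<lambda>T. blinfun_apply T (\<Lambda> 1)"] unfolding lm_\<Lambda> .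
  then show ?thesis by (simp add: \<Lambda>_eq_iff)
qed

lemma inv_lm [simp]: "inv lm (lm a) = a"
  by (rule inv_f_f, rule injI, rule lm_inj)

definition be :: "nat \<Rightarrow> 'b" where "be i = inv \<Lambda> (e i)"

lemma \<Lambda>_be [simp]: "\<Lambda> (be i) = e i"
  by (simp add: be_def)

lemma expand_be: "a = (\<Sum>i<N. cinner (e i) (\<Lambda> a) *\<^sub>C be i)"
proof -
  have "\<Lambda> a = \<Lambda> (\<Sum>i<N. cinner (e i) (\<Lambda> a) *\<^sub>C be i)"
    using expand[of "\<Lambda> a"] by (simp add: \<Lambda>_sum \<Lambda>_scaleC)
  then show ?thesis by (simp only: \<Lambda>_eq_iff)
qed

subsection \<open>Multiplication and unit\<close>

lemma
  shows mult_op_bounded_ops [simp, intro]: "mult_op \<Lambda> \<in> bounded_ops"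
    and mult_op_apply: "blinfun_apply (mult_op \<Lambda>) (\<Lambda> a \<otimes>\<^sub>v \<Lambda> b) = \<Lambda> (a * b)"
proof -
  define X where "X = (\<Sum>i<N. lm (be i) o\<^sub>L adj (lket (e i)))"
  have X: "X \<in> bounded_ops" unfolding X_def by (auto intro!: bounded_ops_sum bounded_ops_compose)
  have Xa: "X (\<Lambda> a \<otimes>\<^sub>v \<Lambda> b) = \<Lambda> (a * b)" for a b
  proof -
    have "X (\<Lambda> a \<otimes>\<^sub>v \<Lambda> b) = \<Lambda> ((\<Sum>i<N. cinner (e i) (\<Lambda> a) *\<^sub>C be i) * b)"
      by (simp add: X_def blinfun.sum_left adj_lket_apply \<Lambda>_scaleC[symmetric] \<Lambda>_sum sum_distrib_right)
    then show ?thesis using expand_be[of a] by simp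
  qed
  have "mult_op \<Lambda> = X"
    unfolding mult_op_def
  proof (rule the_equality)
    fix Y assume Y: "Y \<in> bounded_ops \<and> (\<forall>a b. blinfun_apply Y (\<Lambda> a \<otimes>\<^sub>v \<Lambda> b) = \<Lambda> (a * b))"
    show "Y = X"
    proof (rule tensor_ext)
      fix x y show "Y (x \<otimes>\<^sub>v y) = X (x \<otimes>\<^sub>v y)"
        using Y Xa[of "inv \<Lambda> x" "inv \<Lambda> y"] by (metis \<Lambda>_inv)
    qed (use X Y in auto)
  qed (use X Xa in auto)
  then show "mult_op \<Lambda> \<in> bounded_ops" "blinfun_apply (mult_op \<Lambda>) (\<Lambda> a \<otimes>\<^sub>v \<Lambda> b) = \<Lambda> (a * b)"
    using X Xa by auto
qed

lemma unit_op_apply [simp]: "blinfun_apply (unit_op \<Lambda>) c = c *\<^sub>C \<Lambda> 1"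
  unfolding unit_op_def
  by (subst bounded_linear_Blinfun_apply, rule bounded_linear_intro[where K = "norm (\<Lambda> 1)"])
    (simp_all add: scaleC_add_left norm_scaleC scaleR_scaleC scaleC_scaleC scaleC_complex_def)

lemma unit_op_bounded_ops [simp, intro]: "unit_op \<Lambda> \<in> bounded_ops"
  by (rule bounded_opsI) (simp add: scaleC_scaleC scaleC_complex_def)

lemma adj_unit_op_apply: "blinfun_apply (adj (unit_op \<Lambda>)) x = cinner (\<Lambda> 1) x"
  by (rule cinner_eqI) (simp add: cinner_adj_right cinner_scaleC_left, simp add: cinner_complex_def)

subsection \<open>The modular group and the modular conjugation\<close>

definition Qpow :: "real \<Rightarrow> 'b" where "Qpow t = cstar_powr Q (complex_of_real t)"

lemma log_spec: "star (cstar_log Q) = cstar_log Q" "exp (cstar_log Q) = Q"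
  using cstar_log_spec[OF state finite_matrix_units matrix_unitsD(3)[OF matrix_units] Q] .

lemma star_Qpow [simp]: "star (Qpow t) = Qpow t"
  by (simp add: Qpow_def cstar_powr_def star_exp star_scaleC log_spec)

lemma Qpow_add: "Qpow s * Qpow t = Qpow (s + t)"
  unfolding Qpow_def cstar_powr_def
  by (subst exp_add_commuting[symmetric]) (simp_all add: scaleC_add_left scaleC_scaleC mult.commute)

lemma Qpow_0 [simp]: "Qpow 0 = 1" and Qpow_1: "Qpow 1 = Q"
  by (simp_all add: Qpow_def cstar_powr_def scaleC_one log_spec)

lemma Qpow_mult_left: "Qpow s * (Qpow t * a) = Qpow (s + t) * a"
  by (simp add: Qpow_add flip: mult.assoc)

text \<open>This is \<sigma> at the imaginary parameter \<i> s. The value s = 1/2 occurs in J, and s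
  = -1 in the KMS condition.\<close>

definition modular :: "real \<Rightarrow> 'b \<Rightarrow> 'b" where "modular s a = Qpow (- s) * a * Qpow s"

lemma modular_modular [simp]: "modular s (modular t a) = modular (s + t) a"
  unfolding modular_def by (simp add: mult.assoc Qpow_add Qpow_mult_left add.commute)

lemma modular_0 [simp]: "modular 0 a = a"
  by (simp add: modular_def)

lemma modular_mult: "modular s (a * b) = modular s a * modular s b"
  unfolding modular_def by (simp add: mult.assoc Qpow_mult_left)

lemma star_modular: "star (modular s a) = modular (- s) (star a)"
  unfolding modular_def by (simp add: star_mult mult.assoc)

lemma modular_add: "modular s (a + b) = modular s a + modular s b"
  by (simp add: modular_def algebra_simps)

lemma modular_scaleC: "modular s (c *\<^sub>C a) = c *\<^sub>C modular s a"
  by (simp add: modular_def)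

lemma \<psi>_trace_Qpow: "\<psi> a = block_trace r n E (Qpow 1 * a)"
  by (simp only: \<psi>_trace Qpow_1)

lemma \<psi>_modular [simp]: "\<psi> (modular s a) = \<psi> a"
proof -
  have "\<psi> (modular s a) = block_trace r n E ((Qpow 1 * Qpow (- s) * a) * Qpow s)"
    by (simp add: \<psi>_trace_Qpow modular_def mult.assoc)
  also have "\<dots> = block_trace r n E (Qpow s * (Qpow 1 * Qpow (- s) * a))" by (rule block_trace_commute[OF matrix_units])
  also have "\<dots> = \<psi> a" by (simp add: \<psi>_trace_Qpow Qpow_mult_left mult.assoc)
  finally show ?thesis .
qed

text \<open>The KMS condition: \<open>modular (- 1)\<close> corrects the failure of \<psi> to be a
  trace. It follows by moving factors cyclically under the block trace.\<close>

lemma \<psi>_commute: "\<psi> (a * b) = \<psi> (b * modular (- 1) a)"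
proof -
  have "\<psi> (a * b) = block_trace r n E ((Qpow 1 * a) * b)"
    by (simp add: \<psi>_trace_Qpow mult.assoc)
  also have "\<dots> = block_trace r n E (b * (Qpow 1 * a))" by (rule block_trace_commute[OF matrix_units])
  also have "\<dots> = block_trace r n E ((b * Qpow 1 * a * Qpow (- 1)) * Qpow 1)"
    by (simp add: mult.assoc Qpow_add)
  also have "\<dots> = block_trace r n E (Qpow 1 * (b * Qpow 1 * a * Qpow (- 1)))" by (rule block_trace_commute[OF matrix_units])
  also have "\<dots> = \<psi> (b * modular (- 1) a)" by (simp add: \<psi>_trace_Qpow modular_def mult.assoc)
  finally show ?thesis .
qed

text \<open>\<open>Dop (- 1)\<close> is the modular operator of \<psi>, and \<open>Dop s\<close> is
  its power with exponent -s.\<close>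

definition Dop :: "real \<Rightarrow> 'h \<Rightarrow>\<^sub>L 'h" where "Dop s = Blinfun (\<lambda>x. \<Lambda> (modular s (inv \<Lambda> x)))"

lemma Dop_apply: "blinfun_apply (Dop s) x = \<Lambda> (modular s (inv \<Lambda> x))"
  unfolding Dop_def by (rule Blinfun_\<Lambda>_apply) (simp_all add: modular_add modular_scaleC)

lemma Dop_\<Lambda> [simp]: "blinfun_apply (Dop s) (\<Lambda> a) = \<Lambda> (modular s a)"
  by (simp add: Dop_apply)

lemma Dop_bounded_ops [simp, intro]: "Dop s \<in> bounded_ops"
  by (rule bounded_opsI) (simp add: Dop_apply inv_\<Lambda>_scaleC modular_scaleC \<Lambda>_scaleC)

lemma Dop_compose: "Dop s o\<^sub>L Dop t = Dop (s + t)"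
  by (rule ext_\<Lambda>) simp

lemma Dop_0 [simp]: "Dop 0 = id_blinfun"
  by (rule ext_\<Lambda>) simp

lemma adj_Dop: "adj (Dop s) = Dop s"
proof (rule adj_unique)
  have "cinner (Dop s (\<Lambda> b)) (\<Lambda> a) = cinner (\<Lambda> b) (Dop s (\<Lambda> a))" for a b
    using \<psi>_modular[of s "star (modular s b) * a"] by (simp add: cinner_\<Lambda> star_modular modular_mult)
  then show "cinner (Dop s y) x = cinner y (Dop s x)" for x y by (metis \<Lambda>_inv)
qed simp

abbreviation J :: "'h \<Rightarrow>\<^sub>L 'h" where "J \<equiv> modular_conj \<Lambda> Q"

lemma modular_aut_modular: "modular_aut Q (\<i> / 2) a = modular (1/2) a"
  unfolding modular_aut_def modular_def Qpow_def by simp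

lemma J_\<Lambda>: "blinfun_apply J (\<Lambda> a) = \<Lambda> (star (modular (1/2) a))"
  unfolding modular_conj_def modular_aut_modular
  by (subst Blinfun_\<Lambda>_apply) (simp_all add: modular_add star_add modular_scaleC star_scaleC)

lemma J_J [simp]: "blinfun_apply J (blinfun_apply J x) = x"
proof -
  have "J (J (\<Lambda> a)) = \<Lambda> a" for a by (simp add: J_\<Lambda> star_modular star_star)
  then show ?thesis by (metis \<Lambda>_inv)
qed

lemma J_scaleC: "blinfun_apply J (c *\<^sub>C x) = cnj c *\<^sub>C blinfun_apply J x"
proof -
  have "J (c *\<^sub>C \<Lambda> a) = cnj c *\<^sub>C J (\<Lambda> a)" for a
    by (simp add: J_\<Lambda> modular_scaleC star_scaleC flip: \<Lambda>_scaleC)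
  then show ?thesis by (metis \<Lambda>_inv)
qed

text \<open>Applying the \<psi>-preserving automorphism with parameter -1/2 moves the whole twist
  onto one factor, where the KMS condition absorbs it.\<close>

lemma cinner_J_J: "cinner (blinfun_apply J x) (blinfun_apply J y) = cinner y x"
proof -
  have "cinner (J (\<Lambda> a)) (J (\<Lambda> b)) = cinner (\<Lambda> b) (\<Lambda> a)" for a b
  proof -
    have "cinner (J (\<Lambda> a)) (J (\<Lambda> b)) = \<psi> (modular (1/2) a * modular (- (1/2)) (star b))"
      by (simp add: J_\<Lambda> cinner_\<Lambda> star_star star_modular)
    also have "\<dots> = \<psi> (modular (- (1/2)) (modular (1/2) a * modular (- (1/2)) (star b)))" by (rule \<psi>_modular[symmetric])
    also have "\<dots> = \<psi> (a * modular (- 1) (star b))" by (simp add: modular_mult)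
    also have "\<dots> = cinner (\<Lambda> b) (\<Lambda> a)" by (simp add: cinner_\<Lambda> \<psi>_commute[of "star b" a])
    finally show ?thesis .
  qed
  then show ?thesis by (metis \<Lambda>_inv)
qed

lemma cinner_J_left: "cinner (blinfun_apply J x) y = cinner (blinfun_apply J y) x"
  using cinner_J_J[of x "J y"] by simp

lemma cinner_J_right: "cinner x (blinfun_apply J y) = cinner y (blinfun_apply J x)"
  using cinner_J_J[of "J x" y] by simp

abbreviation \<kappa> :: "('h \<Rightarrow>\<^sub>L 'h) \<Rightarrow> ('h \<Rightarrow>\<^sub>L 'h)" where "\<kappa> \<equiv> kappa \<Lambda> Q"

lemma kappa_apply: "blinfun_apply (\<kappa> x) v = blinfun_apply J (blinfun_apply (adj x) (blinfun_apply J v))"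
  by (simp add: kappa_def)

lemma kappa_bounded_ops [simp, intro]: "x \<in> bounded_ops \<Longrightarrow> \<kappa> x \<in> bounded_ops"
  by (rule bounded_opsI) (simp add: kappa_apply J_scaleC op_scaleC)

lemma adj_kappa: "x \<in> bounded_ops \<Longrightarrow> adj (\<kappa> x) = \<kappa> (adj x)"
proof (rule adj_unique)
  fix u v assume x: "x \<in> bounded_ops"
  show "cinner (\<kappa> (adj x) u) v = cinner u (\<kappa> x v)"
    using x cinner_J_left[of "x (J u)" v] cinner_J_right[of u "adj x (J v)"]
    by (simp add: kappa_apply cinner_adj_left)
qed auto

lemma kappa_kappa [simp]: "x \<in> bounded_ops \<Longrightarrow> \<kappa> (\<kappa> x) = x"
  by (rule blinfun_eqI) (simp add: kappa_apply adj_kappa)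

lemma kappa_add: "x \<in> bounded_ops \<Longrightarrow> y \<in> bounded_ops \<Longrightarrow> \<kappa> (x + y) = \<kappa> x + \<kappa> y"
  by (rule blinfun_eqI) (simp add: kappa_apply adj_add blinfun.add_left blinfun.add_right)

lemma kappa_scaleC: "x \<in> bounded_ops \<Longrightarrow> \<kappa> (c *\<^sub>C x) = c *\<^sub>C \<kappa> x"
  by (rule blinfun_eqI) (simp add: kappa_apply adj_scaleC scaleC_blinfun.rep_eq J_scaleC)

lemma kappa_zero [simp]: "\<kappa> 0 = 0"
  by (rule blinfun_eqI) (simp add: kappa_apply)

lemma kappa_compose:
  assumes "x \<in> bounded_ops" "y \<in> bounded_ops"
  shows "\<kappa> (x o\<^sub>L y) = \<kappa> y o\<^sub>L \<kappa> x"
  by (rule blinfun_eqI) (simp add: kappa_apply adj_compose assms)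

text \<open>An operator commuting with all left multiplications is right multiplication by the
  element it assigns to 1, and conjugation by J turns right multiplications into left ones.\<close>

lemma kappa_commutant:
  assumes x: "x \<in> commutant (range lm)"
  shows "\<exists>b. \<kappa> x = lm b"
proof -
  have xb: "x \<in> bounded_ops" and comm: "x o\<^sub>L lm a = lm a o\<^sub>L x" for a
    using x unfolding commutant_def by auto
  have acomm: "adj x o\<^sub>L lm a = lm a o\<^sub>L adj x" for a
    using arg_cong[OF comm[of "star a"], of adj] xb by (simp add: adj_compose adj_lm star_star)
  define c where "c = inv \<Lambda> (adj x (\<Lambda> 1))"
  have xa: "adj x (\<Lambda> a) = \<Lambda> (a * c)" for a
    using arg_cong[OF acomm[of a], of "\<lambda>T. blinfun_apply T (\<Lambda> 1)"] by (simp add: lm_apply c_def)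
  have "\<kappa> x = lm (star (modular (1/2) c))"
    by (rule ext_\<Lambda>) (simp add: kappa_apply J_\<Lambda> xa modular_mult star_mult star_modular star_star)
  then show ?thesis by blast
qed

lemma kappa_lm: "\<kappa> (lm b) \<in> commutant (range lm)"
proof -
  have "\<kappa> (lm b) (\<Lambda> a) = \<Lambda> (a * star (modular (1/2) (star b)))" for a
    by (simp add: kappa_apply adj_lm J_\<Lambda> modular_mult star_mult star_modular star_star)
  then have "\<kappa> (lm b) o\<^sub>L lm c = lm c o\<^sub>L \<kappa> (lm b)" for c
    by (intro ext_\<Lambda>) (simp add: mult.assoc)
  then show ?thesis unfolding commutant_def by auto
qed

end

section \<open>Quantum adjacency matrices\<close>

context gns
begin

lemma mult_op_lket: "mult_op \<Lambda> o\<^sub>L lket (\<Lambda> a) = lm a"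
  by (rule ext_\<Lambda>) (simp add: mult_op_apply)

lemma adj_lket_adj_mult_op: "adj (lket (\<Lambda> b)) o\<^sub>L adj (mult_op \<Lambda>) = lm (star b)"
  by (simp add: adj_compose[symmetric] mult_op_lket adj_lm)

lemma mult_op_lm_tensor: "mult_op \<Lambda> o\<^sub>L (lm a \<otimes>\<^sub>o id_blinfun) = lm a o\<^sub>L mult_op \<Lambda>"
proof (rule tensor_ext)
  fix x y
  show "(mult_op \<Lambda> o\<^sub>L (lm a \<otimes>\<^sub>o id_blinfun)) (x \<otimes>\<^sub>v y) = (lm a o\<^sub>L mult_op \<Lambda>) (x \<otimes>\<^sub>v y)"
    using mult_op_apply[of "inv \<Lambda> x" "inv \<Lambda> y"] mult_op_apply[of "a * inv \<Lambda> x" "inv \<Lambda> y"]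
    by (simp add: tensor_op_apply lm_apply mult.assoc)
qed auto

lemma lm_tensor_adj_mult_op: "(lm a \<otimes>\<^sub>o id_blinfun) o\<^sub>L adj (mult_op \<Lambda>) = adj (mult_op \<Lambda>) o\<^sub>L lm a"
proof -
  have "adj (mult_op \<Lambda> o\<^sub>L (lm (star a) \<otimes>\<^sub>o id_blinfun)) = adj (lm (star a) o\<^sub>L mult_op \<Lambda>)"
    by (simp only: mult_op_lm_tensor)
  then show ?thesis by (simp add: adj_compose adj_tensor_op adj_lm star_star)
qed

text \<open>These are the second legs of adj m at \<Lambda>(1). In the non-tracial case they need
  not be orthonormal.\<close>

definition sv :: "nat \<Rightarrow> 'h" where "sv l = \<Lambda> (star (be l))"

lemma adj_mult_op_unit: "blinfun_apply (adj (mult_op \<Lambda>)) (\<Lambda> 1) = (\<Sum>i<N. e i \<otimes>\<^sub>v sv i)"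
proof (rule tensor_vec_eqI)
  fix x y
  define a b where "a = inv \<Lambda> x" and "b = inv \<Lambda> y"
  have xy: "x = \<Lambda> a" "y = \<Lambda> b" by (simp_all add: a_def b_def)
  have "cinner (x \<otimes>\<^sub>v y) (\<Sum>i<N. e i \<otimes>\<^sub>v sv i) = (\<Sum>i<N. cinner x (e i) * cinner y (sv i))"
    by (simp add: cinner_sum_right cinner_tensor_vec)
  also have "\<dots> = cinner y (\<Lambda> (star (\<Sum>i<N. cinner (e i) x *\<^sub>C be i)))"
    by (simp add: star_sum star_scaleC \<Lambda>_sum \<Lambda>_scaleC cinner_sum_right cinner_scaleC_right sv_def
        flip: cinner_commute)
  also have "\<dots> = cinner (x \<otimes>\<^sub>v y) (adj (mult_op \<Lambda>) (\<Lambda> 1))"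
    unfolding xy expand_be[symmetric] by (simp add: cinner_adj_right mult_op_apply cinner_\<Lambda> star_mult)
  finally show "cinner (x \<otimes>\<^sub>v y) (adj (mult_op \<Lambda>) (\<Lambda> 1)) = cinner (x \<otimes>\<^sub>v y) (\<Sum>i<N. e i \<otimes>\<^sub>v sv i)" ..
qed

text \<open>The basis dual to \<open>sv\<close>: by the KMS condition the pairing of
  \<open>sv l\<close> with \<open>cv m\<close> is \<psi>(star e_m * e_l).\<close>

definition cv :: "nat \<Rightarrow> 'h" where "cv m = \<Lambda> (modular (- 1) (star (be m)))"

lemma cinner_sv_cv: "l < N \<Longrightarrow> m < N \<Longrightarrow> cinner (sv l) (cv m) = (if l = m then 1 else 0)"
  using onb[of m l] unfolding sv_def cv_def cinner_\<Lambda> star_star \<psi>_commute[symmetric]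
  by (auto simp flip: cinner_\<Lambda>)

lemma expand_cv: "x = (\<Sum>l<N. cinner (sv l) x *\<^sub>C cv l)"
proof -
  \<comment> \<open>Chosen so that x is \<Lambda> of \<open>modular (- 1) (star a)\<close>; the
    expansion of a in the orthonormal basis then becomes one of x in \<open>cv\<close>.\<close>
  define a where "a = star (modular 1 (inv \<Lambda> x))"
  define k where "k l = cnj (cinner (e l) (\<Lambda> a))" for l
  have "x = \<Lambda> (modular (- 1) (star a))" by (simp add: a_def star_star)
  also have "\<dots> = \<Lambda> (modular (- 1) (star (\<Sum>l<N. cinner (e l) (\<Lambda> a) *\<^sub>C be l)))" by (simp flip: expand_be)
  also have "\<dots> = (\<Sum>l<N. k l *\<^sub>C cv l)"
    by (simp add: k_def cv_def star_sum star_scaleC modular_def sum_distrib_left sum_distrib_right \<Lambda>_sum \<Lambda>_scaleC)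
  finally have x: "x = (\<Sum>l<N. k l *\<^sub>C cv l)" .
  have "cinner (sv m) x = k m" if "m < N" for m
    unfolding x cinner_sum_right cinner_scaleC_right using that by (simp add: cinner_sv_cv if_distrib cong: if_cong)
  then show ?thesis using x by simp
qed

subsection \<open>The operators on \<open>L\<^sup>2(B)\<close> as a Hilbert space\<close>

text \<open>The operators \<open>\<bar>e\<^sub>k\<rangle>\<langle>e\<^sub>l\<^sup>*\<bar>\<close> form an orthonormal basis for the inner product that makes
  \<open>\<bar>\<Lambda>(a)\<rangle>\<langle>\<Lambda>(b)\<bar> \<mapsto> \<Lambda>(a) \<otimes> \<Lambda>(b\<^sup>*)\<close> unitary.  For this inner product the coaction on operators becomes a
  unitary corepresentation.\<close>

definition op_unit :: "nat \<Rightarrow> nat \<Rightarrow> 'h \<Rightarrow>\<^sub>L 'h" where "op_unit k l = ketbra (e k) (sv l)"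

text \<open>Evaluation at the dual vector \<open>cv m\<close> singles out the coordinate belonging
  to \<open>op_unit i m\<close>.\<close>

definition op_coeff :: "('h \<Rightarrow>\<^sub>L 'h) \<Rightarrow> nat \<Rightarrow> nat \<Rightarrow> complex"
  where "op_coeff x i m = cinner (e i) (blinfun_apply x (cv m))"

definition ip :: "('h \<Rightarrow>\<^sub>L 'h) \<Rightarrow> ('h \<Rightarrow>\<^sub>L 'h) \<Rightarrow> complex"
  where "ip y x = (\<Sum>i<N. \<Sum>m<N. cnj (op_coeff y i m) * op_coeff x i m)"

lemma op_unit_bounded [simp, intro]: "op_unit k l \<in> bounded_ops"
  by (simp add: op_unit_def)

lemma op_coeff_op_unit: "i < N \<Longrightarrow> m < N \<Longrightarrow> k < N \<Longrightarrow> l < N \<Longrightarrow> op_coeff (op_unit k l) i m = (if i = k \<and> m = l then 1 else 0)"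
  by (auto simp: op_coeff_def op_unit_def cinner_scaleC_right cinner_sv_cv onb)

lemma op_coeff_diff: "op_coeff (x - y) i m = op_coeff x i m - op_coeff y i m"
  by (simp add: op_coeff_def blinfun.diff_left cinner_diff_right)

lemma op_coeff_scaleC: "op_coeff (c *\<^sub>C x) i m = c * op_coeff x i m"
  by (simp add: op_coeff_def scaleC_blinfun.rep_eq cinner_scaleC_right)

lemma op_coeff_sum: "op_coeff (\<Sum>j\<in>I. x j) i m = (\<Sum>j\<in>I. op_coeff (x j) i m)"
  by (simp add: op_coeff_def blinfun.sum_left cinner_sum_right)

lemma expand_op_unit:
  assumes "y \<in> bounded_ops"
  shows "y = (\<Sum>k<N. \<Sum>l<N. op_coeff y k l *\<^sub>C op_unit k l)"
proof (rule blinfun_eqI)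
  fix x
  have "y x = (\<Sum>l<N. cinner (sv l) x *\<^sub>C y (cv l))"
    by (subst expand_cv[of x]) (simp add: blinfun.sum_right op_scaleC assms)
  also have "\<dots> = (\<Sum>l<N. \<Sum>k<N. op_coeff y k l *\<^sub>C cinner (sv l) x *\<^sub>C e k)"
    by (intro sum.cong refl, subst (1) expand[of "y (cv _)"])
      (simp add: complex_vector.scale_sum_right scaleC_scaleC mult.commute op_coeff_def)
  also have "\<dots> = (\<Sum>k<N. \<Sum>l<N. op_coeff y k l *\<^sub>C cinner (sv l) x *\<^sub>C e k)" by (rule sum.swap)
  finally show "y x = (\<Sum>k<N. \<Sum>l<N. op_coeff y k l *\<^sub>C op_unit k l) x"
    by (simp add: blinfun.sum_left scaleC_blinfun.rep_eq op_unit_def)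
qed

lemma cnj_ip: "cnj (ip y x) = ip x y"
  by (simp add: ip_def mult.commute)

lemma ip_diff_left: "ip (y - z) x = ip y x - ip z x"
  by (simp add: ip_def op_coeff_diff left_diff_distrib sum_subtractf)

lemma ip_diff_right: "ip y (x - z) = ip y x - ip y z"
  by (simp add: ip_def op_coeff_diff right_diff_distrib sum_subtractf)

end

locale quantum_graph = gns N e r n E \<psi> Q \<Lambda>
  for N :: nat and e :: "nat \<Rightarrow> 'h::chilbert_space" and r :: nat and n :: "nat \<Rightarrow> nat"
    and E :: "nat \<Rightarrow> nat \<Rightarrow> nat \<Rightarrow> 'b::cstar_algebra"
    and \<psi> :: "'b \<Rightarrow> complex" and Q :: 'b and \<Lambda> :: "'b \<Rightarrow> 'h" +
  fixes A :: "'h \<Rightarrow>\<^sub>L 'h"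
  assumes A_bounded [simp, intro]: "A \<in> bounded_ops" and A_adj [simp]: "adj A = A"
    and A_idem: "mult_op \<Lambda> o\<^sub>L (A \<otimes>\<^sub>o A) o\<^sub>L adj (mult_op \<Lambda>) = A"
    and A_undirected: "right_unitor o\<^sub>L (id_blinfun \<otimes>\<^sub>o (adj (unit_op \<Lambda>) o\<^sub>L mult_op \<Lambda>))
           o\<^sub>L (id_blinfun \<otimes>\<^sub>o A \<otimes>\<^sub>o id_blinfun) o\<^sub>L tensor_assoc
           o\<^sub>L ((adj (mult_op \<Lambda>) o\<^sub>L unit_op \<Lambda>) \<otimes>\<^sub>o id_blinfun) o\<^sub>L adj left_unitor = A"
begin

subsection \<open>Self-adjointness and the modular conjugation\<close>

definition Ao :: "'b \<Rightarrow> 'b" where "Ao a = inv \<Lambda> (blinfun_apply A (\<Lambda> a))"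

lemma A_\<Lambda>: "blinfun_apply A (\<Lambda> a) = \<Lambda> (Ao a)"
  by (simp add: Ao_def)

lemma Ao_sum_scaleC: "Ao (\<Sum>i\<in>I. c i *\<^sub>C a i) = (\<Sum>i\<in>I. c i *\<^sub>C Ao (a i))"
proof -
  have "\<Lambda> (Ao (\<Sum>i\<in>I. c i *\<^sub>C a i)) = \<Lambda> (\<Sum>i\<in>I. c i *\<^sub>C Ao (a i))"
    by (simp add: A_\<Lambda>[symmetric] \<Lambda>_sum \<Lambda>_scaleC blinfun.sum_right op_scaleC)
  then show ?thesis by (simp only: \<Lambda>_eq_iff)
qed

lemma A_self_adjoint: "cinner (blinfun_apply A x) y = cinner x (blinfun_apply A y)"
  using cinner_adj_left[OF A_bounded, of x y] by simp

text \<open>The undirectedness condition says that A x is the sum over j of \<psi>(Ao (star e_j) *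
  x) e_j, with x read as an element of B. Pairing with e_i and moving A across by self-adjointness
  identifies \<open>Ao\<close> at e_i with the star of \<open>Ao\<close> at star e_i.\<close>

lemma Ao_star: "Ao (star a) = star (Ao a)"
proof -
  have base: "Ao (star (be i)) = star (Ao (be i))" if i: "i < N" for i
  proof -
    have eq: "A x = (\<Sum>j<N. cinner (\<Lambda> 1) (mult_op \<Lambda> (A (sv j) \<otimes>\<^sub>v x)) *\<^sub>C e j)" for x
    proof -
      have "A x = (right_unitor o\<^sub>L (id_blinfun \<otimes>\<^sub>o (adj (unit_op \<Lambda>) o\<^sub>L mult_op \<Lambda>))
           o\<^sub>L (id_blinfun \<otimes>\<^sub>o A \<otimes>\<^sub>o id_blinfun) o\<^sub>L tensor_assoc
           o\<^sub>L ((adj (mult_op \<Lambda>) o\<^sub>L unit_op \<Lambda>) \<otimes>\<^sub>o id_blinfun) o\<^sub>L adj left_unitor) x"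
        by (simp only: A_undirected)
      also have "\<dots> = (\<Sum>j<N. cinner (\<Lambda> 1) (mult_op \<Lambda> (A (sv j) \<otimes>\<^sub>v x)) *\<^sub>C e j)"
        by (simp add: left_unitor_eq right_unitor_eq tensor_op_apply scaleC_one adj_mult_op_unit
            tensor_vec_sum_left blinfun.sum_right adj_rket_apply adj_unit_op_apply cinner_complex_def)
      finally show ?thesis .
    qed
    have "cinner (A (e i)) (\<Lambda> b) = cinner (\<Lambda> (star (Ao (star (be i))))) (\<Lambda> b)" for b
    proof -
      have "cinner (A (e i)) (\<Lambda> b) = cinner (e i) (A (\<Lambda> b))" by (rule A_self_adjoint)
      also have "\<dots> = cinner (\<Lambda> 1) (mult_op \<Lambda> (A (sv i) \<otimes>\<^sub>v \<Lambda> b))"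
        unfolding eq[of "\<Lambda> b"] cinner_sum_right cinner_scaleC_right
        using i by (simp add: onb if_distrib cong: if_cong)
      also have "\<dots> = cinner (\<Lambda> (star (Ao (star (be i))))) (\<Lambda> b)"
        by (simp add: sv_def A_\<Lambda> mult_op_apply cinner_\<Lambda> star_star)
      finally show ?thesis .
    qed
    then have "cinner x (A (e i)) = cinner x (\<Lambda> (star (Ao (star (be i)))))" for x
      by (metis cinner_commute \<Lambda>_inv)
    then have "A (e i) = \<Lambda> (star (Ao (star (be i))))" by (rule cinner_eqI)
    then have "Ao (be i) = star (Ao (star (be i)))"
      using A_\<Lambda>[of "be i"] by (simp add: \<Lambda>_eq_iff)
    then show ?thesis by (simp add: star_star)
  qed
  have "star a = (\<Sum>i<N. cnj (cinner (e i) (\<Lambda> a)) *\<^sub>C star (be i))"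
    by (subst expand_be) (simp add: star_sum star_scaleC)
  then have "Ao (star a) = (\<Sum>i<N. cnj (cinner (e i) (\<Lambda> a)) *\<^sub>C star (Ao (be i)))"
    by (simp add: Ao_sum_scaleC base)
  also have "\<dots> = star (Ao (\<Sum>i<N. cinner (e i) (\<Lambda> a) *\<^sub>C be i))"
    by (simp add: Ao_sum_scaleC star_sum star_scaleC)
  finally show ?thesis by (simp flip: expand_be)
qed

text \<open>Both sides equal \<open>\<psi> (Ao x * y)\<close>: the left one because A is
  self-adjoint and preserves the star, the right one by KMS and invariance of \<psi>. This symmetry
  later yields the self-adjointness of Schur multiplication.\<close>

lemma A_flip:
  "cinner (\<Lambda> (star x)) (blinfun_apply A (\<Lambda> y)) = cinner (\<Lambda> (modular (- 1) (star y))) (blinfun_apply A (\<Lambda> x))"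
proof -
  have "cinner (\<Lambda> (star x)) (A (\<Lambda> y)) = \<psi> (Ao x * y)"
    by (simp add: A_self_adjoint[symmetric]) (simp add: A_\<Lambda> Ao_star cinner_\<Lambda> star_star)
  also have "\<dots> = \<psi> (modular 1 (y * modular (- 1) (Ao x)))" by (simp add: \<psi>_commute[of "Ao x"])
  also have "\<dots> = cinner (\<Lambda> (modular (- 1) (star y))) (A (\<Lambda> x))"
    by (simp only: modular_mult) (simp add: A_\<Lambda> cinner_\<Lambda> star_modular star_star)
  finally show ?thesis .
qed

text \<open>The pairing of \<Lambda>(star x) with A \<Lambda>(y) is computed in two ways: by KMS the
  modular operator lands on \<Lambda>(x), by \<open>A_flip\<close> it lands on \<Lambda>(star
  y).\<close>

lemma A_Dop_minus_1: "A o\<^sub>L Dop (- 1) = Dop (- 1) o\<^sub>L A"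
proof (rule ext_\<Lambda>, rule cinner_eqI)
  fix x and z :: 'h
  define y where "y = star (inv \<Lambda> z)"
  have z: "z = \<Lambda> (star y)" by (simp add: y_def star_star)
  have "cinner (\<Lambda> (star x)) (A (\<Lambda> y)) = \<psi> (Ao y * modular (- 1) x)"
    by (simp add: A_\<Lambda> cinner_\<Lambda> star_star \<psi>_commute[of x])
  also have "\<dots> = cinner (A z) (Dop (- 1) (\<Lambda> x))"
    by (simp add: z A_\<Lambda> Ao_star cinner_\<Lambda> star_star)
  also have "\<dots> = cinner z (A (Dop (- 1) (\<Lambda> x)))" by (rule A_self_adjoint)
  finally have 1: "cinner (\<Lambda> (star x)) (A (\<Lambda> y)) = cinner z (A (Dop (- 1) (\<Lambda> x)))" .
  have "cinner (\<Lambda> (star x)) (A (\<Lambda> y)) = cinner (Dop (- 1) z) (A (\<Lambda> x))"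
    by (simp add: A_flip z)
  also have "\<dots> = cinner z (Dop (- 1) (A (\<Lambda> x)))"
    using cinner_adj_left[OF Dop_bounded_ops[of "- 1"], of z "A (\<Lambda> x)"] by (simp add: adj_Dop)
  finally show "cinner z ((A o\<^sub>L Dop (- 1)) (\<Lambda> x)) = cinner z ((Dop (- 1) o\<^sub>L A) (\<Lambda> x))"
    using 1 by simp
qed

lemma Ao_modular_half: "Ao (modular (1/2) a) = modular (1/2) (Ao a)"
proof -
  \<comment> \<open>The argument about square roots needs \<open>Dop (- 1/2)\<close> as the square
    of an invertible self-adjoint operator, hence a fourth root of the modular operator.\<close>
  let ?G = "Dop (- 1/4)"
  have "A o\<^sub>L (?G o\<^sub>L ?G) = (?G o\<^sub>L ?G) o\<^sub>L A"
    by (rule commutes_with_square_root[where G' = "Dop (1/4)"])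
      (simp_all add: adj_Dop Dop_compose A_Dop_minus_1)
  then have *: "A o\<^sub>L Dop (- 1/2) = Dop (- 1/2) o\<^sub>L A" by (simp add: Dop_compose)
  have "modular (- 1/2) (Ao (modular (1/2) a)) = Ao a"
    using arg_cong[OF *, of "\<lambda>T. blinfun_apply T (\<Lambda> (modular (1/2) a))"] by (simp add: A_\<Lambda> \<Lambda>_eq_iff)
  then have "modular (1/2) (modular (- 1/2) (Ao (modular (1/2) a))) = modular (1/2) (Ao a)" by (rule arg_cong)
  then show ?thesis by simp
qed

lemma kappa_A: "\<kappa> A = A"
proof (rule ext_\<Lambda>)
  fix a
  have "J (A (J (\<Lambda> a))) = J (J (A (\<Lambda> a)))"
    by (simp only: J_\<Lambda> A_\<Lambda> Ao_star Ao_modular_half)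
  then show "\<kappa> A (\<Lambda> a) = A (\<Lambda> a)" by (simp add: kappa_apply)
qed

section \<open>The bimodule over B generated by A, and its relation to the one over the
  commutant\<close>

definition BAB :: "('h \<Rightarrow>\<^sub>L 'h) set"
  where "BAB = cspan {lm a o\<^sub>L A o\<^sub>L lm b | a b. True}"

lemma BAB_base: "lm a o\<^sub>L A o\<^sub>L lm b \<in> BAB"
  unfolding BAB_def by (rule complex_vector.span_base) blast

lemma A_in_BAB: "A \<in> BAB"
  using BAB_base[of 1 1] by simp

lemma BAB_subset: "BAB \<subseteq> bounded_ops"
  unfolding BAB_def by (rule complex_vector.span_minimal) (auto simp: csubspace_bounded_ops)

lemma csubspace_BAB: "csubspace BAB"
  unfolding BAB_def by (rule complex_vector.subspace_span)

lemma commutant_bounded: "x \<in> commutant X \<Longrightarrow> x \<in> bounded_ops"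
  by (simp add: commutant_def)

lemma commutant_bimodule_subset: "commutant_bimodule \<Lambda> A \<subseteq> bounded_ops"
  unfolding commutant_bimodule_def
  by (rule complex_vector.span_minimal) (auto simp: csubspace_bounded_ops commutant_bounded)

lemma kappa_commutant_bimodule: "\<kappa> ` commutant_bimodule \<Lambda> A = BAB"
proof -
  have 1: "\<kappa> x \<in> BAB" if "x \<in> commutant_bimodule \<Lambda> A" for x
  proof -
    \<comment> \<open>Boundedness is carried through the induction because additivity and
      homogeneity of \<kappa> are available for members of \<open>bounded_ops\<close>.\<close>
    have "x \<in> bounded_ops \<and> \<kappa> x \<in> BAB"
      using that unfolding commutant_bimodule_def
    proof (induction rule: complex_vector.span_induct_alt)
      case base
      then show ?case by (simp add: complex_vector.subspace_0[OF csubspace_BAB])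
    next
      case (step c x y)
      then obtain u v where x: "x = u o\<^sub>L A o\<^sub>L v" and uv: "u \<in> commutant (range lm)" "v \<in> commutant (range lm)"
        by blast
      have b: "u \<in> bounded_ops" "v \<in> bounded_ops" using uv commutant_bounded by auto
      obtain a b where "\<kappa> u = lm a" "\<kappa> v = lm b" using kappa_commutant uv by metis
      then have "\<kappa> x = lm b o\<^sub>L A o\<^sub>L lm a"
        unfolding x using b by (simp add: kappa_compose kappa_A op_compose_assoc)
      then have "\<kappa> x \<in> BAB" using BAB_base by simp
      moreover have "x \<in> bounded_ops" unfolding x using b by auto
      ultimately show ?case
        using step(2) by (auto simp: kappa_add kappa_scaleC
          intro!: complex_vector.subspace_add[OF csubspace_BAB] complex_vector.subspace_scale[OF csubspace_BAB])
    qed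
    then show ?thesis ..
  qed
  have sub: "csubspace (commutant_bimodule \<Lambda> A)"
    unfolding commutant_bimodule_def by (rule complex_vector.subspace_span)
  have 2: "\<kappa> x \<in> commutant_bimodule \<Lambda> A" if "x \<in> BAB" for x
  proof -
    have "x \<in> bounded_ops \<and> \<kappa> x \<in> commutant_bimodule \<Lambda> A"
      using that unfolding BAB_def
    proof (induction rule: complex_vector.span_induct_alt)
      case base
      then show ?case by (simp add: complex_vector.subspace_0[OF sub])
    next
      case (step c x y)
      then obtain a b where x: "x = lm a o\<^sub>L A o\<^sub>L lm b" by blast
      have "\<kappa> x = \<kappa> (lm b) o\<^sub>L A o\<^sub>L \<kappa> (lm a)"
        unfolding x by (simp add: kappa_compose kappa_A op_compose_assoc)
      then have "\<kappa> x \<in> commutant_bimodule \<Lambda> A"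
        unfolding commutant_bimodule_def using kappa_lm by (auto intro: complex_vector.span_base)
      moreover have "x \<in> bounded_ops" unfolding x by auto
      ultimately show ?case
        using step(2) by (auto simp: kappa_add kappa_scaleC
          intro!: complex_vector.subspace_add[OF sub] complex_vector.subspace_scale[OF sub])
    qed
    then show ?thesis ..
  qed
  show ?thesis
  proof
    show "BAB \<subseteq> \<kappa> ` commutant_bimodule \<Lambda> A"
    proof
      fix x assume x: "x \<in> BAB"
      then have "x = \<kappa> (\<kappa> x)" using BAB_subset by (simp add: subset_iff)
      then show "x \<in> \<kappa> ` commutant_bimodule \<Lambda> A" using 2[OF x] by (rule image_eqI)
    qed
  qed (use 1 in blast)
qed

subsection \<open>The orthogonal projection onto the bimodule\<close>

text \<open>Schur multiplication by \<open>A\<close> is the orthogonal projection onto \<open>B A B\<close>, and it maps the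
  unit \<open>\<bar>\<Lambda>(1)\<rangle>\<langle>\<Lambda>(1)\<bar>\<close> of the Schur product to \<open>A\<close>.\<close>

definition schur :: "('h \<Rightarrow>\<^sub>L 'h) \<Rightarrow> ('h \<Rightarrow>\<^sub>L 'h)"
  where "schur y = mult_op \<Lambda> o\<^sub>L (y \<otimes>\<^sub>o A) o\<^sub>L adj (mult_op \<Lambda>)"

lemma schur_add: "y \<in> bounded_ops \<Longrightarrow> z \<in> bounded_ops \<Longrightarrow> schur (y + z) = schur y + schur z"
  by (simp add: schur_def tensor_op_add_left compose_add_left compose_add_right)

lemma schur_scaleC: "y \<in> bounded_ops \<Longrightarrow> schur (c *\<^sub>C y) = c *\<^sub>C schur y"
  by (simp add: schur_def tensor_op_scaleC_left compose_scaleC_left compose_scaleC_right)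

lemma schur_zero [simp]: "schur 0 = 0"
  by (simp add: schur_def)

lemma schur_sum: "(\<And>i. i \<in> I \<Longrightarrow> y i \<in> bounded_ops) \<Longrightarrow> schur (\<Sum>i\<in>I. y i) = (\<Sum>i\<in>I. schur (y i))"
  by (induction I rule: infinite_finite_induct) (auto simp: schur_add)

text \<open>Since m with its first leg fixed is a left multiplication, rank-one operators go to
  generators of \<open>BAB\<close>. This gives the range of \<open>schur\<close> and its value at
  \<open>omega\<close> at once.\<close>

lemma schur_ketbra: "schur (ketbra (\<Lambda> a) (\<Lambda> b)) = lm a o\<^sub>L A o\<^sub>L lm (star b)"
  by (simp add: schur_def ketbra_tensor op_compose_assoc adj_lket_adj_mult_op)
    (simp add: mult_op_lket flip: op_compose_assoc)

text \<open>By associativity m intertwines left multiplication on the first leg with left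
  multiplication, and adj m does the same. So \<open>schur\<close> fixes all of \<open>BAB\<close>
  as soon as it fixes A, and that is the idempotency condition.\<close>

lemma schur_bimodule:
  assumes "y \<in> bounded_ops"
  shows "schur (lm a o\<^sub>L y o\<^sub>L lm b) = lm a o\<^sub>L schur y o\<^sub>L lm b"
proof -
  have "(lm a o\<^sub>L y o\<^sub>L lm b) \<otimes>\<^sub>o A = (lm a \<otimes>\<^sub>o id_blinfun) o\<^sub>L (y \<otimes>\<^sub>o A) o\<^sub>L (lm b \<otimes>\<^sub>o id_blinfun)"
    using assms by (simp add: tensor_op_compose)
  then have "schur (lm a o\<^sub>L y o\<^sub>L lm b) =
      (mult_op \<Lambda> o\<^sub>L (lm a \<otimes>\<^sub>o id_blinfun)) o\<^sub>L (y \<otimes>\<^sub>o A) o\<^sub>L ((lm b \<otimes>\<^sub>o id_blinfun) o\<^sub>L adj (mult_op \<Lambda>))"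
    by (simp add: schur_def op_compose_assoc)
  also have "\<dots> = lm a o\<^sub>L schur y o\<^sub>L lm b"
    unfolding mult_op_lm_tensor lm_tensor_adj_mult_op by (simp add: schur_def op_compose_assoc)
  finally show ?thesis .
qed

lemma schur_A: "schur A = A"
  by (simp add: schur_def A_idem)

lemma schur_BAB: "x \<in> BAB \<Longrightarrow> schur x = x"
proof -
  assume "x \<in> BAB"
  then have "x \<in> bounded_ops \<and> schur x = x" unfolding BAB_def
  proof (induction rule: complex_vector.span_induct_alt)
    case (step c x y)
    then obtain a b where "x = lm a o\<^sub>L A o\<^sub>L lm b" by blast
    then have "x \<in> bounded_ops" "schur x = x" by (auto simp: schur_bimodule schur_A)
    then show ?case using step(2) by (simp add: schur_add schur_scaleC)
  qed simp
  then show ?thesis ..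
qed

lemma schur_in_BAB:
  assumes "y \<in> bounded_ops"
  shows "schur y \<in> BAB"
proof -
  have "schur y = (\<Sum>i<N. \<Sum>j<N. cinner (e i) (y (e j)) *\<^sub>C schur (ketbra (e i) (e j)))"
    by (subst op_eq_sum_ketbra[OF assms]) (simp add: schur_sum schur_scaleC)
  moreover have "schur (ketbra (e i) (e j)) \<in> BAB" for i j
    using BAB_base[of "be i" "star (be j)"] schur_ketbra[of "be i" "be j"] by simp
  ultimately show ?thesis
    by (simp add: complex_vector.subspace_sum[OF csubspace_BAB] complex_vector.subspace_scale[OF csubspace_BAB])
qed

abbreviation omega :: "'h \<Rightarrow>\<^sub>L 'h" where "omega \<equiv> ketbra (\<Lambda> 1) (\<Lambda> 1)"

lemma schur_omega: "schur omega = A"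
  by (simp add: schur_ketbra)

lemma schur_op_unit: "schur (op_unit k l) = lm (be k) o\<^sub>L A o\<^sub>L lm (be l)"
  using schur_ketbra[of "be k" "star (be l)"] by (simp add: op_unit_def sv_def star_star)

text \<open>The matrix of \<open>schur\<close> in the orthonormal \<open>op_unit\<close> is
  Hermitian. After rewriting, this is \<open>A_flip\<close> for the products \<open>x\<close> and
  \<open>y\<close>; \<open>y\<close> is built so that \<open>modular (- 1) (star y)\<close> has the
  same shape with l and m exchanged.\<close>

lemma op_coeff_schur_op_unit: "op_coeff (schur (op_unit k l)) i m = cnj (op_coeff (schur (op_unit i m)) k l)"
proof -
  define x where "x = star (be i) * be k"
  define y where "y = be l * modular (- 1) (star (be m))"
  define y' where "y' = be m * modular (- 1) (star (be l))"
  have y': "modular (- 1) (star y) = y'" by (simp add: y_def y'_def star_mult modular_mult star_modular star_star)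
  have "op_coeff (schur (op_unit k l)) i m = cinner (\<Lambda> (be i)) (\<Lambda> (be k * Ao y))"
    by (simp add: op_coeff_def schur_op_unit cv_def A_\<Lambda> y_def)
  also have "\<dots> = cinner (\<Lambda> (star x)) (A (\<Lambda> y))"
    by (simp only: cinner_\<Lambda> A_\<Lambda> x_def star_mult star_star mult.assoc)
  also have "\<dots> = cinner (\<Lambda> y') (A (\<Lambda> x))" by (simp only: A_flip y')
  also have "\<dots> = cinner (\<Lambda> (be i * Ao y')) (\<Lambda> (be k))"
    by (subst A_self_adjoint[symmetric]) (simp only: A_\<Lambda> cinner_\<Lambda> x_def star_mult mult.assoc)
  also have "\<dots> = cnj (cinner (\<Lambda> (be k)) (\<Lambda> (be i * Ao y')))" by (rule cinner_commute)
  also have "cinner (\<Lambda> (be k)) (\<Lambda> (be i * Ao y')) = op_coeff (schur (op_unit i m)) k l"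
    by (simp add: op_coeff_def schur_op_unit cv_def A_\<Lambda> y'_def)
  finally show ?thesis .
qed

lemma ip_schur:
  assumes y: "y \<in> bounded_ops" and z: "z \<in> bounded_ops"
  shows "ip y (schur z) = ip (schur y) z"
proof -
  have Eco: "op_coeff (schur z) i m = (\<Sum>k<N. \<Sum>l<N. op_coeff z k l * op_coeff (schur (op_unit k l)) i m)" if "z \<in> bounded_ops" for z i m
  proof -
    have "schur z = (\<Sum>k<N. \<Sum>l<N. op_coeff z k l *\<^sub>C schur (op_unit k l))"
      by (subst expand_op_unit[OF that]) (simp add: schur_sum schur_scaleC)
    then show ?thesis by (simp add: op_coeff_sum op_coeff_scaleC)
  qed
  have "ip y (schur z) = (\<Sum>i<N. \<Sum>m<N. \<Sum>k<N. \<Sum>l<N. cnj (op_coeff y i m) * op_coeff z k l * op_coeff (schur (op_unit k l)) i m)"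
    unfolding ip_def Eco[OF z] by (simp add: sum_distrib_left mult.assoc)
  also have "\<dots> = (\<Sum>(i,m,k,l)\<in>{..<N}\<times>{..<N}\<times>{..<N}\<times>{..<N}. cnj (op_coeff y i m) * op_coeff z k l * op_coeff (schur (op_unit k l)) i m)"
    by (simp add: sum.cartesian_product)
  also have "\<dots> = (\<Sum>(k,l,i,m)\<in>{..<N}\<times>{..<N}\<times>{..<N}\<times>{..<N}. cnj (op_coeff y i m) * op_coeff z k l * op_coeff (schur (op_unit k l)) i m)"
    by (rule sum.reindex_bij_witness[where i = "\<lambda>(k,l,i,m). (i,m,k,l)" and j = "\<lambda>(i,m,k,l). (k,l,i,m)"]) auto
  also have "\<dots> = (\<Sum>k<N. \<Sum>l<N. \<Sum>i<N. \<Sum>m<N. cnj (op_coeff y i m) * op_coeff z k l * op_coeff (schur (op_unit k l)) i m)"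
    by (simp add: sum.cartesian_product)
  also have "\<dots> = ip (schur y) z"
    unfolding ip_def Eco[OF y] by (simp add: sum_distrib_left sum_distrib_right op_coeff_schur_op_unit[symmetric] ac_simps)
  finally show ?thesis .
qed

text \<open>The projection of \<open>omega\<close> onto the bimodule is A, so the two have the same
  inner products with members of the bimodule.\<close>

lemma ip_BAB_omega: "x \<in> BAB \<Longrightarrow> ip x omega = ip x A"
  using ip_schur[of x omega] BAB_subset by (auto simp: schur_BAB schur_omega)

end

section \<open>Tensor products of operator spaces\<close>

lemma tensor_space_induct:
  assumes X: "X \<in> S \<otimes>\<^sub>s T"
    and "closed {X. P X}" "P 0" "\<And>x y. P x \<Longrightarrow> P y \<Longrightarrow> P (x + y)" "\<And>c x. P x \<Longrightarrow> P (c *\<^sub>C x)"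
    and gen: "\<And>s t. s \<in> S \<Longrightarrow> t \<in> T \<Longrightarrow> P (s \<otimes>\<^sub>o t)"
  shows "P X"
proof -
  have "cspan {s \<otimes>\<^sub>o t | s t. s \<in> S \<and> t \<in> T} \<subseteq> {X. P X}"
    by (rule complex_vector.span_minimal) (auto intro!: complex_vector.subspaceI assms)
  then have "S \<otimes>\<^sub>s T \<subseteq> {X. P X}"
    unfolding tensor_space_def using assms(2) by (rule closure_minimal)
  then show ?thesis using X by blast
qed

lemma tensor_space_span: "X \<in> cspan {s \<otimes>\<^sub>o t | s t. s \<in> S \<and> t \<in> T} \<Longrightarrow> X \<in> S \<otimes>\<^sub>s T"
  unfolding tensor_space_def by (rule subsetD[OF closure_subset])

lemma tensor_space_base: "s \<in> S \<Longrightarrow> t \<in> T \<Longrightarrow> s \<otimes>\<^sub>o t \<in> S \<otimes>\<^sub>s T"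
  by (rule tensor_space_span, rule complex_vector.span_base) blast

lemma closed_tensor_space: "closed (S \<otimes>\<^sub>s T)"
  unfolding tensor_space_def by (rule closed_closure)

lemma csubspace_closure:
  assumes "csubspace X"
  shows "csubspace (closure X)"
proof (rule complex_vector.subspaceI)
  show "0 \<in> closure X" using complex_vector.subspace_0[OF assms] closure_subset by blast
next
  fix x y assume "x \<in> closure X" "y \<in> closure X"
  then obtain f g where "\<And>n. f n \<in> X" "f \<longlonglongrightarrow> x" "\<And>n. g n \<in> X" "g \<longlonglongrightarrow> y"
    unfolding closure_sequential by blast
  then show "x + y \<in> closure X"
    unfolding closure_sequential
    by (intro exI[of _ "\<lambda>n. f n + g n"] conjI allI complex_vector.subspace_add[OF assms] tendsto_add)
next
  fix c x assume "x \<in> closure X"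
  then obtain f where "\<And>n. f n \<in> X" "f \<longlonglongrightarrow> x" unfolding closure_sequential by blast
  then show "c *\<^sub>C x \<in> closure X"
    unfolding closure_sequential
    by (intro exI[of _ "\<lambda>n. c *\<^sub>C f n"] conjI allI complex_vector.subspace_scale[OF assms]
        bounded_linear.tendsto[OF bounded_linear_scaleC])
qed

lemma csubspace_tensor_space: "csubspace (S \<otimes>\<^sub>s T)"
  unfolding tensor_space_def by (rule csubspace_closure) (rule complex_vector.subspace_span)

lemmas tensor_space_add = complex_vector.subspace_add[OF csubspace_tensor_space]
  and tensor_space_scaleC = complex_vector.subspace_scale[OF csubspace_tensor_space]
  and tensor_space_zero [simp] = complex_vector.subspace_0[OF csubspace_tensor_space]
  and tensor_space_sum = complex_vector.subspace_sum[OF csubspace_tensor_space]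

lemma tensor_space_bounded:
  assumes "X \<in> S \<otimes>\<^sub>s T" "S \<subseteq> bounded_ops" "T \<subseteq> bounded_ops"
  shows "X \<in> bounded_ops"
  using assms(1)
proof (rule tensor_space_induct)
  show "closed {X :: ('a, 'b) htensor \<Rightarrow>\<^sub>L ('a, 'b) htensor. X \<in> bounded_ops}" by (simp add: closed_bounded_ops)
qed (use assms in auto)

lemma tensor_space_mono: "S \<subseteq> S' \<Longrightarrow> T \<subseteq> T' \<Longrightarrow> S \<otimes>\<^sub>s T \<subseteq> S' \<otimes>\<^sub>s T'"
  unfolding tensor_space_def by (intro closure_mono complex_vector.span_mono) blast

lemma continuous_on_scaleC [continuous_intros]:
  "continuous_on Z f \<Longrightarrow> continuous_on Z (\<lambda>x. c *\<^sub>C (f x :: 'a::complex_normed_vector))"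
  by (rule bounded_linear.continuous_on[OF bounded_linear_scaleC])

text \<open>For elementary tensors the slice is a multiple of the second leg, and closedness of T
  extends this to limits. It is how coefficients are seen to lie in the algebra of the quantum
  group.\<close>

lemma slice_in_subspace:
  assumes X: "X \<in> S \<otimes>\<^sub>s T" and T: "csubspace T" "closed T" "T \<subseteq> bounded_ops" and S: "S \<subseteq> bounded_ops"
  shows "slice a X c \<in> T"
  using X
proof (rule tensor_space_induct)
  have "closed ((\<lambda>X. slice a X c) -` T)"
    by (rule closed_vimage[OF T(2)]) (intro continuous_intros)
  then show "closed {X. slice a X c \<in> T}" by (simp add: vimage_def)
  fix s t assume st: "s \<in> S" "t \<in> T"
  then have "slice a (s \<otimes>\<^sub>o t) c = cinner a (s c) *\<^sub>C t"
    using S T by (intro blinfun_eqI) (auto simp: tensor_op_apply adj_lket_apply scaleC_blinfun.rep_eq subset_iff)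
  then show "slice a (s \<otimes>\<^sub>o t) c \<in> T"
    using complex_vector.subspace_scale[OF T(1)] st by simp
qed (use T in \<open>auto simp: compose_add_left compose_add_right compose_scaleC_left compose_scaleC_right
    intro: complex_vector.subspace_add complex_vector.subspace_scale complex_vector.subspace_0\<close>)

lemma slice_tensor:
  "s \<in> bounded_ops \<Longrightarrow> t \<in> bounded_ops \<Longrightarrow> slice a (s \<otimes>\<^sub>o t) c = cinner a (blinfun_apply s c) *\<^sub>C t"
  by (rule blinfun_eqI) (simp add: tensor_op_apply adj_lket_apply scaleC_blinfun.rep_eq)

section \<open>Continuous linear lifts from tensor products of operator spaces\<close>

lemma
  assumes "\<exists>F. clinear_on (S \<otimes>\<^sub>s T) F \<and> continuous_on (S \<otimes>\<^sub>s T) F \<and> (\<forall>s\<in>S. \<forall>t\<in>T. F (s \<otimes>\<^sub>o t) = p s t)"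
  shows tensor_lift_clinear: "clinear_on (S \<otimes>\<^sub>s T) (tensor_lift S T p)"
    and tensor_lift_continuous: "continuous_on (S \<otimes>\<^sub>s T) (tensor_lift S T p)"
    and tensor_lift_tensor: "s \<in> S \<Longrightarrow> t \<in> T \<Longrightarrow> tensor_lift S T p (s \<otimes>\<^sub>o t) = p s t"
  using someI_ex[OF assms] unfolding tensor_lift_def by auto

lemma tensor_lift_sum:
  assumes "\<exists>F. clinear_on (S \<otimes>\<^sub>s T) F \<and> continuous_on (S \<otimes>\<^sub>s T) F \<and> (\<forall>s\<in>S. \<forall>t\<in>T. F (s \<otimes>\<^sub>o t) = p s t)"
    and "\<And>i. i \<in> I \<Longrightarrow> s i \<in> S" "\<And>i. i \<in> I \<Longrightarrow> t i \<in> T"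
  shows "tensor_lift S T p (\<Sum>i\<in>I. s i \<otimes>\<^sub>o t i) = (\<Sum>i\<in>I. p (s i) (t i))"
  using assms(2,3) tensor_lift_tensor[OF assms(1)]
  by (simp add: clinear_on_sum[OF csubspace_tensor_space tensor_lift_clinear[OF assms(1)]] tensor_space_base)

text \<open>The last hypothesis holds when the functionals \<open>x \<mapsto> \<langle>a i, x (c i)\<rangle>\<close> are dual to a
  basis \<open>s i\<close> of \<open>S\<close>.\<close>

lemma ex_tensor_lift:
  fixes s :: "'i \<Rightarrow> 'h::chilbert_space \<Rightarrow>\<^sub>L 'h" and p :: "('h \<Rightarrow>\<^sub>L 'h) \<Rightarrow> ('k::chilbert_space \<Rightarrow>\<^sub>L 'k) \<Rightarrow> 'c::complex_normed_vector"
  assumes T: "csubspace T" "closed T" "T \<subseteq> bounded_ops" and S: "S \<subseteq> bounded_ops"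
    and s: "\<And>i. i \<in> I \<Longrightarrow> s i \<in> S"
    and p: "\<And>i. i \<in> I \<Longrightarrow> clinear_on T (p (s i))" "\<And>i. i \<in> I \<Longrightarrow> continuous_on T (p (s i))"
    and expand: "\<And>x t. x \<in> S \<Longrightarrow> t \<in> T \<Longrightarrow> p x t = (\<Sum>i\<in>I. cinner (a i) (blinfun_apply x (c i)) *\<^sub>C p (s i) t)"
  shows "\<exists>F. clinear_on (S \<otimes>\<^sub>s T) F \<and> continuous_on (S \<otimes>\<^sub>s T) F \<and> (\<forall>s\<in>S. \<forall>t\<in>T. F (s \<otimes>\<^sub>o t) = p s t)"
proof -
  define sl where "sl i X = slice (a i) X (c i)" for i and X :: "('h, 'k) htensor \<Rightarrow>\<^sub>L ('h, 'k) htensor"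
  \<comment> \<open>When the functionals are dual to a basis \<open>s i\<close>, the slices are the
    coefficients of X in that basis, and this is the only value a lift can take.\<close>
  define F where "F X = (\<Sum>i\<in>I. p (s i) (sl i X))" for X
  have sl: "sl i X \<in> T" if "X \<in> S \<otimes>\<^sub>s T" for X i
    unfolding sl_def using slice_in_subspace[OF that T S] .
  have lin: "sl i (X + Y) = sl i X + sl i Y" "sl i (k *\<^sub>C X) = k *\<^sub>C sl i X" for i X Y k
    by (simp_all add: sl_def compose_add_left compose_add_right compose_scaleC_left compose_scaleC_right)
  show ?thesis
  proof (intro exI conjI ballI)
    show "clinear_on (S \<otimes>\<^sub>s T) F"
      using p(1) sl unfolding clinear_on_def F_def lin
      by (simp add: sum.distrib complex_vector.scale_sum_right)
    show "continuous_on (S \<otimes>\<^sub>s T) F"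
      unfolding F_def
    proof (rule continuous_on_sum, rule continuous_on_compose2[OF p(2)])
      show "continuous_on (S \<otimes>\<^sub>s T) (sl i)" for i
        unfolding sl_def by (intro continuous_intros)
    qed (use sl in auto)
    fix x t assume xt: "x \<in> S" "t \<in> T"
    then have "sl i (x \<otimes>\<^sub>o t) = cinner (a i) (x (c i)) *\<^sub>C t" for i
      unfolding sl_def using S T by (intro slice_tensor) auto
    then have "F (x \<otimes>\<^sub>o t) = (\<Sum>i\<in>I. cinner (a i) (x (c i)) *\<^sub>C p (s i) t)"
      unfolding F_def using p(1) xt unfolding clinear_on_def by simp
    then show "F (x \<otimes>\<^sub>o t) = p x t" using expand xt by simp
  qed
qed

section \<open>Coactions\<close>

lemma sum_div_mod: "(\<Sum>K<N * N. f (K div N) (K mod N)) = (\<Sum>i<N. \<Sum>j<N. f i (j :: nat))"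
proof -
  have "(\<Sum>K<N * N. f (K div N) (K mod N)) = (\<Sum>(i,j)\<in>{..<N}\<times>{..<N}. f i j)"
  proof (rule sum.reindex_bij_witness[where i = "\<lambda>(i,j). i * N + j" and j = "\<lambda>K. (K div N, K mod N)"])
    fix p assume "p \<in> {..<N} \<times> {..<N}"
    then obtain i j where p: "p = (i, j)" "i < N" "j < N" by auto
    have "i * N + j < (i + 1) * N" using p by simp
    also have "\<dots> \<le> N * N" using p by (intro mult_right_mono) auto
    finally show "(case p of (i, j) \<Rightarrow> i * N + j) \<in> {..<N * N}" using p by simp
    show "((case p of (i, j) \<Rightarrow> i * N + j) div N, (case p of (i, j) \<Rightarrow> i * N + j) mod N) = p"
      using p by simp
  next
    fix K assume "K \<in> {..<N * N}"
    then have "K < N * N" "N > 0" by (cases "N = 0"; simp)+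
    then show "(K div N, K mod N) \<in> {..<N} \<times> {..<N}" by (simp add: less_mult_imp_div_less)
  qed auto
  then show ?thesis by (simp add: sum.cartesian_product)
qed

text \<open>The matrix with entries S u_ij is a left inverse of u, and the adjoint matrix is a right
  inverse; the two therefore agree.\<close>

lemma antipode_unitary:
  assumes S: "is_antipode \<A> \<Delta> S" and u: "unitary_corepresentation \<A> \<Delta> n u"
    and ub: "\<And>i j. i < n \<Longrightarrow> j < n \<Longrightarrow> u i j \<in> bounded_ops" and ij: "i < n" "l < n"
  shows "S (u i l) = adj (u l i)"
proof -
  have 1: "(\<Sum>k<n. S (u i k) o\<^sub>L u k j) = (if i = j then id_blinfun else 0)" if "j < n" for j
    using S u ij that unfolding is_antipode_def by blast
  have 2: "(\<Sum>j<n. u k j o\<^sub>L adj (u l j)) = (if k = l then id_blinfun else 0)" if "k < n" for k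
    using u ij that unfolding unitary_corepresentation_def by blast
  have "adj (u l i) = (\<Sum>j<n. (if i = j then id_blinfun else 0) o\<^sub>L adj (u l j))"
    using ij by (simp add: if_distrib[where f = "\<lambda>x. x o\<^sub>L _"] cong: if_cong)
  also have "\<dots> = (\<Sum>j<n. (\<Sum>k<n. S (u i k) o\<^sub>L u k j) o\<^sub>L adj (u l j))"
    by (intro sum.cong refl) (simp add: 1)
  also have "\<dots> = (\<Sum>k<n. S (u i k) o\<^sub>L (\<Sum>j<n. u k j o\<^sub>L adj (u l j)))"
    by (simp add: compose_sum_left compose_sum_right op_compose_assoc, rule sum.swap)
  also have "\<dots> = (\<Sum>k<n. S (u i k) o\<^sub>L (if k = l then id_blinfun else 0))"
    by (intro sum.cong refl) (simp add: 2)
  also have "\<dots> = S (u i l)"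
    using ij by (simp add: if_distrib cong: if_cong)
  finally show ?thesis ..
qed

text \<open>The antipode maps \<open>u\<^sub>i\<^sub>j\<close> to \<open>u\<^sub>j\<^sub>i\<^sup>*\<close>, so it turns \<open>\<langle>c, u d\<rangle> = 0\<close> into \<open>\<langle>d, u c\<rangle> = 0\<close>.  Hence the
  orthogonal complement of an invariant subspace is invariant.\<close>

lemma invariant_complement:
  assumes S: "is_antipode \<A> \<Delta> S" and u: "unitary_corepresentation \<A> \<Delta> n u"
    and ub: "\<And>i j. i < n \<Longrightarrow> j < n \<Longrightarrow> u i j \<in> bounded_ops"
    and z: "(\<Sum>i<n. \<Sum>j<n. (cnj (c i) * d j) *\<^sub>C u i j) = 0"
  shows "(\<Sum>i<n. \<Sum>j<n. (cnj (d i) * c j) *\<^sub>C u i j) = 0"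
proof -
  have mem: "u i j \<in> hopf_algebra \<A> \<Delta>" if "i < n" "j < n" for i j
    unfolding hopf_algebra_def using u that by (intro complex_vector.span_base) blast
  have sub: "csubspace (hopf_algebra \<A> \<Delta>)"
    unfolding hopf_algebra_def by (rule complex_vector.subspace_span)
  have lin: "clinear_on (hopf_algebra \<A> \<Delta>) S" using S unfolding is_antipode_def by blast
  have sc: "S (k *\<^sub>C u i j) = k *\<^sub>C adj (u j i)" if "i < n" "j < n" for i j k
    using lin mem[OF that] antipode_unitary[OF S u ub that] unfolding clinear_on_def by simp
  have "S (\<Sum>i<n. \<Sum>j<n. (cnj (c i) * d j) *\<^sub>C u i j) = (\<Sum>i<n. S (\<Sum>j<n. (cnj (c i) * d j) *\<^sub>C u i j))"
    by (rule clinear_on_sum[OF sub lin])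
      (auto intro!: complex_vector.subspace_sum[OF sub] complex_vector.subspace_scale[OF sub] mem)
  also have "\<dots> = (\<Sum>i<n. \<Sum>j<n. S ((cnj (c i) * d j) *\<^sub>C u i j))"
    by (intro sum.cong refl clinear_on_sum[OF sub lin])
      (auto intro!: complex_vector.subspace_scale[OF sub] mem)
  also have "\<dots> = (\<Sum>i<n. \<Sum>j<n. (cnj (c i) * d j) *\<^sub>C adj (u j i))"
    by (intro sum.cong refl) (simp add: sc)
  finally have "(\<Sum>i<n. \<Sum>j<n. (cnj (c i) * d j) *\<^sub>C adj (u j i)) = 0"
    using z clinear_on_diff[OF sub lin, of 0 0] complex_vector.subspace_0[OF sub] by simp
  then have "0 = adj (\<Sum>i<n. \<Sum>j<n. (cnj (c i) * d j) *\<^sub>C adj (u j i))" by simp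
  also have "\<dots> = (\<Sum>i<n. adj (\<Sum>j<n. (cnj (c i) * d j) *\<^sub>C adj (u j i)))"
    by (rule adj_sum) (auto intro!: bounded_ops_sum bounded_ops_scaleC ub)
  also have "\<dots> = (\<Sum>i<n. \<Sum>j<n. adj ((cnj (c i) * d j) *\<^sub>C adj (u j i)))"
    by (intro sum.cong refl adj_sum) (auto intro!: bounded_ops_scaleC ub)
  also have "\<dots> = (\<Sum>i<n. \<Sum>j<n. (c i * cnj (d j)) *\<^sub>C u j i)"
    by (intro sum.cong refl) (simp add: adj_scaleC ub)
  finally have "(\<Sum>i<n. \<Sum>j<n. (c i * cnj (d j)) *\<^sub>C u j i) = 0" ..
  then show ?thesis by (subst sum.swap) (simp add: mult.commute)
qed

locale quantum_graph_coaction = quantum_graph N e r n E \<psi> Q \<Lambda> A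
  for N :: nat and e :: "nat \<Rightarrow> 'h::chilbert_space" and r :: nat and n :: "nat \<Rightarrow> nat"
    and E :: "nat \<Rightarrow> nat \<Rightarrow> nat \<Rightarrow> 'b::cstar_algebra"
    and \<psi> :: "'b \<Rightarrow> complex" and Q :: 'b and \<Lambda> :: "'b \<Rightarrow> 'h" and A :: "'h \<Rightarrow>\<^sub>L 'h" +
  fixes \<A> :: "('k::chilbert_space \<Rightarrow>\<^sub>L 'k) set"
    and \<Delta> :: "('k \<Rightarrow>\<^sub>L 'k) \<Rightarrow> (('k, 'k) htensor \<Rightarrow>\<^sub>L ('k, 'k) htensor)"
    and R :: "('k \<Rightarrow>\<^sub>L 'k) \<Rightarrow> ('k \<Rightarrow>\<^sub>L 'k)"
    and \<alpha> :: "'b \<Rightarrow> (('h, 'k) htensor \<Rightarrow>\<^sub>L ('h, 'k) htensor)"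
    and U :: "('h, 'k) htensor \<Rightarrow>\<^sub>L ('h, 'k) htensor"
  assumes cqg: "compact_quantum_group \<A> \<Delta>" and antipode: "unitary_antipode \<A> \<Delta> R"
    and coact: "coaction \<A> \<Delta> \<Lambda> \<alpha>" and impl: "unitary_implementation \<Lambda> \<alpha> U"
begin

lemma \<A>_cstar: "cstar_algebra_on \<A>"
  using cqg unfolding compact_quantum_group_def by blast

lemmas \<A>_bounded' = cstar_algebra_onD(1)[OF \<A>_cstar]
  and \<A>_subspace = cstar_algebra_onD(2)[OF \<A>_cstar]
  and \<A>_closed = cstar_algebra_onD(3)[OF \<A>_cstar]
  and \<A>_id [simp, intro] = cstar_algebra_onD(4)[OF \<A>_cstar]
  and \<A>_compose [simp, intro] = cstar_algebra_onD(5)[OF \<A>_cstar]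
  and \<A>_adj [simp, intro] = cstar_algebra_onD(6)[OF \<A>_cstar]
  and \<A>_scaleC = complex_vector.subspace_scale[OF cstar_algebra_onD(2)[OF \<A>_cstar]]
  and \<A>_sum = complex_vector.subspace_sum[OF cstar_algebra_onD(2)[OF \<A>_cstar]]

lemma \<A>_bounded [simp]: "a \<in> \<A> \<Longrightarrow> a \<in> bounded_ops"
  using \<A>_bounded' by blast

lemma range_lm_bounded: "range lm \<subseteq> bounded_ops"
  by auto

lemma
  shows \<alpha>_mem: "\<alpha> b \<in> range lm \<otimes>\<^sub>s \<A>" and \<alpha>_clinear: "clinear \<alpha>"
    and \<alpha>_mult: "\<alpha> (a * b) = \<alpha> a o\<^sub>L \<alpha> b" and \<alpha>_star: "\<alpha> (star b) = adj (\<alpha> b)"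
    and \<alpha>_one: "\<alpha> 1 = id_blinfun"
    and \<alpha>_coassoc: "tensor_assoc o\<^sub>L
          tensor_lift (range lm) \<A> (\<lambda>s t. \<alpha> (inv lm s) \<otimes>\<^sub>o t) (\<alpha> b) =
        tensor_lift (range lm) \<A> (\<lambda>s t. s \<otimes>\<^sub>o \<Delta> t) (\<alpha> b) o\<^sub>L tensor_assoc"
  using coact unfolding coaction_def by blast+

lemma \<alpha>_bounded [simp, intro]: "\<alpha> b \<in> bounded_ops"
  by (rule tensor_space_bounded[OF \<alpha>_mem range_lm_bounded \<A>_bounded'])

lemma U_bounded [simp, intro]: "U \<in> bounded_ops" and U_left: "adj U o\<^sub>L U = id_blinfun"
  and U_right: "U o\<^sub>L adj U = id_blinfun"
  and U_apply: "blinfun_apply U (\<Lambda> b \<otimes>\<^sub>v \<xi>) = blinfun_apply (\<alpha> b) (\<Lambda> 1 \<otimes>\<^sub>v \<xi>)"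
  using impl unfolding unitary_implementation_def unitary_op_def by auto

lemma adj_U_bounded [simp, intro]: "adj U \<in> bounded_ops"
  by (rule) simp

subsection \<open>Matrix coefficients of the unitary implementation\<close>

text \<open>Evaluation at \<Lambda>(1) recovers b from \<open>lm b\<close>, so slicing against e_i
  and \<Lambda>(1) yields the coefficients. In particular every element of the tensor space is a
  finite sum of elementary tensors.\<close>

lemma expand_range_lm_tensor:
  assumes "X \<in> range lm \<otimes>\<^sub>s \<A>"
  shows "X = (\<Sum>i<N. lm (be i) \<otimes>\<^sub>o (slice (e i) X (\<Lambda> 1)))"
proof -
  \<comment> \<open>Tested on x and \<xi>, the expansion becomes a closed linear condition on X, as
    the induction over the closure demands.\<close>
  define D where "D x \<xi> X = blinfun_apply X (x \<otimes>\<^sub>v \<xi>) -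
      (\<Sum>i<N. blinfun_apply (lket (lm (be i) x)) (blinfun_apply (adj (lket (e i))) (blinfun_apply X (\<Lambda> 1 \<otimes>\<^sub>v \<xi>))))"
    for x \<xi> and X :: "('h, 'k) htensor \<Rightarrow>\<^sub>L ('h, 'k) htensor"
  have D_add: "D x \<xi> (X + Y) = D x \<xi> X + D x \<xi> Y" for x \<xi> X Y
    by (simp add: D_def blinfun.add_left blinfun.add_right sum.distrib tensor_vec_add_right)
  have D_scaleC: "D x \<xi> (c *\<^sub>C X) = c *\<^sub>C D x \<xi> X" for x \<xi> c X
    by (simp add: D_def scaleC_blinfun.rep_eq op_scaleC complex_vector.scale_sum_right
        tensor_vec_scaleC_right complex_vector.scale_right_diff_distrib)
  have D: "\<forall>x \<xi>. D x \<xi> X = 0"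
    using assms
  proof (rule tensor_space_induct)
    show "closed {X. \<forall>x \<xi>. D x \<xi> X = 0}"
      unfolding D_def by (intro closed_Collect_all closed_Collect_eq continuous_intros)
    show "\<forall>x \<xi>. D x \<xi> 0 = 0" by (simp add: D_def)
  next
    fix s t assume s: "s \<in> range lm" and t: "t \<in> \<A>"
    then obtain b where s: "s = lm b" by blast
    show "\<forall>x \<xi>. D x \<xi> (s \<otimes>\<^sub>o t) = 0"
    proof (intro allI)
      fix x \<xi>
      have "lm b x = (\<Sum>i<N. cinner (e i) (\<Lambda> b) *\<^sub>C lm (be i) x)"
        by (subst (1) expand_be[of b]) (simp add: lm_sum lm_scaleC blinfun.sum_left scaleC_blinfun.rep_eq)
      then show "D x \<xi> (s \<otimes>\<^sub>o t) = 0"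
        using t by (simp add: D_def s tensor_op_apply adj_lket_apply tensor_vec_sum_left tensor_vec_scaleC_left
            tensor_vec_scaleC_right)
    qed
  qed (simp_all add: D_add D_scaleC)
  have Xb: "X \<in> bounded_ops" by (rule tensor_space_bounded[OF assms range_lm_bounded \<A>_bounded'])
  show ?thesis
  proof (rule tensor_ext)
    fix x \<xi>
    have "X (x \<otimes>\<^sub>v \<xi>) = (\<Sum>i<N. lket (lm (be i) x) (adj (lket (e i)) (X (\<Lambda> 1 \<otimes>\<^sub>v \<xi>))))"
      using spec[OF spec[OF D, of x], of \<xi>] unfolding D_def eq_iff_diff_eq_0[symmetric] .
    also have "\<dots> = (\<Sum>i<N. lm (be i) \<otimes>\<^sub>o (slice (e i) X (\<Lambda> 1))) (x \<otimes>\<^sub>v \<xi>)"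
      using Xb by (simp add: blinfun.sum_left tensor_op_apply)
    finally show "X (x \<otimes>\<^sub>v \<xi>) = (\<Sum>i<N. lm (be i) \<otimes>\<^sub>o (slice (e i) X (\<Lambda> 1))) (x \<otimes>\<^sub>v \<xi>)" .
  qed (use Xb in \<open>auto intro!: bounded_ops_sum bounded_ops_tensor adj_bounded_ops\<close>)
qed

definition te :: "'b \<Rightarrow> nat \<Rightarrow> ('k \<Rightarrow>\<^sub>L 'k)" where "te b i = slice (e i) (\<alpha> b) (\<Lambda> 1)"

lemma te_mem [simp, intro]: "te b i \<in> \<A>"
  unfolding te_def by (rule slice_in_subspace[OF \<alpha>_mem \<A>_subspace \<A>_closed \<A>_bounded' range_lm_bounded])

lemma \<alpha>_expand: "\<alpha> b = (\<Sum>i<N. lm (be i) \<otimes>\<^sub>o te b i)"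
  unfolding te_def by (rule expand_range_lm_tensor[OF \<alpha>_mem])

definition u :: "nat \<Rightarrow> nat \<Rightarrow> ('k \<Rightarrow>\<^sub>L 'k)" where "u i j = slice (e i) U (e j)"

lemma U_lket: "U o\<^sub>L lket (\<Lambda> b) = \<alpha> b o\<^sub>L lket (\<Lambda> 1)"
  by (rule blinfun_eqI) (simp add: U_apply)

text \<open>The coefficients of U coincide with those of \<alpha>, which is why they belong to the
  algebra.\<close>

lemma te_be: "te (be j) i = u i j"
  using U_lket[of "be j"] by (simp add: te_def u_def op_compose_assoc)

lemma u_mem [simp, intro]: "u i j \<in> \<A>"
  by (simp flip: te_be)

lemma \<alpha>_be: "\<alpha> (be j) = (\<Sum>i<N. lm (be i) \<otimes>\<^sub>o u i j)"
  using \<alpha>_expand[of "be j"] by (simp add: te_be)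

lemma adj_u: "adj (u i j) = slice (e j) (adj U) (e i)"
  by (simp add: u_def adj_compose op_compose_assoc)

text \<open>Inserting a resolution of the identity makes slices multiply like matrix entries, so
  unitarity of U becomes unitarity of the matrix \<open>u\<close>.\<close>

lemma sandwich:
  assumes "i < N" "j < N" and X: "X \<in> bounded_ops" "Y \<in> bounded_ops" "Y o\<^sub>L X = id_blinfun"
  shows "(\<Sum>k<N. (slice (e i) Y (e k)) o\<^sub>L (slice (e k) X (e j))) =
    (if i = j then id_blinfun else (0 :: 'k \<Rightarrow>\<^sub>L 'k))"
proof -
  have "(\<Sum>k<N. (slice (e i) Y (e k)) o\<^sub>L (slice (e k) X (e j))) =
      adj (lket (e i)) o\<^sub>L Y o\<^sub>L (\<Sum>k<N. lket (e k) o\<^sub>L adj (lket (e k))) o\<^sub>L X o\<^sub>L (lket (e j) :: 'k \<Rightarrow>\<^sub>L _)"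
    by (simp add: compose_sum_left compose_sum_right op_compose_assoc)
  also have "\<dots> = slice (e i) (Y o\<^sub>L X) (e j)"
    by (simp add: sum_lket_adj_lket op_compose_assoc)
  also have "\<dots> = (if i = j then id_blinfun else 0)"
    using onb[OF assms(1,2)] by (simp add: X(3) adj_lket_lket scaleC_one)
  finally show ?thesis .
qed

lemma u_unitary:
  assumes "i < N" "j < N"
  shows "(\<Sum>k<N. adj (u k i) o\<^sub>L u k j) = (if i = j then id_blinfun else 0)"
    and "(\<Sum>k<N. u i k o\<^sub>L adj (u j k)) = (if i = j then id_blinfun else 0)"
  unfolding adj_u unfolding u_def
  by (rule sandwich[OF assms]; simp add: U_left U_right)+

lemma \<Delta>_facts:
  shows \<Delta>_mem: "a \<in> \<A> \<Longrightarrow> \<Delta> a \<in> \<A> \<otimes>\<^sub>s \<A>" and \<Delta>_clinear: "clinear_on \<A> \<Delta>"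
    and \<Delta>_mult: "a \<in> \<A> \<Longrightarrow> b \<in> \<A> \<Longrightarrow> \<Delta> (a o\<^sub>L b) = \<Delta> a o\<^sub>L \<Delta> b"
    and \<Delta>_adj: "a \<in> \<A> \<Longrightarrow> \<Delta> (adj a) = adj (\<Delta> a)" and \<Delta>_id: "\<Delta> id_blinfun = id_blinfun"
  using cqg unfolding compact_quantum_group_def by blast+

lemma \<Delta>_bounded [simp, intro]: "a \<in> \<A> \<Longrightarrow> \<Delta> a \<in> bounded_ops"
  by (rule tensor_space_bounded[OF \<Delta>_mem \<A>_bounded' \<A>_bounded'])

lemma norm_\<Delta>_le: "a \<in> \<A> \<Longrightarrow> norm (\<Delta> a) \<le> norm a"
  by (rule star_hom_contractive[OF \<A>_cstar \<Delta>_clinear \<Delta>_id]) (auto simp: \<Delta>_adj \<Delta>_mult)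

lemma ex_lift_range_lm:
  assumes "\<And>a b t. t \<in> \<A> \<Longrightarrow> p (lm (a + b)) t = p (lm a) t + p (lm b) t"
    and "\<And>k a t. t \<in> \<A> \<Longrightarrow> p (lm (k *\<^sub>C a)) t = k *\<^sub>C (p (lm a) t :: 'c::complex_normed_vector)"
    and "\<And>b. clinear_on \<A> (p (lm b))" "\<And>b t. t \<in> \<A> \<Longrightarrow> norm (p (lm b) t) \<le> K b * norm t"
  shows "\<exists>F. clinear_on (range lm \<otimes>\<^sub>s \<A>) F \<and> continuous_on (range lm \<otimes>\<^sub>s \<A>) F \<and>
    (\<forall>s\<in>range lm. \<forall>t\<in>\<A>. F (s \<otimes>\<^sub>o t) = p s t)"
proof (rule ex_tensor_lift[OF \<A>_subspace \<A>_closed \<A>_bounded' range_lm_bounded, where I = "{..<N}"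
      and s = "\<lambda>i. lm (be i)" and a = e and c = "\<lambda>_. \<Lambda> 1"])
  fix x t assume "x \<in> range lm" and t: "t \<in> \<A>"
  then obtain b where x: "x = lm b" by blast
  have z: "p (lm 0) t = 0" using assms(2)[OF t, of 0 0] by simp
  have "p (lm (\<Sum>i\<in>I. k i *\<^sub>C f i)) t = (\<Sum>i\<in>I. k i *\<^sub>C p (lm (f i)) t)" for I and k :: "nat \<Rightarrow> complex" and f
    using z by (induction I rule: infinite_finite_induct) (simp_all add: assms(1,2) t del: lm_zero)
  from this[of "\<lambda>i. cinner (e i) (\<Lambda> b)" be "{..<N}"]
  show "p x t = (\<Sum>i<N. cinner (e i) (x (\<Lambda> 1)) *\<^sub>C p (lm (be i)) t)"
    by (simp add: x flip: expand_be)
next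
  fix i show "continuous_on \<A> (p (lm (be i)))"
    by (rule clinear_on_continuous[OF \<A>_subspace assms(3) assms(4)])
qed (use assms in auto)

text \<open>Coassociativity of \<alpha> at e_j, evaluated on \<Lambda>(1) \<otimes> \<xi> \<otimes>
  \<eta> and paired with e_k in the first leg.\<close>

lemma \<Delta>_u: "j < N \<Longrightarrow> k < N \<Longrightarrow> \<Delta> (u k j) = (\<Sum>i<N. u k i \<otimes>\<^sub>o u i j)"
proof -
  assume k: "k < N"
  have p1: "tensor_lift (range lm) \<A> (\<lambda>s t. \<alpha> (inv lm s) \<otimes>\<^sub>o t) (\<alpha> (be j)) = (\<Sum>i<N. \<alpha> (be i) \<otimes>\<^sub>o u i j)"
    unfolding \<alpha>_be[of j]
  proof (subst tensor_lift_sum[OF ex_lift_range_lm])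
    show "norm (\<alpha> (inv lm (lm b)) \<otimes>\<^sub>o t) \<le> norm (\<alpha> b) * norm t" if "t \<in> \<A>" for b t
      using that by (simp add: norm_tensor_op_le)
  qed (auto simp: clinear_add[OF \<alpha>_clinear] clinear_scaleC[OF \<alpha>_clinear] tensor_op_add_left
      tensor_op_add_right tensor_op_scaleC_left tensor_op_scaleC_right clinear_on_def)
  have p2: "tensor_lift (range lm) \<A> (\<lambda>s t. s \<otimes>\<^sub>o \<Delta> t) (\<alpha> (be j)) = (\<Sum>i<N. lm (be i) \<otimes>\<^sub>o \<Delta> (u i j))"
    unfolding \<alpha>_be[of j]
  proof (subst tensor_lift_sum[OF ex_lift_range_lm])
    show "norm (lm b \<otimes>\<^sub>o \<Delta> t) \<le> norm (lm b) * norm t" if "t \<in> \<A>" for b t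
      by (rule order_trans[OF norm_tensor_op_le]) (use that in \<open>auto intro: mult_left_mono norm_\<Delta>_le\<close>)
    show "clinear_on \<A> (\<lambda>t. lm b \<otimes>\<^sub>o \<Delta> t)" for b
      using \<Delta>_clinear unfolding clinear_on_def by (simp add: tensor_op_add_right tensor_op_scaleC_right)
  qed (auto simp: lm_add lm_scaleC tensor_op_add_left tensor_op_scaleC_left)
  show ?thesis
  proof (rule tensor_ext)
    fix \<xi> \<eta> :: 'k
    have "(tensor_assoc o\<^sub>L (\<Sum>i<N. \<alpha> (be i) \<otimes>\<^sub>o u i j)) ((\<Lambda> 1 \<otimes>\<^sub>v \<xi>) \<otimes>\<^sub>v \<eta>) =
        ((\<Sum>i<N. lm (be i) \<otimes>\<^sub>o \<Delta> (u i j)) o\<^sub>L tensor_assoc) ((\<Lambda> 1 \<otimes>\<^sub>v \<xi>) \<otimes>\<^sub>v \<eta>)"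
      using \<alpha>_coassoc[of "be j"] by (simp only: p1 p2)
    then have "(\<Sum>i<N. \<Sum>l<N. e l \<otimes>\<^sub>v (u l i \<xi> \<otimes>\<^sub>v u i j \<eta>)) = (\<Sum>l<N. e l \<otimes>\<^sub>v \<Delta> (u l j) (\<xi> \<otimes>\<^sub>v \<eta>))"
      by (simp add: blinfun.sum_left blinfun.sum_right tensor_op_apply \<alpha>_be tensor_vec_sum_left)
    then have "adj (lket (e k)) (\<Sum>i<N. \<Sum>l<N. e l \<otimes>\<^sub>v (u l i \<xi> \<otimes>\<^sub>v u i j \<eta>)) =
        adj (lket (e k)) (\<Sum>l<N. e l \<otimes>\<^sub>v \<Delta> (u l j) (\<xi> \<otimes>\<^sub>v \<eta>))" by simp
    then have "(\<Sum>i<N. u k i \<xi> \<otimes>\<^sub>v u i j \<eta>) = \<Delta> (u k j) (\<xi> \<otimes>\<^sub>v \<eta>)"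
      using k by (simp add: blinfun.sum_right adj_lket_apply onb scaleC_one
          if_distrib[where f = "\<lambda>c. c *\<^sub>C _"] cong: if_cong)
    then show "\<Delta> (u k j) (\<xi> \<otimes>\<^sub>v \<eta>) = (\<Sum>i<N. u k i \<otimes>\<^sub>o u i j) (\<xi> \<otimes>\<^sub>v \<eta>)"
      by (simp add: blinfun.sum_left tensor_op_apply)
  qed (auto intro!: bounded_ops_sum)
qed

text \<open>The tensor square of \<open>u\<close>, with the pair \<open>(i, m)\<close> encoded as \<open>i N + m\<close>.\<close>

definition w :: "nat \<Rightarrow> nat \<Rightarrow> ('k \<Rightarrow>\<^sub>L 'k)" where
  "w I L = u (I div N) (L div N) o\<^sub>L u (I mod N) (L mod N)"

lemma w_mem [simp, intro]: "w I L \<in> \<A>"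
  by (simp add: w_def)

lemma w_unitary: "unitary_corepresentation \<A> \<Delta> (N * N) w"
  unfolding unitary_corepresentation_def
proof (intro conjI allI impI)
  fix I L assume I: "I < N * N" and L: "L < N * N"
  then have N: "N > 0" by (cases "N = 0") auto
  define i m k l where "i = I div N" and "m = I mod N" and "k = L div N" and "l = L mod N"
  have b: "i < N" "m < N" "k < N" "l < N"
    using I L N by (auto simp: i_def m_def k_def l_def less_mult_imp_div_less)
  have IL: "I = L \<longleftrightarrow> i = k \<and> m = l"
    unfolding i_def m_def k_def l_def by (metis div_mult_mod_eq)
  show "w I L \<in> \<A>" by simp
  have "\<Delta> (w I L) = (\<Sum>p<N. u i p \<otimes>\<^sub>o u p k) o\<^sub>L (\<Sum>q<N. u m q \<otimes>\<^sub>o u q l)"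
    using b by (simp add: w_def \<Delta>_mult \<Delta>_u i_def m_def k_def l_def)
  also have "\<dots> = (\<Sum>p<N. \<Sum>q<N. (u i p o\<^sub>L u m q) \<otimes>\<^sub>o (u p k o\<^sub>L u q l))"
    by (simp only: compose_sum_left) (simp add: compose_sum_right tensor_op_compose)
  also have "\<dots> = (\<Sum>K<N * N. w I K \<otimes>\<^sub>o w K L)"
    unfolding w_def i_def[symmetric] m_def[symmetric] k_def[symmetric] l_def[symmetric]
    by (rule sum_div_mod[symmetric])
  finally show "\<Delta> (w I L) = (\<Sum>K<N * N. w I K \<otimes>\<^sub>o w K L)" .
  have "(\<Sum>K<N * N. adj (w K I) o\<^sub>L w K L) =
      (\<Sum>p<N. \<Sum>q<N. adj (u p i o\<^sub>L u q m) o\<^sub>L (u p k o\<^sub>L u q l))"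
    unfolding w_def i_def[symmetric] m_def[symmetric] k_def[symmetric] l_def[symmetric]
    by (rule sum_div_mod)
  \<comment> \<open>The adjoint reverses the factors of \<open>w\<close>, so the sum over p is
    innermost and is contracted first.\<close>
  also have "\<dots> = (\<Sum>q<N. adj (u q m) o\<^sub>L (\<Sum>p<N. adj (u p i) o\<^sub>L u p k) o\<^sub>L u q l)"
    by (subst sum.swap) (simp add: adj_compose compose_sum_left compose_sum_right op_compose_assoc)
  also have "\<dots> = (if I = L then id_blinfun else 0)"
    using b by (simp add: u_unitary IL)
  finally show "(\<Sum>K<N * N. adj (w K I) o\<^sub>L w K L) = (if I = L then id_blinfun else 0)" .
  have "(\<Sum>K<N * N. w I K o\<^sub>L adj (w L K)) =
      (\<Sum>p<N. \<Sum>q<N. (u i p o\<^sub>L u m q) o\<^sub>L adj (u k p o\<^sub>L u l q))"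
    unfolding w_def i_def[symmetric] m_def[symmetric] k_def[symmetric] l_def[symmetric]
    by (rule sum_div_mod)
  also have "\<dots> = (\<Sum>p<N. u i p o\<^sub>L (\<Sum>q<N. u m q o\<^sub>L adj (u l q)) o\<^sub>L adj (u k p))"
    by (simp add: adj_compose compose_sum_left compose_sum_right op_compose_assoc)
  also have "\<dots> = (if I = L then id_blinfun else 0)"
    using b by (simp add: u_unitary IL)
  finally show "(\<Sum>K<N * N. w I K o\<^sub>L adj (w L K)) = (if I = L then id_blinfun else 0)" .
qed

subsection \<open>The coaction on operators\<close>

lemma alpha_U_bounded [simp, intro]: "x \<in> bounded_ops \<Longrightarrow> alpha_U U x \<in> bounded_ops"
  by (auto simp: alpha_U_def)

lemma alpha_U_diff: "x \<in> bounded_ops \<Longrightarrow> y \<in> bounded_ops \<Longrightarrow> alpha_U U (x - y) = alpha_U U x - alpha_U U y"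
proof -
  assume xy: "x \<in> bounded_ops" "y \<in> bounded_ops"
  have "(x - y) \<otimes>\<^sub>o id_blinfun = x \<otimes>\<^sub>o id_blinfun - (y \<otimes>\<^sub>o id_blinfun :: ('h, 'k) htensor \<Rightarrow>\<^sub>L _)"
    using tensor_op_add_left[of "x - y" y "id_blinfun :: 'k \<Rightarrow>\<^sub>L 'k"] xy by simp
  then show ?thesis
    by (auto simp: alpha_U_def blinfun.diff_left blinfun.diff_right intro: blinfun_eqI)
qed

lemma alpha_U_add: "x \<in> bounded_ops \<Longrightarrow> y \<in> bounded_ops \<Longrightarrow> alpha_U U (x + y) = alpha_U U x + alpha_U U y"
  by (simp add: alpha_U_def tensor_op_add_left compose_add_left compose_add_right)

lemma alpha_U_scaleC: "x \<in> bounded_ops \<Longrightarrow> alpha_U U (c *\<^sub>C x) = c *\<^sub>C alpha_U U x"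
  by (simp add: alpha_U_def tensor_op_scaleC_left compose_scaleC_left compose_scaleC_right)

lemma alpha_U_zero [simp]: "alpha_U U 0 = 0"
  by (simp add: alpha_U_def)

lemma alpha_U_sum: "(\<And>i. i \<in> I \<Longrightarrow> x i \<in> bounded_ops) \<Longrightarrow> alpha_U U (\<Sum>i\<in>I. x i) = (\<Sum>i\<in>I. alpha_U U (x i))"
  by (induction I rule: infinite_finite_induct) (auto simp: alpha_U_add)

lemma alpha_U_compose:
  assumes "x \<in> bounded_ops" "y \<in> bounded_ops"
  shows "alpha_U U (x o\<^sub>L y) = alpha_U U x o\<^sub>L alpha_U U y"
proof -
  have "alpha_U U x o\<^sub>L alpha_U U y =
      U o\<^sub>L (x \<otimes>\<^sub>o id_blinfun) o\<^sub>L (adj U o\<^sub>L U) o\<^sub>L (y \<otimes>\<^sub>o id_blinfun) o\<^sub>L adj U"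
    by (simp add: alpha_U_def op_compose_assoc)
  also have "\<dots> = U o\<^sub>L ((x \<otimes>\<^sub>o id_blinfun) o\<^sub>L (y \<otimes>\<^sub>o id_blinfun)) o\<^sub>L adj U"
    by (simp add: U_left op_compose_assoc)
  also have "\<dots> = alpha_U U (x o\<^sub>L y)"
    by (simp add: tensor_op_compose assms alpha_U_def)
  finally show ?thesis ..
qed

lemma alpha_U_lm: "alpha_U U (lm b) = \<alpha> b"
proof -
  have "U o\<^sub>L (lm b \<otimes>\<^sub>o id_blinfun) = \<alpha> b o\<^sub>L U"
  proof (rule tensor_ext)
    fix x \<xi>
    show "(U o\<^sub>L (lm b \<otimes>\<^sub>o id_blinfun)) (x \<otimes>\<^sub>v \<xi>) = (\<alpha> b o\<^sub>L U) (x \<otimes>\<^sub>v \<xi>)"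
      using U_apply[of "b * inv \<Lambda> x" \<xi>] U_apply[of "inv \<Lambda> x" \<xi>]
      by (simp add: tensor_op_apply lm_apply \<alpha>_mult)
  qed auto
  then show ?thesis by (simp add: alpha_U_def op_compose_assoc U_right)
qed

lemma alpha_U_omega: "alpha_U U omega = omega \<otimes>\<^sub>o id_blinfun"
proof -
  have 1: "U o\<^sub>L lket (\<Lambda> 1) = lket (\<Lambda> 1)" using U_lket[of 1] by (simp add: \<alpha>_one)
  have 2: "adj (lket (\<Lambda> 1)) o\<^sub>L adj U = adj (lket (\<Lambda> 1))"
    using arg_cong[OF 1, of adj] by (simp add: adj_compose)
  show ?thesis by (simp add: alpha_U_def ketbra_tensor op_compose_assoc 2) (simp add: 1 flip: op_compose_assoc)
qed

lemma alpha_U_A_eq_iff: "alpha_U U A = A \<otimes>\<^sub>o id_blinfun \<longleftrightarrow>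
    U o\<^sub>L (A \<otimes>\<^sub>o id_blinfun) = (A \<otimes>\<^sub>o id_blinfun) o\<^sub>L U"
proof
  assume "alpha_U U A = A \<otimes>\<^sub>o id_blinfun"
  then have "(A \<otimes>\<^sub>o id_blinfun) o\<^sub>L U = U o\<^sub>L (A \<otimes>\<^sub>o id_blinfun) o\<^sub>L (adj U o\<^sub>L U)"
    by (simp add: alpha_U_def op_compose_assoc[symmetric])
  then show "U o\<^sub>L (A \<otimes>\<^sub>o id_blinfun) = (A \<otimes>\<^sub>o id_blinfun) o\<^sub>L U" by (simp add: U_left)
next
  assume "U o\<^sub>L (A \<otimes>\<^sub>o id_blinfun) = (A \<otimes>\<^sub>o id_blinfun) o\<^sub>L U"
  then show "alpha_U U A = A \<otimes>\<^sub>o id_blinfun" by (simp add: alpha_U_def op_compose_assoc U_right)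
qed

text \<open>Slices of the image of a rank-one operator are products of the form u_ik (adj u_jl).
  This places the coaction on operators inside the domain of \<kappa> \<otimes> R.\<close>

lemma alpha_U_mem:
  assumes x: "x \<in> bounded_ops"
  shows "alpha_U U x \<in> bounded_ops \<otimes>\<^sub>s \<A>"
proof -
  have ent: "slice (e i) (alpha_U U x) (e j) \<in> \<A>" for i j
  proof -
    have "slice (e i) (alpha_U U (ketbra (e k) (e l))) (e j) = u i k o\<^sub>L adj (u j l)" for k l
      by (simp add: alpha_U_def ketbra_tensor u_def adj_u op_compose_assoc adj_compose)
    then have "slice (e i) (alpha_U U x) (e j) =
        (\<Sum>k<N. \<Sum>l<N. cinner (e k) (x (e l)) *\<^sub>C (u i k o\<^sub>L adj (u j l)))"
      by (subst op_eq_sum_ketbra[OF x])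
        (simp add: alpha_U_sum alpha_U_scaleC compose_sum_left compose_sum_right compose_scaleC_left
          compose_scaleC_right)
    then show ?thesis by (simp add: \<A>_sum \<A>_scaleC)
  qed
  show ?thesis
    by (subst op_eq_sum_entries) (auto intro!: tensor_space_sum tensor_space_base ent x)
qed

text \<open>Because \<alpha> preserves the star, the starred basis transforms with the adjoints of
  the coefficients.\<close>

lemma U_sv: "U o\<^sub>L lket (sv l) = (\<Sum>j<N. lket (sv j) o\<^sub>L adj (u j l))"
proof -
  have "\<alpha> (star (be l)) = (\<Sum>j<N. lm (star (be j)) \<otimes>\<^sub>o adj (u j l))"
    unfolding \<alpha>_star \<alpha>_be by (simp add: adj_sum adj_tensor_op adj_lm)
  then show ?thesis
    unfolding sv_def U_lket by (simp add: compose_sum_left tensor_compose_lket)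
qed

text \<open>The bra of \<open>op_unit k l\<close> meets \<open>adj U\<close>, which undoes the
  adjoint in \<open>U_sv\<close>. The coefficients are thus products of entries of \<open>u\<close>
  itself, in the order used for \<open>w\<close>.\<close>

lemma slice_alpha_U_op_unit:
  assumes "m < N" "l < N"
  shows "slice (e i) (alpha_U U (op_unit k l)) (cv m) = u i k o\<^sub>L u m l"
proof -
  have "slice (cv m) U (sv l) = (\<Sum>j<N. cinner (cv m) (sv j) *\<^sub>C adj (u j l))"
    by (simp add: op_compose_assoc U_sv compose_sum_right)
      (simp add: op_compose_assoc[symmetric] adj_lket_lket compose_scaleC_left)
  also have "\<dots> = (\<Sum>j<N. if j = m then adj (u j l) else 0)"
    using assms by (intro sum.cong refl) (auto simp: cinner_sv_cv cinner_commute[of "cv m"] scaleC_one)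
  also have "\<dots> = adj (u m l)" using assms by simp
  finally have "slice (cv m) U (sv l) = adj (u m l)" .
  from arg_cong[OF this, of adj]
  have 1: "slice (sv l) (adj U) (cv m) = u m l"
    by (simp add: adj_compose op_compose_assoc)
  have "slice (e i) (alpha_U U (op_unit k l)) (cv m) =
      (slice (e i) U (e k)) o\<^sub>L (slice (sv l) (adj U) (cv m))"
    by (simp add: alpha_U_def op_unit_def ketbra_tensor op_compose_assoc)
  then show ?thesis unfolding 1 by (simp add: u_def)
qed

subsection \<open>Invariant bimodules\<close>

text \<open>The functional \<open>ip y\<close> applied to the first leg.\<close>

definition ip_slice :: "('h \<Rightarrow>\<^sub>L 'h) \<Rightarrow> (('h, 'k) htensor \<Rightarrow>\<^sub>L ('h, 'k) htensor) \<Rightarrow> ('k \<Rightarrow>\<^sub>L 'k)" where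
  "ip_slice y X = (\<Sum>i<N. \<Sum>m<N. cnj (op_coeff y i m) *\<^sub>C (slice (e i) X (cv m)))"

lemma ip_slice_add: "ip_slice y (X + Y) = ip_slice y X + ip_slice y Y"
  by (simp add: ip_slice_def compose_add_left compose_add_right scaleC_add_right sum.distrib)

lemma ip_slice_diff: "ip_slice y (X - Y) = ip_slice y X - ip_slice y Y"
  using ip_slice_add[of y "X - Y" Y] by simp

lemma ip_slice_scaleC: "ip_slice y (c *\<^sub>C X) = c *\<^sub>C ip_slice y X"
  by (simp add: ip_slice_def compose_scaleC_left compose_scaleC_right
      complex_vector.scale_sum_right scaleC_scaleC mult.commute)

lemma ip_slice_diff_left: "ip_slice (y - z) X = ip_slice y X - ip_slice z X"
  by (simp add: ip_slice_def op_coeff_diff complex_vector.scale_left_diff_distrib sum_subtractf)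

lemma ip_slice_tensor: "x \<in> bounded_ops \<Longrightarrow> t \<in> bounded_ops \<Longrightarrow> ip_slice y (x \<otimes>\<^sub>o t) = ip y x *\<^sub>C t"
  by (simp add: ip_slice_def slice_tensor ip_def complex_vector.scale_sum_left scaleC_scaleC op_coeff_def)

text \<open>The right side is the pairing of y with w x in coordinates, the form to which
  \<open>invariant_complement\<close> applies.\<close>

lemma ip_slice_alpha_U:
  assumes x: "x \<in> bounded_ops"
  shows "ip_slice y (alpha_U U x) = (\<Sum>I<N * N. \<Sum>L<N * N.
    (cnj (op_coeff y (I div N) (I mod N)) * op_coeff x (L div N) (L mod N)) *\<^sub>C w I L)"
proof -
  have sl: "slice (e i) (alpha_U U x) (cv m) =
      (\<Sum>k<N. \<Sum>l<N. op_coeff x k l *\<^sub>C (u i k o\<^sub>L u m l))" if "m < N" for i m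
    using that by (subst expand_op_unit[OF x])
      (simp add: alpha_U_sum alpha_U_scaleC compose_sum_left compose_sum_right compose_scaleC_left
        compose_scaleC_right slice_alpha_U_op_unit)
  have "ip_slice y (alpha_U U x) = (\<Sum>i<N. \<Sum>m<N. \<Sum>k<N. \<Sum>l<N. (cnj (op_coeff y i m) * op_coeff x k l) *\<^sub>C (u i k o\<^sub>L u m l))"
    unfolding ip_slice_def
    by (intro sum.cong refl) (simp add: sl complex_vector.scale_sum_right scaleC_scaleC)
  also have "\<dots> = (\<Sum>I<N * N. \<Sum>k<N. \<Sum>l<N. (cnj (op_coeff y (I div N) (I mod N)) * op_coeff x k l) *\<^sub>C (u (I div N) k o\<^sub>L u (I mod N) l))"
    by (rule sum_div_mod[symmetric])
  also have "\<dots> = (\<Sum>I<N * N. \<Sum>L<N * N. (cnj (op_coeff y (I div N) (I mod N)) * op_coeff x (L div N) (L mod N)) *\<^sub>C w I L)"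
    unfolding w_def by (intro sum.cong refl sum_div_mod[symmetric])
  finally show ?thesis .
qed

lemma ip_slice_alpha_U_swap:
  assumes x: "x \<in> bounded_ops" and y: "y \<in> bounded_ops" and z: "ip_slice y (alpha_U U x) = 0"
  shows "ip_slice x (alpha_U U y) = 0"
proof -
  obtain S where S: "is_antipode \<A> \<Delta> S" using antipode unfolding unitary_antipode_def by blast
  show ?thesis
    unfolding ip_slice_alpha_U[OF y]
    by (rule invariant_complement[OF S w_unitary]) (use z in \<open>simp_all add: ip_slice_alpha_U[OF x]\<close>)
qed

lemma ip_slice_annihilates:
  assumes "X \<in> BAB \<otimes>\<^sub>s \<A>" "\<And>x. x \<in> BAB \<Longrightarrow> ip y x = 0"
  shows "ip_slice y X = 0"
  using assms(1)
proof (rule tensor_space_induct)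
  show "closed {X. ip_slice y X = 0}"
    unfolding ip_slice_def by (intro closed_Collect_eq continuous_intros)
  show "ip_slice y (s \<otimes>\<^sub>o t) = 0" if "s \<in> BAB" "t \<in> \<A>" for s t
    using that BAB_subset assms(2) by (simp add: ip_slice_tensor subset_iff)
qed (use ip_slice_scaleC[of y 0 0] in \<open>simp_all add: ip_slice_add ip_slice_scaleC\<close>)

text \<open>Since the orthogonal complement of \<open>B A B\<close> is invariant along with \<open>B A B\<close>, the coaction
  commutes with the orthogonal projection, which maps the invariant operator \<open>\<bar>\<Lambda>(1)\<rangle>\<langle>\<Lambda>(1)\<bar>\<close> to \<open>A\<close>.\<close>

lemma invariant_bimodule_imp_invariant_A:
  assumes inv: "alpha_U U ` BAB \<subseteq> BAB \<otimes>\<^sub>s \<A>"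
  shows "alpha_U U A = A \<otimes>\<^sub>o id_blinfun"
proof -
  \<comment> \<open>The component of \<open>omega\<close> orthogonal to the bimodule.\<close>
  define P where "P = omega - A"
  have P: "P \<in> bounded_ops" by (auto simp: P_def)
  have ipP: "ip P x = 0" if "x \<in> BAB" for x
    using ip_BAB_omega[OF that] cnj_ip[of x P] by (simp add: P_def ip_diff_right)
  have FP: "ip_slice x (alpha_U U P) = 0" if x: "x \<in> BAB" for x
  proof (rule ip_slice_alpha_U_swap)
    show "x \<in> bounded_ops" using x BAB_subset by blast
    then show "ip_slice P (alpha_U U x) = 0" using inv x by (intro ip_slice_annihilates ipP) auto
  qed (rule P)
  have AP: "alpha_U U A = omega \<otimes>\<^sub>o id_blinfun - alpha_U U P"
    using alpha_U_omega by (simp add: P_def alpha_U_diff)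
  \<comment> \<open>As \<open>y - schur y\<close> is orthogonal to the bimodule, it annihilates
    \<open>alpha_U U A\<close>, and y may be replaced by \<open>schur y\<close>. Against that
    element the contribution of \<open>P\<close> vanishes by \<open>FP\<close>, and only the
    invariant \<open>omega\<close> is left.\<close>
  have key: "ip_slice y (alpha_U U A) = ip y A *\<^sub>C id_blinfun" if y: "y \<in> bounded_ops" for y
  proof -
    have Ey: "schur y \<in> BAB" by (rule schur_in_BAB[OF y])
    have "ip_slice (y - schur y) (alpha_U U A) = 0"
    proof (rule ip_slice_annihilates)
      show "alpha_U U A \<in> BAB \<otimes>\<^sub>s \<A>" using inv A_in_BAB by auto
      fix x assume "x \<in> BAB"
      then show "ip (y - schur y) x = 0"
        using ip_schur[OF y, of x] schur_BAB[of x] BAB_subset by (auto simp: ip_diff_left)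
    qed
    then have "ip_slice y (alpha_U U A) = ip_slice (schur y) (alpha_U U A)" by (simp add: ip_slice_diff_left)
    also have "\<dots> = ip (schur y) omega *\<^sub>C id_blinfun"
      unfolding AP ip_slice_diff using FP[OF Ey] by (simp add: ip_slice_tensor)
    also have "ip (schur y) omega = ip (schur y) A" by (rule ip_BAB_omega[OF Ey])
    also have "\<dots> = ip y A" using ip_schur[OF y A_bounded] by (simp add: schur_A)
    finally show ?thesis .
  qed
  \<comment> \<open>Testing with the orthonormal \<open>op_unit i m\<close> reads off single
    entries, so that \<open>key\<close> determines the whole operator.\<close>
  have ip_slice_op_unit: "ip_slice (op_unit i m) X = slice (e i) X (cv m)" if "i < N" "m < N" for i m X
  proof -
    have "ip_slice (op_unit i m) X = (\<Sum>i'<N. if i' = i then (\<Sum>m'<N. if m' = m then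
        (slice (e i') X (cv m')) else 0) else 0)"
      unfolding ip_slice_def
    proof (intro sum.cong refl)
      fix i' assume "i' \<in> {..<N}"
      moreover have "cnj (if C then 1 else 0) *\<^sub>C T = (if C then T else 0)" for C and T :: "'k \<Rightarrow>\<^sub>L 'k"
        by (simp add: scaleC_one)
      ultimately show "(\<Sum>m'<N. cnj (op_coeff (op_unit i m) i' m') *\<^sub>C (slice (e i') X (cv m'))) =
          (if i' = i then (\<Sum>m'<N. if m' = m then (slice (e i') X (cv m')) else 0) else 0)"
        using that by (cases "i' = i") (simp_all add: op_coeff_op_unit)
    qed
    then show ?thesis using that by simp
  qed
  have ent: "adj (lket (e i)) (alpha_U U A (cv m \<otimes>\<^sub>v \<xi>)) = adj (lket (e i)) ((A \<otimes>\<^sub>o id_blinfun) (cv m \<otimes>\<^sub>v \<xi>))"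
    if "i < N" "m < N" for i m \<xi>
  proof -
    have "ip_slice (op_unit i m) (alpha_U U A) = ip_slice (op_unit i m) (A \<otimes>\<^sub>o id_blinfun)" by (simp add: key ip_slice_tensor)
    then have "slice (e i) (alpha_U U A) (cv m) = slice (e i) (A \<otimes>\<^sub>o id_blinfun) (cv m)"
      unfolding ip_slice_op_unit[OF that] .
    from arg_cong[OF this, of "\<lambda>T. blinfun_apply T \<xi>"] show ?thesis by simp
  qed
  have cvx: "alpha_U U A (cv m \<otimes>\<^sub>v \<xi>) = (A \<otimes>\<^sub>o id_blinfun) (cv m \<otimes>\<^sub>v \<xi>)" if "m < N" for m \<xi>
  proof -
    have "X v = (\<Sum>i<N. lket (e i) (adj (lket (e i)) (X v)))" for X :: "('h, 'k) htensor \<Rightarrow>\<^sub>L ('h, 'k) htensor" and v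
      using arg_cong[OF sum_lket_adj_lket, of "\<lambda>T. blinfun_apply T (X v)"] by (simp add: blinfun.sum_left)
    then show ?thesis using ent that by (metis (no_types, lifting) lessThan_iff sum.cong)
  qed
  show ?thesis
  proof (rule tensor_ext)
    fix x and \<xi> :: 'k
    have "X (x \<otimes>\<^sub>v \<xi>) = (\<Sum>l<N. cinner (sv l) x *\<^sub>C X (cv l \<otimes>\<^sub>v \<xi>))"
      if "X \<in> bounded_ops" for X :: "('h, 'k) htensor \<Rightarrow>\<^sub>L ('h, 'k) htensor"
      by (subst expand_cv[of x]) (simp add: tensor_vec_sum_left tensor_vec_scaleC_left blinfun.sum_right op_scaleC that)
    then show "alpha_U U A (x \<otimes>\<^sub>v \<xi>) = (A \<otimes>\<^sub>o id_blinfun) (x \<otimes>\<^sub>v \<xi>)" by (simp add: cvx)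
  qed auto
qed

text \<open>Both \<alpha>(a) and \<alpha>(b) are finite sums of elementary tensors, so their product
  around A \<otimes> 1 is again a finite sum with first legs in \<open>BAB\<close>.\<close>

lemma invariant_A_imp_invariant_bimodule:
  assumes "alpha_U U A = A \<otimes>\<^sub>o id_blinfun"
  shows "alpha_U U ` BAB \<subseteq> BAB \<otimes>\<^sub>s \<A>"
proof -
  have "x \<in> bounded_ops \<and> alpha_U U x \<in> BAB \<otimes>\<^sub>s \<A>" if "x \<in> BAB" for x
    using that unfolding BAB_def
  proof (induction rule: complex_vector.span_induct_alt)
    case base
    show ?case using tensor_space_zero by simp
  next
    case (step c x y)
    then obtain a b where x: "x = lm a o\<^sub>L A o\<^sub>L lm b" by blast
    have xb: "x \<in> bounded_ops" unfolding x by auto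
    have "alpha_U U x = (\<Sum>i<N. lm (be i) \<otimes>\<^sub>o te a i) o\<^sub>L (A \<otimes>\<^sub>o id_blinfun) o\<^sub>L (\<Sum>j<N. lm (be j) \<otimes>\<^sub>o te b j)"
      unfolding x by (simp add: alpha_U_compose alpha_U_lm assms flip: \<alpha>_expand)
    also have "\<dots> = (\<Sum>i<N. \<Sum>j<N. (lm (be i) o\<^sub>L A o\<^sub>L lm (be j)) \<otimes>\<^sub>o (te a i o\<^sub>L te b j))"
      by (simp only: compose_sum_left) (simp add: compose_sum_right tensor_op_compose)
    also have "\<dots> \<in> BAB \<otimes>\<^sub>s \<A>" by (intro tensor_space_sum tensor_space_base BAB_base) auto
    finally have "alpha_U U x \<in> BAB \<otimes>\<^sub>s \<A>" .
    then show ?case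
      using step(2) xb unfolding BAB_def[symmetric]
      by (auto simp: alpha_U_add alpha_U_scaleC intro!: tensor_space_add
          tensor_space_scaleC)
  qed
  then show ?thesis by blast
qed

subsection \<open>The opposite coaction\<close>

lemma
  shows R_mem [simp, intro]: "a \<in> \<A> \<Longrightarrow> R a \<in> \<A>" and R_clinear: "clinear_on \<A> R"
    and R_mult: "a \<in> \<A> \<Longrightarrow> b \<in> \<A> \<Longrightarrow> R (a o\<^sub>L b) = R b o\<^sub>L R a"
    and R_adj: "a \<in> \<A> \<Longrightarrow> R (adj a) = adj (R a)" and R_R [simp]: "a \<in> \<A> \<Longrightarrow> R (R a) = a"
  using antipode unfolding unitary_antipode_def by blast+

text \<open>Apply R to the product of 1 and R 1: involutivity gives 1, and the reversed product
  gives R 1.\<close>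

lemma R_id: "R id_blinfun = id_blinfun"
  using R_mult[of id_blinfun "R id_blinfun"] by simp

lemma norm_R_le: "a \<in> \<A> \<Longrightarrow> norm (R a) \<le> norm a"
  by (rule star_hom_contractive[OF \<A>_cstar R_clinear R_id]) (auto simp: R_adj R_mult)

section \<open>The involution \<kappa> \<otimes> R\<close>

definition KR :: "(('h, 'k) htensor \<Rightarrow>\<^sub>L ('h, 'k) htensor) \<Rightarrow> (('h, 'k) htensor \<Rightarrow>\<^sub>L ('h, 'k) htensor)"
  where "KR = tensor_lift bounded_ops \<A> (\<lambda>s t. \<kappa> s \<otimes>\<^sub>o R t)"

lemma ex_KR: "\<exists>F. clinear_on (bounded_ops \<otimes>\<^sub>s \<A>) F \<and> continuous_on (bounded_ops \<otimes>\<^sub>s \<A>) F \<and>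
    (\<forall>s\<in>bounded_ops. \<forall>t\<in>\<A>. F (s \<otimes>\<^sub>o t) = \<kappa> s \<otimes>\<^sub>o R t)"
proof (rule ex_tensor_lift[OF \<A>_subspace \<A>_closed \<A>_bounded' order_refl, where I = "{..<N} \<times> {..<N}"
      and s = "\<lambda>(i, j). ketbra (e i) (e j)" and a = "\<lambda>(i, j). e i" and c = "\<lambda>(i, j). e j"])
  fix p :: "nat \<times> nat"
  obtain i j where p: "p = (i, j)" by (cases p)
  show lin: "clinear_on \<A> (\<lambda>t. \<kappa> (case p of (i, j) \<Rightarrow> ketbra (e i) (e j)) \<otimes>\<^sub>o R t)"
    using R_clinear unfolding clinear_on_def p by (simp add: tensor_op_add_right tensor_op_scaleC_right)
  show "continuous_on \<A> (\<lambda>t. \<kappa> (case p of (i, j) \<Rightarrow> ketbra (e i) (e j)) \<otimes>\<^sub>o R t)"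
  proof (rule clinear_on_continuous[OF \<A>_subspace lin])
    fix t assume "t \<in> \<A>"
    then show "norm (\<kappa> (case p of (i, j) \<Rightarrow> ketbra (e i) (e j)) \<otimes>\<^sub>o R t) \<le> norm (\<kappa> (ketbra (e i) (e j))) * norm t"
      unfolding p by (intro order_trans[OF norm_tensor_op_le]) (auto intro: mult_left_mono norm_R_le)
  qed
next
  fix x :: "'h \<Rightarrow>\<^sub>L 'h" and t assume x: "x \<in> bounded_ops" and t: "t \<in> \<A>"
  have ks: "\<kappa> (\<Sum>i\<in>I. f i) = (\<Sum>i\<in>I. \<kappa> (f i))" if "\<And>i. i \<in> I \<Longrightarrow> f i \<in> bounded_ops" for I and f :: "nat \<Rightarrow> _"
    using that by (induction I rule: infinite_finite_induct) (auto simp: kappa_add)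
  have "\<kappa> x = (\<Sum>i<N. \<Sum>j<N. cinner (e i) (x (e j)) *\<^sub>C \<kappa> (ketbra (e i) (e j)))"
    by (subst op_eq_sum_ketbra[OF x]) (simp add: ks kappa_scaleC)
  then have "\<kappa> x \<otimes>\<^sub>o R t = (\<Sum>i<N. \<Sum>j<N. cinner (e i) (x (e j)) *\<^sub>C (\<kappa> (ketbra (e i) (e j)) \<otimes>\<^sub>o R t))"
    using t by (simp add: tensor_op_sum_left tensor_op_scaleC_left)
  then show "\<kappa> x \<otimes>\<^sub>o R t = (\<Sum>p\<in>{..<N} \<times> {..<N}. cinner (case p of (i, j) \<Rightarrow> e i) (x (case p of (i, j) \<Rightarrow> e j)) *\<^sub>C
      (\<kappa> (case p of (i, j) \<Rightarrow> ketbra (e i) (e j)) \<otimes>\<^sub>o R t))"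
    by (simp add: sum.cartesian_product case_prod_unfold)
qed auto

lemmas KR_clinear = tensor_lift_clinear[OF ex_KR, folded KR_def]
  and KR_continuous = tensor_lift_continuous[OF ex_KR, folded KR_def]
  and KR_tensor = tensor_lift_tensor[OF ex_KR, folded KR_def]

lemma KR_zero [simp]: "KR 0 = 0"
proof -
  have "0 \<in> bounded_ops \<otimes>\<^sub>s \<A>" by (rule tensor_space_zero)
  then have "KR (0 *\<^sub>C 0) = 0 *\<^sub>C KR 0" using KR_clinear unfolding clinear_on_def by blast
  then show ?thesis by simp
qed

lemma KR_mem:
  assumes S: "S \<subseteq> bounded_ops" and X: "X \<in> S \<otimes>\<^sub>s \<A>" and k: "\<kappa> ` S \<subseteq> S'"
  shows "KR X \<in> S' \<otimes>\<^sub>s \<A>"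
proof -
  have sub: "S \<otimes>\<^sub>s \<A> \<subseteq> bounded_ops \<otimes>\<^sub>s \<A>" using S by (intro tensor_space_mono) auto
  have "KR Y \<in> S' \<otimes>\<^sub>s \<A>" if "Y \<in> cspan {s \<otimes>\<^sub>o t | s t. s \<in> S \<and> t \<in> \<A>}" for Y
  proof -
    \<comment> \<open>Linearity of \<open>KR\<close> is known on this tensor space, so membership is
      part of the induction.\<close>
    have "Y \<in> bounded_ops \<otimes>\<^sub>s \<A> \<and> KR Y \<in> S' \<otimes>\<^sub>s \<A>"
      using that
    proof (induction rule: complex_vector.span_induct_alt)
      case base
      show ?case by (simp add: tensor_space_zero)
    next
      case (step c X Y)
      then obtain s t where X: "X = s \<otimes>\<^sub>o t" "s \<in> S" "t \<in> \<A>" by blast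
      have "X \<in> bounded_ops \<otimes>\<^sub>s \<A>" using X S by (auto intro!: tensor_space_base)
      moreover have "KR X \<in> S' \<otimes>\<^sub>s \<A>"
        using X S k by (auto simp: KR_tensor subset_iff intro!: tensor_space_base)
      moreover have "c *\<^sub>C X \<in> bounded_ops \<otimes>\<^sub>s \<A>"
        using calculation(1) by (rule tensor_space_scaleC)
      ultimately show ?case
        using step(2) KR_clinear unfolding clinear_on_def
        by (auto intro!: tensor_space_add
            tensor_space_scaleC)
    qed
    then show ?thesis ..
  qed
  then have "KR ` (S \<otimes>\<^sub>s \<A>) \<subseteq> S' \<otimes>\<^sub>s \<A>"
    using continuous_on_subset[OF KR_continuous sub] closed_tensor_space
    unfolding tensor_space_def[of S] by (intro image_closure_subset) auto
  then show ?thesis using X by blast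
qed

lemma KR_KR: "X \<in> bounded_ops \<otimes>\<^sub>s \<A> \<Longrightarrow> KR (KR X) = X"
proof -
  let ?T = "bounded_ops \<otimes>\<^sub>s \<A>"
  note sub = csubspace_tensor_space[of bounded_ops \<A>]
  have mem: "KR X \<in> ?T" if "X \<in> ?T" for X
    using that by (rule KR_mem[OF order_refl]) auto
  have cont: "continuous_on ?T (\<lambda>X. KR (KR X) - X)"
    by (intro continuous_intros continuous_on_compose2[OF KR_continuous KR_continuous]) (use mem in auto)
  \<comment> \<open>The closed set is formed inside \<open>?T\<close>, since continuity of
    \<open>KR\<close> is known there.\<close>
  have cl: "closed {X \<in> ?T. KR (KR X) - X = 0}"
    by (rule continuous_closed_preimage_constant[OF cont closed_tensor_space])
  assume "X \<in> ?T"
  then have "X \<in> ?T \<and> KR (KR X) - X = 0"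
  proof (rule tensor_space_induct)
    show "closed {X. X \<in> ?T \<and> KR (KR X) - X = 0}" using cl .
    show "0 \<in> ?T \<and> KR (KR 0) - 0 = 0" by (simp add: tensor_space_zero)
    have lin: "KR (X + Y) = KR X + KR Y" "KR (c *\<^sub>C X) = c *\<^sub>C KR X" if "X \<in> ?T" "Y \<in> ?T" for X Y c
      using that KR_clinear unfolding clinear_on_def by auto
    show "X + Y \<in> ?T \<and> KR (KR (X + Y)) - (X + Y) = 0"
      if "X \<in> ?T \<and> KR (KR X) - X = 0" "Y \<in> ?T \<and> KR (KR Y) - Y = 0" for X Y
      using that mem by (simp add: lin complex_vector.subspace_add[OF sub])
    show "c *\<^sub>C X \<in> ?T \<and> KR (KR (c *\<^sub>C X)) - c *\<^sub>C X = 0" if "X \<in> ?T \<and> KR (KR X) - X = 0" for c X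
      using that mem lin(2)[of X X] lin(2)[of "KR X" "KR X"] by (simp add: complex_vector.subspace_scale[OF sub])
    show "s \<otimes>\<^sub>o t \<in> ?T \<and> KR (KR (s \<otimes>\<^sub>o t)) - s \<otimes>\<^sub>o t = 0" if "s \<in> bounded_ops" "t \<in> \<A>" for s t
      using that by (auto simp: KR_tensor intro!: tensor_space_base)
  qed
  then show "KR (KR X) = X" by simp
qed

lemma alpha_U_op_eq: "alpha_U_op \<A> R \<Lambda> Q U x = KR (alpha_U U (\<kappa> x))"
  by (simp add: alpha_U_op_def KR_def)

text \<open>The map \<kappa> \<otimes> R exchanges the tensor spaces over S and over its image under
  \<kappa>. For the converse it is applied a second time, and \<open>alpha_U_mem\<close> lets the
  two applications cancel.\<close>

lemma opposite_invariance:
  assumes S: "S \<subseteq> bounded_ops"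
  shows "alpha_U U ` (\<kappa> ` S) \<subseteq> (\<kappa> ` S) \<otimes>\<^sub>s \<A> \<longleftrightarrow> alpha_U_op \<A> R \<Lambda> Q U ` S \<subseteq> S \<otimes>\<^sub>s \<A>"
proof safe
  fix x assume inv: "alpha_U U ` \<kappa> ` S \<subseteq> (\<kappa> ` S) \<otimes>\<^sub>s \<A>" and x: "x \<in> S"
  then have "alpha_U U (\<kappa> x) \<in> (\<kappa> ` S) \<otimes>\<^sub>s \<A>" by blast
  moreover have "\<kappa> ` \<kappa> ` S \<subseteq> S" using S by (auto simp: subset_iff)
  moreover have "\<kappa> ` S \<subseteq> bounded_ops" using S by auto
  ultimately show "alpha_U_op \<A> R \<Lambda> Q U x \<in> S \<otimes>\<^sub>s \<A>"
    unfolding alpha_U_op_eq by (intro KR_mem)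
next
  fix x assume inv: "alpha_U_op \<A> R \<Lambda> Q U ` S \<subseteq> S \<otimes>\<^sub>s \<A>" and x: "x \<in> S"
  have xb: "x \<in> bounded_ops" using x S by blast
  have "KR (alpha_U U (\<kappa> x)) \<in> S \<otimes>\<^sub>s \<A>" using inv x by (auto simp: alpha_U_op_eq)
  then have "KR (KR (alpha_U U (\<kappa> x))) \<in> (\<kappa> ` S) \<otimes>\<^sub>s \<A>" by (rule KR_mem[OF S]) simp
  then show "alpha_U U (\<kappa> x) \<in> (\<kappa> ` S) \<otimes>\<^sub>s \<A>"
    by (simp add: KR_KR alpha_U_mem xb)
qed

end

theorem theorem9p18:
  fixes r :: nat and n :: "nat \<Rightarrow> nat" and E :: "nat \<Rightarrow> nat \<Rightarrow> nat \<Rightarrow> 'b::cstar_algebra"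
    and \<psi> :: "'b \<Rightarrow> complex" and Q :: 'b and \<Lambda> :: "'b \<Rightarrow> 'h::chilbert_space"
    and A :: "('k::chilbert_space \<Rightarrow>\<^sub>L 'k) set"
    and \<Delta> :: "('k \<Rightarrow>\<^sub>L 'k) \<Rightarrow> (('k, 'k) htensor \<Rightarrow>\<^sub>L ('k, 'k) htensor)"
    and R :: "('k \<Rightarrow>\<^sub>L 'k) \<Rightarrow> ('k \<Rightarrow>\<^sub>L 'k)"
    and \<alpha> :: "'b \<Rightarrow> (('h, 'k) htensor \<Rightarrow>\<^sub>L ('h, 'k) htensor)"
    and U :: "('h, 'k) htensor \<Rightarrow>\<^sub>L ('h, 'k) htensor"
    and A\<^sub>G :: "'h \<Rightarrow>\<^sub>L 'h"
    and S\<^sub>0 :: "('h \<Rightarrow>\<^sub>L 'h) set"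
  assumes "matrix_units r n E"
    and "faithful_state \<psi>"
    and "positive_invertible Q" and "\<And>a. \<psi> a = block_trace r n E (Q * a)"
    and "gns_map \<psi> \<Lambda>"
    and "compact_quantum_group A \<Delta>" and "unitary_antipode A \<Delta> R"
    and "coaction A \<Delta> \<Lambda> \<alpha>" and "preserves_state A \<Lambda> \<psi> \<alpha>"
    and "unitary_implementation \<Lambda> \<alpha> U"
    and "A\<^sub>G \<in> bounded_ops" and "adj A\<^sub>G = A\<^sub>G"
    and "mult_op \<Lambda> o\<^sub>L (A\<^sub>G \<otimes>\<^sub>o A\<^sub>G) o\<^sub>L adj (mult_op \<Lambda>) = A\<^sub>G"
    and "right_unitor o\<^sub>L (id_blinfun \<otimes>\<^sub>o (adj (unit_op \<Lambda>) o\<^sub>L mult_op \<Lambda>))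
           o\<^sub>L (id_blinfun \<otimes>\<^sub>o A\<^sub>G \<otimes>\<^sub>o id_blinfun) o\<^sub>L tensor_assoc
           o\<^sub>L ((adj (mult_op \<Lambda>) o\<^sub>L unit_op \<Lambda>) \<otimes>\<^sub>o id_blinfun) o\<^sub>L adj left_unitor = A\<^sub>G"
    and "S\<^sub>0 = commutant_bimodule \<Lambda> A\<^sub>G"
  shows "(U o\<^sub>L (A\<^sub>G \<otimes>\<^sub>o id_blinfun) = (A\<^sub>G \<otimes>\<^sub>o id_blinfun) o\<^sub>L U
            \<longleftrightarrow> alpha_U U ` (kappa \<Lambda> Q ` S\<^sub>0) \<subseteq> (kappa \<Lambda> Q ` S\<^sub>0) \<otimes>\<^sub>s A) \<and>
         (alpha_U U ` (kappa \<Lambda> Q ` S\<^sub>0) \<subseteq> (kappa \<Lambda> Q ` S\<^sub>0) \<otimes>\<^sub>s A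
            \<longleftrightarrow> alpha_U_op A R \<Lambda> Q U ` S\<^sub>0 \<subseteq> S\<^sub>0 \<otimes>\<^sub>s A)"
proof -
  have lin: "clinear \<Lambda>" and bij: "bij \<Lambda>"
    using \<open>gns_map \<psi> \<Lambda>\<close> unfolding gns_map_def by auto
  interpret \<Lambda>: Vector_Spaces.linear "(*\<^sub>C)" "(*\<^sub>C)" \<Lambda> by (rule lin)
  \<comment> \<open>The images of the matrix units span L^2(B), which supplies the finite
    orthonormal basis fixed by the locales.\<close>
  have "cspan (\<Lambda> ` {E k i j | k i j. k < r \<and> i < n k \<and> j < n k}) = UNIV"
    using \<Lambda>.span_image matrix_unitsD(3)[OF \<open>matrix_units r n E\<close>] bij_is_surj[OF bij] by simp
  then obtain N and e :: "nat \<Rightarrow> 'h" where "finite_onb N e"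
    using ex_finite_onb[OF finite_imageI[OF finite_matrix_units]] by blast
  then interpret quantum_graph_coaction N e r n E \<psi> Q \<Lambda> A\<^sub>G A \<Delta> R \<alpha> U
    using assms
    by (simp add: quantum_graph_coaction_def quantum_graph_coaction_axioms_def quantum_graph_def
        quantum_graph_axioms_def gns_def gns_axioms_def)
  show ?thesis
    using opposite_invariance[OF commutant_bimodule_subset] alpha_U_A_eq_iff
      invariant_bimodule_imp_invariant_A invariant_A_imp_invariant_bimodule
    unfolding \<open>S\<^sub>0 = commutant_bimodule \<Lambda> A\<^sub>G\<close> kappa_commutant_bimodule by blast
qed

end
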